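(* Let $G$ be a non-elementary hyperbolic group and let $X$ be its Cayley graph with respect to a finite symmetric generating system $S$. Then there exists on $G$ a symmetric probability measure $\mu$ (i.e. $\mu(g^{-1})=\mu(g)$ for all $g \in G$) with a finite first moment, whose support generates $G$, and such that the associated harmonic measure on $\partial G$ and the Hausdorff measure on $\partial G$ (with respect to the metric $d_a$) are mutually singular.
   Context: A finitely generated group $G$ is hyperbolic if its Cayley graph $X$ with respect to a finite symmetric generating system $S$, with the metric $d$ that restricts to the word metric on $G$ and makes each edge isometric to $[0,1]$, is a hyperbolic space: there is $\delta\ge 0$ such that, with $(x|y)_o=\frac12[d(o,x)+d(o,y)-d(x,y)]$, one has $(x|z)_o\ge\min\{(x|y)_o,(y|z)_o\}-\delta$ for all $x,y,z,o\in X$. $G$ acts on $X$ by left multiplication. A base point $o\in X$ is fixed and $(x|y):=(x|y)_o$. The hyperbolic boundary $\partial G=\partial X$ is the set of geodesic rays modulo equivalence (two rays are equivalent if they stay at bounded distance); the Gromov product extends to $X\cup\partial X$ by $(x|y)=\inf\liminf_n(x_n|y_n)$ over sequences $x_n\to x$, $y_n\to y$ in $X$, and $X\cup\partial X$ carries its usual compact topology, in which $x_n\to\xi\in\partial X$ iff $(\xi|x_n)\to\infty$. $G$ is non-elementary if $\partial G$ (the limit set of $G$) has more than two points. Metric: a parameter $a>1$ (in the admissible range $1<a<a_0$) and a metric $d_a$ on $X\cup\partial X$ inducing on it the usual compact topology of $X\cup\partial X$ (in which $x_n\to\xi\in\partial X$ iff $(\xi|x_n)\to\infty$) are fixed, such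 that for some constant $\lambda>0$: $d_a(x,y)\le\lambda a^{-(x|y)}$ for all $x,y\in X\cup\partial X$, and $d_a(x,y)\ge\lambda^{-1}a^{-(x|y)}$ for all $x,y\in\partial X$. Hausdorff measure: for $Z\subset\partial G$ and $\alpha\ge0$, $m_H(Z,\alpha)=\lim_{\epsilon\to0}\inf\sum_U(\operatorname{diam}U)^\alpha$, the infimum being over covers of $Z$ by open sets of diameter at most $\epsilon$. Let $D=\dim_H(\partial G)$ be the Hausdorff dimension of $(\partial G,d_a)$. It is known that $D=e_a(G)=\limsup_{R\to\infty}\frac{1}{R}\log_a\operatorname{card}\{g\in G:d(o,go)\le R\}$ and that $0<m_H(\partial G,D)<\infty$; the Hausdorff measure on $\partial G$ is the probability measure obtained by normalizing $Z\mapsto m_H(Z,D)$. Finite first moment: $\sum_{g\in G}\mu(g)d(o,go)<\infty$. Random walk: $x_0=e$, $x_n=h_1\cdots h_n$ with $(h_i)$ i.i.d. of law $\mu$. When the support of $\mu$ generates $G$, $x_no$ converges almost surely to a point $x_\infty\in\partial X$ (known fact); the harmonic measure is the distribution of $x_\infty$. *)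

theory Defs
  imports "HOL-Probability.Probability" "HOL-Algebra.Generated_Groups"
begin

section \<open>Gromov hyperbolic metric spaces\<close>

text \<open>A metric space is given by a carrier \<open>X\<close> and a distance \<open>d\<close>; \<open>b\<close> is the base point.\<close>

definition gromov_product :: "('p \<Rightarrow> 'p \<Rightarrow> real) \<Rightarrow> 'p \<Rightarrow> 'p \<Rightarrow> 'p \<Rightarrow> real" where
  "gromov_product d b x y = (d b x + d b y - d x y) / 2"

definition gromov_hyperbolic :: "'p set \<Rightarrow> ('p \<Rightarrow> 'p \<Rightarrow> real) \<Rightarrow> bool" where
  "gromov_hyperbolic X d \<longleftrightarrow>
     (\<exists>\<delta>\<ge>0. \<forall>x\<in>X. \<forall>y\<in>X. \<forall>z\<in>X. \<forall>b\<in>X.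
        gromov_product d b x z \<ge> min (gromov_product d b x y) (gromov_product d b y z) - \<delta>)"

text \<open>Only the values of a ray on \<open>[0, \<infinity>)\<close> matter: rays that agree there are equivalent.\<close>

definition geodesic_rays :: "'p set \<Rightarrow> ('p \<Rightarrow> 'p \<Rightarrow> real) \<Rightarrow> (real \<Rightarrow> 'p) set" where
  "geodesic_rays X d =
     {c. (\<forall>t\<ge>0. c t \<in> X) \<and> (\<forall>s\<ge>0. \<forall>t\<ge>0. d (c s) (c t) = \<bar>s - t\<bar>)}"

definition ray_equiv :: "'p set \<Rightarrow> ('p \<Rightarrow> 'p \<Rightarrow> real) \<Rightarrow> ((real \<Rightarrow> 'p) \<times> (real \<Rightarrow> 'p)) set" where
  "ray_equiv X d =
     {(c, c'). c \<in> geodesic_rays X d \<and> c' \<in> geodesic_rays X d \<and>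
               (\<exists>B. \<forall>t\<ge>0. d (c t) (c' t) \<le> B)}"

text \<open>The union of \<open>X\<close> and its boundary is a set of tagged elements:
  \<open>Inl x\<close> is the point \<open>x\<close> of \<open>X\<close>, \<open>Inr C\<close> is the boundary point given by the class \<open>C\<close> of rays.\<close>

type_synonym 'p bord = "'p + (real \<Rightarrow> 'p) set"

definition hyp_boundary :: "'p set \<Rightarrow> ('p \<Rightarrow> 'p \<Rightarrow> real) \<Rightarrow> 'p bord set" where
  "hyp_boundary X d = Inr ` (geodesic_rays X d // ray_equiv X d)"

definition bordification :: "'p set \<Rightarrow> ('p \<Rightarrow> 'p \<Rightarrow> real) \<Rightarrow> 'p bord set" where
  "bordification X d = Inl ` X \<union> hyp_boundary X d"

text \<open>Convergence of sequences in \<open>X\<close>, as needed to extend the Gromov product: \<open>x\<^sub>n\<close> converges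
  to the class of the ray \<open>c\<close> iff \<open>(x\<^sub>n | c(m))\<close> tends to infinity as \<open>n, m\<close> do.\<close>

definition seq_converges :: "('p \<Rightarrow> 'p \<Rightarrow> real) \<Rightarrow> 'p \<Rightarrow> (nat \<Rightarrow> 'p) \<Rightarrow> 'p bord \<Rightarrow> bool" where
  "seq_converges d b xs \<xi> =
     (case \<xi> of
        Inl x \<Rightarrow> (\<lambda>n. d (xs n) x) \<longlonglongrightarrow> 0
      | Inr C \<Rightarrow> (\<exists>c\<in>C. filterlim (\<lambda>(n, m). gromov_product d b (xs n) (c (real m)))
                        at_top (sequentially \<times>\<^sub>F sequentially)))"

definition ext_gromov_product ::
    "'p set \<Rightarrow> ('p \<Rightarrow> 'p \<Rightarrow> real) \<Rightarrow> 'p \<Rightarrow> 'p bord \<Rightarrow> 'p bord \<Rightarrow> ereal" where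
  "ext_gromov_product X d b \<xi> \<eta> =
     Inf {liminf (\<lambda>n. ereal (gromov_product d b (xs n) (ys n))) | xs ys.
            (\<forall>n. xs n \<in> X \<and> ys n \<in> X) \<and> seq_converges d b xs \<xi> \<and> seq_converges d b ys \<eta>}"

text \<open>The usual topology: \<open>X\<close> is an open subspace with its metric topology, and the sets
  \<open>{\<eta>. (\<xi>|\<eta>) > r}\<close> are a neighbourhood base at a boundary point \<open>\<xi>\<close>.\<close>

definition bord_open :: "'p set \<Rightarrow> ('p \<Rightarrow> 'p \<Rightarrow> real) \<Rightarrow> 'p \<Rightarrow> 'p bord set \<Rightarrow> bool" where
  "bord_open X d b U \<longleftrightarrow>
     U \<subseteq> bordification X d \<and> openin (Metric_space.mtopology X d) (Inl -` U) \<and>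
     (\<forall>\<xi> \<in> U \<inter> hyp_boundary X d. \<exists>r::real.
        {\<eta> \<in> bordification X d. ext_gromov_product X d b \<xi> \<eta> > ereal r} \<subseteq> U)"

definition bord_topology :: "'p set \<Rightarrow> ('p \<Rightarrow> 'p \<Rightarrow> real) \<Rightarrow> 'p \<Rightarrow> 'p bord topology" where
  "bord_topology X d b = topology (bord_open X d b)"

lemma istopology_bord_open: "istopology (bord_open X d b)"
proof -
  define N where
    "N \<xi> r = {\<eta> \<in> bordification X d. ext_gromov_product X d b \<xi> \<eta> > ereal r}" for \<xi> r
  have N_mono: "N \<xi> s \<subseteq> N \<xi> r" if "r \<le> s" for \<xi> r s
  proof
    fix \<eta> assume "\<eta> \<in> N \<xi> s"
    moreover have "ereal r \<le> ereal s" using that by simp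
    ultimately show "\<eta> \<in> N \<xi> r"
      unfolding N_def by (metis (no_types, lifting) le_less_trans mem_Collect_eq)
  qed
  have iff: "bord_open X d b U \<longleftrightarrow>
      U \<subseteq> bordification X d \<and> openin (Metric_space.mtopology X d) (Inl -` U) \<and>
      (\<forall>\<xi> \<in> U \<inter> hyp_boundary X d. \<exists>r. N \<xi> r \<subseteq> U)" for U
    by (simp only: bord_open_def N_def)
  have bord_openI: "bord_open X d b U"
    if "U \<subseteq> bordification X d" "openin (Metric_space.mtopology X d) (Inl -` U)"
       "\<And>\<xi>. \<xi> \<in> U \<Longrightarrow> \<xi> \<in> hyp_boundary X d \<Longrightarrow> \<exists>r. N \<xi> r \<subseteq> U" for U
    unfolding iff using that by simp
  have bord_openD: "U \<subseteq> bordification X d" "openin (Metric_space.mtopology X d) (Inl -` U)"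
      "\<And>\<xi>. \<xi> \<in> U \<Longrightarrow> \<xi> \<in> hyp_boundary X d \<Longrightarrow> \<exists>r. N \<xi> r \<subseteq> U"
    if "bord_open X d b U" for U
    using that unfolding iff by simp_all
  show ?thesis
    unfolding istopology_def
  proof (intro conjI allI impI)
    fix U V assume U: "bord_open X d b U" and V: "bord_open X d b V"
    show "bord_open X d b (U \<inter> V)"
    proof (rule bord_openI)
      show "U \<inter> V \<subseteq> bordification X d"
        using bord_openD(1)[OF U] by (rule le_infI1)
      show "openin (Metric_space.mtopology X d) (Inl -` (U \<inter> V))"
        unfolding vimage_Int by (intro openin_Int bord_openD(2) U V)
      fix \<xi> assume "\<xi> \<in> U \<inter> V" and \<xi>: "\<xi> \<in> hyp_boundary X d"
      then have "\<xi> \<in> U" "\<xi> \<in> V" by simp_all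
      then obtain r s where "N \<xi> r \<subseteq> U" "N \<xi> s \<subseteq> V"
        using bord_openD(3)[OF U _ \<xi>] bord_openD(3)[OF V _ \<xi>] by metis
      moreover have "N \<xi> (max r s) \<subseteq> N \<xi> r" "N \<xi> (max r s) \<subseteq> N \<xi> s"
        by (intro N_mono max.cobounded1 max.cobounded2)+
      ultimately have "N \<xi> (max r s) \<subseteq> U \<inter> V" by (metis le_infI order_trans)
      then show "\<exists>r. N \<xi> r \<subseteq> U \<inter> V" ..
    qed
  next
    fix \<K> assume K: "\<forall>U\<in>\<K>. bord_open X d b U"
    show "bord_open X d b (\<Union>\<K>)"
    proof (rule bord_openI)
      show "\<Union>\<K> \<subseteq> bordification X d"
        using bord_openD(1) K by (intro Union_least) simp
      show "openin (Metric_space.mtopology X d) (Inl -` \<Union>\<K>)"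
        unfolding vimage_Union using bord_openD(2) K by (intro openin_Union) force
      fix \<xi> assume "\<xi> \<in> \<Union>\<K>" and \<xi>: "\<xi> \<in> hyp_boundary X d"
      then obtain U where U: "U \<in> \<K>" "\<xi> \<in> U" by (elim UnionE)
      then obtain r where "N \<xi> r \<subseteq> U"
        using bord_openD(3)[OF _ U(2) \<xi>] K by metis
      then have "N \<xi> r \<subseteq> \<Union>\<K>" using U(1) by (metis Union_upper order_trans)
      then show "\<exists>r. N \<xi> r \<subseteq> \<Union>\<K>" ..
    qed
  qed
qed

lemma openin_bord_topology: "openin (bord_topology X d b) U \<longleftrightarrow> bord_open X d b U"
  by (simp add: bord_topology_def istopology_bord_open)

definition boundary_topology :: "'p set \<Rightarrow> ('p \<Rightarrow> 'p \<Rightarrow> real) \<Rightarrow> 'p \<Rightarrow> 'p bord topology" where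
  "boundary_topology X d b = subtopology (bord_topology X d b) (hyp_boundary X d)"

text \<open>\<open>exp_neg a t\<close> is \<open>a\<^sup>-\<^sup>t\<close>, with value \<open>0\<close> for \<open>t = \<infinity>\<close>.\<close>

definition exp_neg :: "real \<Rightarrow> ereal \<Rightarrow> real" where
  "exp_neg a t = (if t = \<infinity> then 0 else a powr (- real_of_ereal t))"

definition visual_metric ::
    "'p set \<Rightarrow> ('p \<Rightarrow> 'p \<Rightarrow> real) \<Rightarrow> 'p \<Rightarrow> real \<Rightarrow> ('p bord \<Rightarrow> 'p bord \<Rightarrow> real) \<Rightarrow> bool" where
  "visual_metric X d b a da \<longleftrightarrow>
     Metric_space (bordification X d) da \<and>
     Metric_space.mtopology (bordification X d) da = bord_topology X d b \<and>
     (\<exists>C>0.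
        (\<forall>x \<in> bordification X d. \<forall>y \<in> bordification X d.
           da x y \<le> C * exp_neg a (ext_gromov_product X d b x y)) \<and>
        (\<forall>x \<in> hyp_boundary X d. \<forall>y \<in> hyp_boundary X d.
           da x y \<ge> inverse C * exp_neg a (ext_gromov_product X d b x y)))"


section \<open>Hausdorff measure\<close>

definition ediam :: "('q \<Rightarrow> 'q \<Rightarrow> real) \<Rightarrow> 'q set \<Rightarrow> ennreal" where
  "ediam d U = (SUP x\<in>U. SUP y\<in>U. ennreal (d x y))"

text \<open>The summand \<open>(diam U)\<^sup>\<alpha>\<close>, only used for sets of finite diameter. The empty set, which pads
  finite covers, contributes nothing, and \<open>0\<^sup>0 = 1\<close> for nonempty sets (whereas \<open>0 powr 0 = 0\<close>).\<close>

definition diam_pow :: "('q \<Rightarrow> 'q \<Rightarrow> real) \<Rightarrow> real \<Rightarrow> 'q set \<Rightarrow> ennreal" where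
  "diam_pow d \<alpha> U =
     (if U = {} then 0 else if \<alpha> = 0 then 1 else ennreal (enn2real (ediam d U) powr \<alpha>))"

definition hausdorff_measure ::
    "'q set \<Rightarrow> ('q \<Rightarrow> 'q \<Rightarrow> real) \<Rightarrow> 'q set \<Rightarrow> real \<Rightarrow> ennreal" where
  "hausdorff_measure M d Z \<alpha> =
     Lim (at_right 0) (\<lambda>\<epsilon>::real.
       Inf {(\<Sum>n. diam_pow d \<alpha> (U n)) | U :: nat \<Rightarrow> 'q set.
              (\<forall>n. openin (Metric_space.mtopology M d) (U n) \<and> ediam d (U n) \<le> ennreal \<epsilon>) \<and>
              Z \<subseteq> (\<Union>n. U n)})"

definition hausdorff_dim :: "'q set \<Rightarrow> ('q \<Rightarrow> 'q \<Rightarrow> real) \<Rightarrow> real" where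
  "hausdorff_dim M d = Inf {\<alpha>. 0 \<le> \<alpha> \<and> hausdorff_measure M d M \<alpha> = 0}"

definition borel_of :: "'q topology \<Rightarrow> 'q measure" where
  "borel_of T = sigma (topspace T) {U. openin T U}"

text \<open>The normalized Hausdorff measure in the dimension of the space, on the Borel sets.\<close>

definition hausdorff_prob :: "'q set \<Rightarrow> ('q \<Rightarrow> 'q \<Rightarrow> real) \<Rightarrow> 'q measure" where
  "hausdorff_prob M d =
     measure_of M (sets (borel_of (Metric_space.mtopology M d)))
       (\<lambda>Z. hausdorff_measure M d Z (hausdorff_dim M d) /
            hausdorff_measure M d M (hausdorff_dim M d))"

definition mutually_singular :: "'q measure \<Rightarrow> 'q measure \<Rightarrow> bool" where
  "mutually_singular M N \<longleftrightarrow>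
     sets M = sets N \<and> (\<exists>A\<in>sets M. emeasure M A = 0 \<and> emeasure N (space N - A) = 0)"


section \<open>Cayley graphs and hyperbolic groups\<close>

definition symmetric_generating_system :: "('g, 'm) monoid_scheme \<Rightarrow> 'g set \<Rightarrow> bool" where
  "symmetric_generating_system G S \<longleftrightarrow>
     S \<subseteq> carrier G \<and> (\<forall>s\<in>S. inv\<^bsub>G\<^esub> s \<in> S) \<and> generate G S = carrier G"

definition word_length :: "('g, 'm) monoid_scheme \<Rightarrow> 'g set \<Rightarrow> 'g \<Rightarrow> nat" where
  "word_length G S g =
     (LEAST n. \<exists>ws. set ws \<subseteq> S \<and> length ws = n \<and> foldr (\<otimes>\<^bsub>G\<^esub>) ws \<one>\<^bsub>G\<^esub> = g)"

definition word_dist :: "('g, 'm) monoid_scheme \<Rightarrow> 'g set \<Rightarrow> 'g \<Rightarrow> 'g \<Rightarrow> nat" where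
  "word_dist G S g h = word_length G S (inv\<^bsub>G\<^esub> g \<otimes>\<^bsub>G\<^esub> h)"

text \<open>A point of the geometric realization is given by its barycentric coordinates, a function
  on the vertices: the point at parameter \<open>t \<in> [0,1]\<close> of the edge from \<open>g\<close> to \<open>h\<close> is
  \<open>(1 - t) g + t h\<close>. In particular the two orientations of an edge give the same points, there is
  one edge between two adjacent vertices, and there are no loops, even if \<open>S\<close> contains the identity.\<close>

definition vertex :: "'g \<Rightarrow> 'g \<Rightarrow> real" where
  "vertex g = (\<lambda>k. if k = g then 1 else 0)"

definition edge_point :: "'g \<Rightarrow> 'g \<Rightarrow> real \<Rightarrow> 'g \<Rightarrow> real" where
  "edge_point g h t = (\<lambda>k. (1 - t) * vertex g k + t * vertex h k)"

definition cayley_edges :: "('g, 'm) monoid_scheme \<Rightarrow> 'g set \<Rightarrow> ('g \<Rightarrow> real) set set" where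
  "cayley_edges G S = {edge_point g (g \<otimes>\<^bsub>G\<^esub> s) ` {0..1} | g s. g \<in> carrier G \<and> s \<in> S}"

definition cayley_graph :: "('g, 'm) monoid_scheme \<Rightarrow> 'g set \<Rightarrow> ('g \<Rightarrow> real) set" where
  "cayley_graph G S = vertex ` carrier G \<union> \<Union> (cayley_edges G S)"

text \<open>The length metric. Two points of a common edge are at distance the difference of their
  parameters, which is half the \<open>\<ell>\<^sup>1\<close>-distance of the coordinates. Otherwise a shortest path leaves
  the edge of \<open>x\<close> at one of its ends \<open>g\<close>, at distance \<open>1 - x g\<close> from \<open>x\<close>, and enters the edge of
  \<open>y\<close> at one of its ends \<open>h\<close>.\<close>

definition cayley_dist ::
    "('g, 'm) monoid_scheme \<Rightarrow> 'g set \<Rightarrow> ('g \<Rightarrow> real) \<Rightarrow> ('g \<Rightarrow> real) \<Rightarrow> real" where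
  "cayley_dist G S x y =
     (if \<exists>E\<in>cayley_edges G S. x \<in> E \<and> y \<in> E
      then (\<Sum>k | x k \<noteq> 0 \<or> y k \<noteq> 0. \<bar>x k - y k\<bar>) / 2
      else Min {(1 - x g) + real (word_dist G S g h) + (1 - y h) | g h. x g \<noteq> 0 \<and> y h \<noteq> 0})"

definition cayley_act :: "('g, 'm) monoid_scheme \<Rightarrow> 'g \<Rightarrow> ('g \<Rightarrow> real) \<Rightarrow> ('g \<Rightarrow> real)" where
  "cayley_act G g x = (\<lambda>k. if k \<in> carrier G then x (inv\<^bsub>G\<^esub> g \<otimes>\<^bsub>G\<^esub> k) else 0)"

definition hyperbolic_group :: "('g, 'm) monoid_scheme \<Rightarrow> bool" where
  "hyperbolic_group G \<longleftrightarrow>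
     group G \<and> (\<exists>S. finite S \<and> symmetric_generating_system G S \<and>
                    gromov_hyperbolic (cayley_graph G S) (cayley_dist G S))"

abbreviation cayley_boundary ::
    "('g, 'm) monoid_scheme \<Rightarrow> 'g set \<Rightarrow> ('g \<Rightarrow> real) bord set" where
  "cayley_boundary G S \<equiv> hyp_boundary (cayley_graph G S) (cayley_dist G S)"

lemma (in group) cayley_act_vertex:
  assumes "g \<in> carrier G" "h \<in> carrier G"
  shows "cayley_act G g (vertex h) = vertex (g \<otimes> h)"
proof
  fix k
  have "inv g \<otimes> k = h \<longleftrightarrow> k = g \<otimes> h" if "k \<in> carrier G"
    using assms that by (metis inv_solve_left)
  then show "cayley_act G g (vertex h) k = vertex (g \<otimes> h) k"
    using assms by (auto simp: cayley_act_def vertex_def)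
qed

lemma cayley_dist_edge:
  assumes "g \<in> carrier G" "u \<in> S" "g \<noteq> g \<otimes>\<^bsub>G\<^esub> u" "s \<in> {0..1}" "t \<in> {0..1}"
  shows "cayley_dist G S (edge_point g (g \<otimes>\<^bsub>G\<^esub> u) s) (edge_point g (g \<otimes>\<^bsub>G\<^esub> u) t) = \<bar>s - t\<bar>"
proof -
  let ?h = "g \<otimes>\<^bsub>G\<^esub> u"
  let ?x = "edge_point g ?h s" and ?y = "edge_point g ?h t"
  have E: "\<exists>E\<in>cayley_edges G S. ?x \<in> E \<and> ?y \<in> E"
  proof (rule bexI)
    show "?x \<in> edge_point g ?h ` {0..1} \<and> ?y \<in> edge_point g ?h ` {0..1}"
      using assms(4,5) by blast
    show "edge_point g ?h ` {0..1} \<in> cayley_edges G S"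
      using assms(1,2) unfolding cayley_edges_def by blast
  qed
  have "(\<Sum>k | ?x k \<noteq> 0 \<or> ?y k \<noteq> 0. \<bar>?x k - ?y k\<bar>) = (\<Sum>k\<in>{g, ?h}. \<bar>?x k - ?y k\<bar>)"
    by (rule sum.mono_neutral_left) (auto simp: edge_point_def vertex_def split: if_splits)
  also have "\<dots> = 2 * \<bar>s - t\<bar>"
    using assms(3) by (simp add: edge_point_def vertex_def)
  finally show ?thesis
    unfolding cayley_dist_def if_P[OF E] by simp
qed

lemma (in group) cayley_dist_vertex:
  assumes "symmetric_generating_system G S" "g \<in> carrier G" "h \<in> carrier G"
  shows "cayley_dist G S (vertex g) (vertex h) = real (word_dist G S g h)"
proof (cases "\<exists>E\<in>cayley_edges G S. vertex g \<in> E \<and> vertex h \<in> E")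
  case False
  have "{(1 - vertex g g') + real (word_dist G S g' h') + (1 - vertex h h') | g' h'.
          vertex g g' \<noteq> 0 \<and> vertex h h' \<noteq> 0} = {real (word_dist G S g h)}"
    by (auto simp: vertex_def)
  then show ?thesis
    unfolding cayley_dist_def if_not_P[OF False] by (simp only: Min_singleton)
next
  case True
  have S: "S \<subseteq> carrier G" and inv: "\<And>s. s \<in> S \<Longrightarrow> inv s \<in> S"
    using assms(1) by (auto simp: symmetric_generating_system_def)
  have d: "cayley_dist G S (vertex g) (vertex h) = (if g = h then 0 else 1)"
  proof -
    have "(\<Sum>k | vertex g k \<noteq> 0 \<or> vertex h k \<noteq> 0. \<bar>vertex g k - vertex h k\<bar>)
        = (\<Sum>k\<in>{g, h}. \<bar>vertex g k - vertex h k\<bar>)"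
      by (rule sum.mono_neutral_left) (auto simp: vertex_def split: if_splits)
    also have "\<dots> = (if g = h then 0 else 2)"
      by (simp add: vertex_def)
    finally show ?thesis
      unfolding cayley_dist_def if_P[OF True] by simp
  qed
  show ?thesis
  proof (cases "g = h")
    case True
    have "word_length G S \<one> = 0"
      unfolding word_length_def by (rule Least_eq_0) auto
    with True d assms show ?thesis
      by (simp add: word_dist_def)
  next
    case False
    obtain k s p q where E: "k \<in> carrier G" "s \<in> S"
      "vertex g = edge_point k (k \<otimes> s) p" "vertex h = edge_point k (k \<otimes> s) q"
      using True unfolding cayley_edges_def by blast
    have "g = k \<or> g = k \<otimes> s"
      using fun_cong[OF E(3), of g] by (auto simp: edge_point_def vertex_def split: if_splits)
    moreover have "h = k \<or> h = k \<otimes> s"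
      using fun_cong[OF E(4), of h] by (auto simp: edge_point_def vertex_def split: if_splits)
    ultimately have gh: "(g = k \<and> h = k \<otimes> s) \<or> (g = k \<otimes> s \<and> h = k)"
      using False by blast
    have s: "s \<in> carrier G" using E(2) S by blast
    have "inv (k \<otimes> s) \<otimes> k = inv s"
      using E(1) s by (simp add: inv_mult_group m_assoc)
    moreover have "inv k \<otimes> (k \<otimes> s) = s"
      using E(1) s by (simp flip: m_assoc)
    ultimately have w: "inv g \<otimes> h \<in> S"
      using gh E(2) inv[OF E(2)] by (elim disjE conjE) simp_all
    have "inv g \<otimes> h \<noteq> \<one>"
    proof
      assume "inv g \<otimes> h = \<one>"
      then have "g \<otimes> \<one> = h"
        using assms(2,3) by (metis inv_solve_left one_closed)
      then show False using False assms(2) by simp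
    qed
    then have ne: "foldr (\<otimes>) [] \<one> \<noteq> inv g \<otimes> h" by simp
    have "word_length G S (inv g \<otimes> h) = 1"
      unfolding word_length_def
    proof (rule Least_equality)
      show "\<exists>ws. set ws \<subseteq> S \<and> length ws = 1 \<and> foldr (\<otimes>) ws \<one> = inv g \<otimes> h"
        using w assms by (intro exI[of _ "[inv g \<otimes> h]"]) simp
    next
      fix n assume "\<exists>ws. set ws \<subseteq> S \<and> length ws = n \<and> foldr (\<otimes>) ws \<one> = inv g \<otimes> h"
      then show "1 \<le> n"
        using ne by (metis length_0_conv less_one not_le)
    qed
    with d False show ?thesis
      by (simp add: word_dist_def)
  qed
qed


section \<open>Random walks and harmonic measure\<close>

primrec random_walk :: "('g, 'm) monoid_scheme \<Rightarrow> (nat \<Rightarrow> 'g) \<Rightarrow> nat \<Rightarrow> 'g" where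
  "random_walk G h 0 = \<one>\<^bsub>G\<^esub>"
| "random_walk G h (Suc n) = random_walk G h n \<otimes>\<^bsub>G\<^esub> h n"

text \<open>The space of i.i.d. increments of law \<open>\<mu>\<close>. The restriction to the (countable) carrier
  makes the partial products measurable, since the product is arbitrary outside the carrier.\<close>

definition increments :: "('g, 'm) monoid_scheme \<Rightarrow> 'g pmf \<Rightarrow> (nat \<Rightarrow> 'g) measure" where
  "increments G \<mu> = (\<Pi>\<^sub>M i\<in>(UNIV :: nat set). restrict_space (measure_pmf \<mu>) (carrier G))"

text \<open>The limit of \<open>x\<^sub>n b\<close>; where there is none (a null set, if the support of \<open>\<mu>\<close>
  generates \<open>G\<close>), some fixed boundary point is used.\<close>

definition walk_limit ::
    "('g, 'm) monoid_scheme \<Rightarrow> 'g set \<Rightarrow> ('g \<Rightarrow> real) \<Rightarrow> (nat \<Rightarrow> 'g) \<Rightarrow> ('g \<Rightarrow> real) bord" where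
  "walk_limit G S b h =
     (let L = (\<lambda>\<xi>. \<xi> \<in> cayley_boundary G S \<and>
                   limitin (bord_topology (cayley_graph G S) (cayley_dist G S) b)
                     (\<lambda>n. Inl (cayley_act G (random_walk G h n) b)) \<xi> sequentially)
      in if \<exists>\<xi>. L \<xi> then THE \<xi>. L \<xi> else SOME \<xi>. \<xi> \<in> cayley_boundary G S)"

definition harmonic_measure ::
    "('g, 'm) monoid_scheme \<Rightarrow> 'g set \<Rightarrow> ('g \<Rightarrow> real) \<Rightarrow> 'g pmf \<Rightarrow> ('g \<Rightarrow> real) bord measure" where
  "harmonic_measure G S b \<mu> =
     distr (increments G \<mu>)
       (borel_of (boundary_topology (cayley_graph G S) (cayley_dist G S) b))
       (walk_limit G S b)"

end

theory Submission
  imports Defs "HOL-Real_Asymp.Real_Asymp"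
begin

text \<open>The step distribution mixes rare long jumps of all scales: at scale \<open>j\<close>, jumps of length about
  \<open>l j\<close> occur at rate about \<open>2 powr (-j) / l j\<close>, which keeps the first moment finite. Within the first
  \<open>N j\<close> steps, a number of order \<open>4 powr j * l j\<close>, such a jump occurs with high probability, while the
  walk stays in a ball of radius linear in \<open>l j\<close>. The jumps at scale \<open>j\<close> are drawn from a set whose
  cardinality does not depend on \<open>l j\<close>, with directions spread out enough that the jump hardly cancels with
  the rest of the path. Hence almost every limit point lies, for all large \<open>j\<close>, in the shadow of \<open>y w\<close>
  for some \<open>y\<close> in that ball and some jump \<open>w\<close> of scale \<open>j\<close> with \<open>len (y w)\<close> close to
  \<open>len y + len w\<close>. If the Hausdorff measure of the boundary in dimension \<open>D\<close> is positive and finite, then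
  spheres of radius \<open>n\<close> have at most of order \<open>a powr (D * n)\<close> elements, so these shadows have total cost
  of order \<open>l j * a powr (-D * l j)\<close>, which tends to zero. Neither the convergence of the walk nor any
  entropy estimate is needed.\<close>

section \<open>Word metrics\<close>

text \<open>The cost estimate works because the path before a jump is almost free: summed over a
  ball, \<open>a powr (- D * len y)\<close> grows only linearly in the radius, while the jump takes
  boundedly many values and gains the full factor \<open>a powr (- D * len w)\<close>. For this the
  number of jumps, the cancellation constant and the failure probability of a scale are fixed before
  its length, which is then taken as large as required. Spread directions need a boundary point with
  infinite orbit. The obstacle is a group fixing a boundary point: it would have linear growth,
  which is incompatible with infinitely many boundary points. Hyperbolicity is given for some
  generating system but needed for \<open>S\<close>, which calls for the Morse lemma. Positivity,
  finiteness and even countable additivity of the Hausdorff measure are not hypotheses: where one of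
  them fails, \<open>hausdorff_prob\<close> gives the whole boundary mass zero and singularity is
  immediate.\<close>

locale word_metric = group G for G :: "('g, 'm) monoid_scheme" (structure) +
  fixes S :: "'g set"
  assumes finite_gens: "finite S"
    and generating_system: "symmetric_generating_system G S"
begin

abbreviation len :: "'g \<Rightarrow> real" where
  "len g \<equiv> real (word_length G S g)"

abbreviation wd :: "'g \<Rightarrow> 'g \<Rightarrow> real" where
  "wd g h \<equiv> real (word_dist G S g h)"

lemma gens_closed: "s \<in> S \<Longrightarrow> s \<in> carrier G"
  and gens_inv: "s \<in> S \<Longrightarrow> inv s \<in> S"
  and generate_gens: "generate G S = carrier G"
  using generating_system by (auto simp: symmetric_generating_system_def)

abbreviation word_prod :: "'g list \<Rightarrow> 'g" where
  "word_prod ws \<equiv> foldr (\<otimes>) ws \<one>"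

lemma word_prod_closed: "set ws \<subseteq> S \<Longrightarrow> word_prod ws \<in> carrier G"
  by (induction ws) (auto intro: gens_closed)

lemma word_prod_append:
  "set us \<subseteq> S \<Longrightarrow> set ws \<subseteq> S \<Longrightarrow> word_prod (us @ ws) = word_prod us \<otimes> word_prod ws"
proof (induction us)
  case Nil
  then show ?case using word_prod_closed by simp
next
  case (Cons u us)
  then show ?case
    using word_prod_closed[of us] word_prod_closed[of ws] word_prod_closed[of "us @ ws"]
    by (simp add: gens_closed m_assoc)
qed

lemma word_prod_rev:
  "set ws \<subseteq> S \<Longrightarrow> word_prod (rev (map (\<lambda>x. inv x) ws)) = inv (word_prod ws)"
proof (induction ws)
  case (Cons w ws)
  have s: "set (rev (map (\<lambda>x. inv x) ws)) \<subseteq> S" "set [inv w] \<subseteq> S"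
    using Cons.prems gens_inv by auto
  have "word_prod (rev (map (\<lambda>x. inv x) (w # ws))) = word_prod (rev (map (\<lambda>x. inv x) ws)) \<otimes> word_prod [inv w]"
    using word_prod_append[OF s] by simp
  then show ?case
    using Cons word_prod_closed[of ws] by (simp add: gens_closed inv_mult_group)
qed simp

lemma word_exists:
  assumes "g \<in> carrier G" shows "\<exists>ws. set ws \<subseteq> S \<and> word_prod ws = g"
proof -
  have "g \<in> generate G S" using assms generate_gens by simp
  then show ?thesis
  proof induction
    case one
    show ?case by (rule exI[of _ "[]"]) simp
  next
    case (incl h)
    then show ?case by (intro exI[of _ "[h]"]) (simp add: gens_closed)
  next
    case (inv h)
    then show ?case by (intro exI[of _ "[inv h]"]) (simp add: gens_closed gens_inv)
  next
    case (eng h1 h2)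
    then obtain us ws where "set us \<subseteq> S" "word_prod us = h1" "set ws \<subseteq> S" "word_prod ws = h2"
      by blast
    then show ?case by (intro exI[of _ "us @ ws"]) (simp add: word_prod_append del: foldr_append)
  qed
qed

lemma word_length_witness:
  assumes "g \<in> carrier G"
  obtains ws where "set ws \<subseteq> S" "length ws = word_length G S g" "word_prod ws = g"
proof -
  have "\<exists>n ws. set ws \<subseteq> S \<and> length ws = n \<and> word_prod ws = g"
    using word_exists[OF assms] by blast
  then have "\<exists>ws. set ws \<subseteq> S \<and> length ws = word_length G S g \<and> word_prod ws = g"
    unfolding word_length_def by (rule LeastI_ex)
  then show thesis using that by blast
qed

lemma word_length_le: "set ws \<subseteq> S \<Longrightarrow> word_prod ws = g \<Longrightarrow> word_length G S g \<le> length ws"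
  unfolding word_length_def by (rule Least_le) blast

lemma word_length_one [simp]: "word_length G S \<one> = 0"
  using word_length_le[of "[]" "\<one>"] by simp

lemma word_length_eq_0: "g \<in> carrier G \<Longrightarrow> word_length G S g = 0 \<longleftrightarrow> g = \<one>"
  by (metis word_length_witness foldr.simps(1) id_apply length_0_conv word_length_one)

lemma word_length_mult:
  assumes "g \<in> carrier G" "h \<in> carrier G"
  shows "word_length G S (g \<otimes> h) \<le> word_length G S g + word_length G S h"
proof -
  obtain us where us: "set us \<subseteq> S" "length us = word_length G S g" "word_prod us = g"
    using word_length_witness[OF assms(1)] .
  obtain ws where ws: "set ws \<subseteq> S" "length ws = word_length G S h" "word_prod ws = h"
    using word_length_witness[OF assms(2)] .
  show ?thesis
    using word_length_le[of "us @ ws" "g \<otimes> h"] us ws by (simp add: word_prod_append del: foldr_append)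
qed

lemma word_length_inv [simp]:
  assumes "g \<in> carrier G" shows "word_length G S (inv g) = word_length G S g"
proof -
  have le: "word_length G S (inv g) \<le> word_length G S g" if g: "g \<in> carrier G" for g
  proof -
    obtain ws where ws: "set ws \<subseteq> S" "length ws = word_length G S g" "word_prod ws = g"
      using word_length_witness[OF g] .
    have "set (rev (map (\<lambda>x. inv x) ws)) \<subseteq> S" using ws gens_inv by auto
    from word_length_le[OF this, of "inv g"] show ?thesis using word_prod_rev ws by simp
  qed
  show ?thesis using le[OF assms] le[of "inv g"] assms by simp
qed

lemma wd_one_left [simp]: "g \<in> carrier G \<Longrightarrow> wd \<one> g = len g"
  and wd_self [simp]: "g \<in> carrier G \<Longrightarrow> wd g g = 0"
  by (simp_all add: word_dist_def)

lemma wd_one_right [simp]: "g \<in> carrier G \<Longrightarrow> wd g \<one> = len g"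
  by (simp add: word_dist_def)

lemma word_dist_commute:
  assumes "g \<in> carrier G" "h \<in> carrier G" shows "word_dist G S g h = word_dist G S h g"
proof -
  have "inv (inv g \<otimes> h) = inv h \<otimes> g" using assms by (simp add: inv_mult_group)
  then show ?thesis
    unfolding word_dist_def using assms word_length_inv[of "inv g \<otimes> h"] by simp
qed

lemma word_dist_triangle:
  assumes "g \<in> carrier G" "h \<in> carrier G" "k \<in> carrier G"
  shows "word_dist G S g k \<le> word_dist G S g h + word_dist G S h k"
proof -
  have "inv g \<otimes> k = (inv g \<otimes> h) \<otimes> (inv h \<otimes> k)"
    using assms by (metis inv_closed inv_solve_left m_assoc m_closed)
  then show ?thesis
    unfolding word_dist_def using word_length_mult[of "inv g \<otimes> h" "inv h \<otimes> k"] assms by simp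
qed

lemma wd_triangle:
  "g \<in> carrier G \<Longrightarrow> h \<in> carrier G \<Longrightarrow> k \<in> carrier G \<Longrightarrow> wd g k \<le> wd g h + wd h k"
  using word_dist_triangle[of g h k] by linarith

lemma wd_commute: "g \<in> carrier G \<Longrightarrow> h \<in> carrier G \<Longrightarrow> wd g h = wd h g"
  using word_dist_commute by simp

lemma word_dist_translate [simp]:
  assumes "k \<in> carrier G" "g \<in> carrier G" "h \<in> carrier G"
  shows "word_dist G S (k \<otimes> g) (k \<otimes> h) = word_dist G S g h"
proof -
  have "inv (k \<otimes> g) \<otimes> (k \<otimes> h) = inv g \<otimes> h"
    using assms by (metis inv_closed inv_mult_group inv_solve_left m_assoc m_closed)
  then show ?thesis by (simp add: word_dist_def)
qed

lemma wd_translate_inv: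
  assumes "k \<in> carrier G" "g \<in> carrier G" "h \<in> carrier G"
  shows "wd (inv k \<otimes> g) h = wd g (k \<otimes> h)"
  using word_dist_translate[of k "inv k \<otimes> g" h] assms by (simp add: m_assoc[symmetric])

lemma wd_mult_right [simp]:
  "g \<in> carrier G \<Longrightarrow> h \<in> carrier G \<Longrightarrow> wd g (g \<otimes> h) = len h"
  using word_dist_translate[of g \<one> h] by (simp del: word_dist_translate)

lemma word_dist_eq_0:
  assumes "g \<in> carrier G" "h \<in> carrier G" shows "word_dist G S g h = 0 \<longleftrightarrow> g = h"
  using assms word_length_eq_0[of "inv g \<otimes> h"]
  by (metis inv_closed inv_solve_left m_closed one_closed r_one word_dist_def)

lemma finite_ball: "finite {g \<in> carrier G. len g \<le> R}"
proof -
  have "{g \<in> carrier G. len g \<le> R} \<subseteq> word_prod ` {ws. set ws \<subseteq> S \<and> length ws \<le> nat \<lfloor>R\<rfloor>}"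
  proof
    fix g assume g: "g \<in> {g \<in> carrier G. len g \<le> R}"
    then obtain ws where "set ws \<subseteq> S" "length ws = word_length G S g" "word_prod ws = g"
      using word_length_witness by blast
    moreover have "word_length G S g \<le> nat \<lfloor>R\<rfloor>" using g by (simp add: le_nat_floor)
    ultimately show "g \<in> word_prod ` {ws. set ws \<subseteq> S \<and> length ws \<le> nat \<lfloor>R\<rfloor>}" by auto
  qed
  then show ?thesis using finite_lists_length_le[OF finite_gens] finite_surj by blast
qed

lemma countable_carrier: "countable (carrier G)"
proof -
  have "countable (\<Union>n::nat. {g \<in> carrier G. len g \<le> real n})"
    by (rule countable_UN) (simp_all only: countableI_type countable_finite[OF finite_ball])
  moreover have "g \<in> (\<Union>n::nat. {g \<in> carrier G. len g \<le> real n})" if "g \<in> carrier G" for g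
    using that by (intro UN_I[of "word_length G S g"]) simp_all
  ultimately show ?thesis by (meson countable_subset subsetI)
qed

text \<open>The condition on \<open>range \<gamma>\<close> also constrains indices beyond
  \<open>n\<close>, so that membership in the carrier never needs a bound on the index.\<close>

definition word_geodesic :: "(nat \<Rightarrow> 'g) \<Rightarrow> nat \<Rightarrow> 'g \<Rightarrow> 'g \<Rightarrow> bool" where
  "word_geodesic \<gamma> n x y \<longleftrightarrow> n = word_dist G S x y \<and> \<gamma> 0 = x \<and> \<gamma> n = y \<and> range \<gamma> \<subseteq> carrier G \<and>
     (\<forall>i j. i \<le> j \<longrightarrow> j \<le> n \<longrightarrow> word_dist G S (\<gamma> i) (\<gamma> j) = j - i)"

text \<open>Take the prefixes of a shortest word for \<open>inv x \<otimes> y\<close>. Their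
  distances cannot be smaller than the differences of their lengths, since otherwise the whole word
  would not be shortest.\<close>

lemma word_geodesic_exists:
  assumes "x \<in> carrier G" "y \<in> carrier G"
  obtains \<gamma> where "word_geodesic \<gamma> (word_dist G S x y) x y"
proof -
  obtain ws where ws: "set ws \<subseteq> S" "length ws = word_dist G S x y" "word_prod ws = inv x \<otimes> y"
    using word_length_witness[of "inv x \<otimes> y"] assms by (metis inv_closed m_closed word_dist_def)
  define n where "n = word_dist G S x y"
  define \<gamma> where "\<gamma> i = x \<otimes> word_prod (take i ws)" for i
  have tk: "set (take i ws) \<subseteq> S" "set (drop i ws) \<subseteq> S" for i
    using ws(1) set_take_subset set_drop_subset by fastforce+
  have car: "word_prod (take i ws) \<in> carrier G" for i using word_prod_closed tk by blast
  have gc: "\<gamma> i \<in> carrier G" for i unfolding \<gamma>_def using car assms by simp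
  have g0: "\<gamma> 0 = x" unfolding \<gamma>_def using assms by simp
  have gn: "\<gamma> n = y" unfolding \<gamma>_def n_def using assms ws(2,3) by (simp add: m_assoc[symmetric])
  have up: "word_dist G S (\<gamma> i) (\<gamma> j) \<le> j - i" if "i \<le> j" for i j
  proof -
    let ?t = "drop i (take j ws)"
    have t: "set ?t \<subseteq> S" using tk set_drop_subset by (metis order_trans)
    have "take j ws = take i ws @ ?t" using that by (metis append_take_drop_id min.absorb1 take_take)
    then have "\<gamma> j = \<gamma> i \<otimes> word_prod ?t"
      unfolding \<gamma>_def using word_prod_append[OF tk(1) t] word_prod_closed[OF t] car assms
      by (metis m_assoc)
    then have "word_dist G S (\<gamma> i) (\<gamma> j) = word_length G S (word_prod ?t)"
      unfolding word_dist_def using gc[of i] word_prod_closed[OF t]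
      by (simp add: m_assoc[symmetric])
    also have "\<dots> \<le> length ?t" using word_length_le[OF t] by simp
    finally show ?thesis by simp
  qed
  have "word_dist G S (\<gamma> i) (\<gamma> j) = j - i" if "i \<le> j" "j \<le> n" for i j
  proof -
    have "n \<le> word_dist G S (\<gamma> 0) (\<gamma> i) + word_dist G S (\<gamma> i) (\<gamma> j) + word_dist G S (\<gamma> j) (\<gamma> n)"
      using word_dist_triangle[of "\<gamma> 0" "\<gamma> i" "\<gamma> n"] word_dist_triangle[of "\<gamma> i" "\<gamma> j" "\<gamma> n"] gc
      unfolding n_def using g0 gn n_def by force
    also have "\<dots> \<le> i + word_dist G S (\<gamma> i) (\<gamma> j) + (n - j)"
      using up[of 0 i] up[of j n] that by simp
    finally show ?thesis using up[OF that(1)] that by linarith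
  qed
  then have "word_geodesic \<gamma> n x y"
    unfolding word_geodesic_def using g0 gn gc n_def by auto
  then show thesis using that n_def by simp
qed

abbreviation gpb :: "'g \<Rightarrow> 'g \<Rightarrow> 'g \<Rightarrow> real" where
  "gpb p x y \<equiv> gromov_product wd p x y"

lemma gpb_commute: "x \<in> carrier G \<Longrightarrow> y \<in> carrier G \<Longrightarrow> gpb p x y = gpb p y x"
  using wd_commute[of x y] by (simp add: gromov_product_def)

lemma gpb_nonneg:
  "p \<in> carrier G \<Longrightarrow> x \<in> carrier G \<Longrightarrow> y \<in> carrier G \<Longrightarrow> 0 \<le> gpb p x y"
  using wd_triangle[of x p y] wd_commute[of x p] by (simp add: gromov_product_def)

lemma gpb_change_right:
  assumes "p \<in> carrier G" "x \<in> carrier G" "y \<in> carrier G" "z \<in> carrier G"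
  shows "gpb p x y \<ge> gpb p x z - wd y z"
  using wd_triangle[of p y z] wd_triangle[of x z y] wd_commute[of y z] assms
  unfolding gromov_product_def by argo

lemma gpb_change_base:
  assumes "p \<in> carrier G" "q \<in> carrier G" "x \<in> carrier G" "y \<in> carrier G"
  shows "gpb p x y \<ge> gpb q x y - wd p q"
  using wd_triangle[of q p x] wd_triangle[of q p y] wd_commute[of p q] assms
  unfolding gromov_product_def by argo

lemma gpb_translate [simp]:
  "k \<in> carrier G \<Longrightarrow> p \<in> carrier G \<Longrightarrow> x \<in> carrier G \<Longrightarrow> y \<in> carrier G \<Longrightarrow>
   gpb (k \<otimes> p) (k \<otimes> x) (k \<otimes> y) = gpb p x y"
  by (simp add: gromov_product_def)

end

section \<open>Slim triangles and the four-point inequality\<close>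

context word_metric
begin

text \<open>Applied to the length function of another generating system, this gives the bi-Lipschitz
  comparison of two word metrics.\<close>

lemma len_le_of_generators:
  fixes f :: "'g \<Rightarrow> real"
  assumes "f \<one> = 0" "\<And>g h. g \<in> carrier G \<Longrightarrow> h \<in> carrier G \<Longrightarrow> f (g \<otimes> h) \<le> f g + f h"
    and "\<And>s. s \<in> S \<Longrightarrow> f s \<le> c" "g \<in> carrier G"
  shows "f g \<le> c * len g"
proof -
  have "set ws \<subseteq> S \<Longrightarrow> f (word_prod ws) \<le> c * real (length ws)" for ws
  proof (induction ws)
    case (Cons w ws)
    then have "f (w \<otimes> word_prod ws) \<le> f w + f (word_prod ws)"
      using assms(2) word_prod_closed gens_closed by simp
    then show ?case using Cons assms(3)[of w] by (simp add: algebra_simps)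
  qed (use assms in simp)
  then show ?thesis using word_length_witness[OF assms(4)] by metis
qed

lemma word_geodesicD:
  assumes "word_geodesic \<gamma> n x y"
  shows "n = word_dist G S x y" "\<gamma> 0 = x" "\<gamma> n = y" "\<gamma> i \<in> carrier G"
    "i \<le> j \<Longrightarrow> j \<le> n \<Longrightarrow> word_dist G S (\<gamma> i) (\<gamma> j) = j - i"
    "i \<le> n \<Longrightarrow> word_dist G S x (\<gamma> i) = i" "i \<le> n \<Longrightarrow> word_dist G S (\<gamma> i) y = n - i"
proof -
  show *: "n = word_dist G S x y" "\<gamma> 0 = x" "\<gamma> n = y" "\<gamma> i \<in> carrier G"
    using assms by (auto simp: word_geodesic_def)
  show d: "i \<le> j \<Longrightarrow> j \<le> n \<Longrightarrow> word_dist G S (\<gamma> i) (\<gamma> j) = j - i" for i j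
    using assms by (auto simp: word_geodesic_def)
  show "i \<le> n \<Longrightarrow> word_dist G S x (\<gamma> i) = i" "i \<le> n \<Longrightarrow> word_dist G S (\<gamma> i) y = n - i"
    using d[of 0 i] d[of i n] * by auto
qed

lemma word_geodesic_gpb:
  assumes "word_geodesic \<gamma> n x y" "i \<le> n" shows "gpb (\<gamma> i) x y = 0"
  using word_geodesicD(6,7)[OF assms(1), of i] assms(2) wd_commute[of x "\<gamma> i"]
    word_geodesicD(2)[OF assms(1)] word_geodesicD(4)[OF assms(1), of 0] word_geodesicD(4)[OF assms(1), of i] word_geodesicD(1)[OF assms(1)]
  by (simp add: gromov_product_def of_nat_diff)

lemma point_between:
  assumes "x \<in> carrier G" "y \<in> carrier G" "i \<le> word_dist G S x y"
  obtains z where "z \<in> carrier G" "word_dist G S x z = i" "word_dist G S z y = word_dist G S x y - i"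
  using word_geodesic_exists[OF assms(1,2)] word_geodesicD assms(3) by metis

text \<open>The bridge between word metrics: distances to geodesics survive a bi-Lipschitz change of
  metric up to constants, whereas Gromov products are differences of distances and do not.\<close>

definition slim :: "real \<Rightarrow> bool" where
  "slim K \<longleftrightarrow> (\<forall>x y p \<gamma> \<gamma>\<^sub>1 \<gamma>\<^sub>2 n n\<^sub>1 n\<^sub>2 m.
     p \<in> carrier G \<longrightarrow> word_geodesic \<gamma> n x y \<longrightarrow> word_geodesic \<gamma>\<^sub>1 n\<^sub>1 x p \<longrightarrow> word_geodesic \<gamma>\<^sub>2 n\<^sub>2 y p \<longrightarrow> m \<le> n \<longrightarrow>
     (\<exists>i\<le>n\<^sub>1. wd (\<gamma> m) (\<gamma>\<^sub>1 i) \<le> K) \<or> (\<exists>i\<le>n\<^sub>2. wd (\<gamma> m) (\<gamma>\<^sub>2 i) \<le> K))"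

text \<open>At a point of the geodesic the product is zero, and moving the base point changes it by
  at most the distance moved.\<close>

lemma gpb_le_dist_geodesic:
  assumes "word_geodesic \<gamma> n x y" "m \<le> n" "p \<in> carrier G"
  shows "gpb p x y \<le> wd p (\<gamma> m)"
proof -
  have "x \<in> carrier G" "y \<in> carrier G" "\<gamma> m \<in> carrier G"
    using word_geodesicD(2,3,4)[OF assms(1)] by metis+
  then have "gpb (\<gamma> m) x y \<ge> gpb p x y - wd (\<gamma> m) p"
    using gpb_change_base assms(3) by simp
  then show ?thesis
    using word_geodesic_gpb[OF assms(1,2)] wd_commute \<open>\<gamma> m \<in> carrier G\<close> assms(3) by simp
qed

text \<open>The geodesic starts close to the side from \<open>x\<close> to \<open>p\<close> and ends
  close to the side from \<open>y\<close> to \<open>p\<close>. Where the two regimes meet it is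
  close to both sides, and adding up triangle inequalities there bounds the distance to
  \<open>p\<close>.\<close>

lemma slim_dist_geodesic_le:
  assumes "slim K" "0 \<le> K" "word_geodesic \<gamma> n x y" "p \<in> carrier G"
  shows "\<exists>m\<le>n. wd p (\<gamma> m) \<le> gpb p x y + 2 * (K + 1)"
proof -
  have xy: "x \<in> carrier G" "y \<in> carrier G" and \<gamma>: "\<And>m. \<gamma> m \<in> carrier G"
    using word_geodesicD(2,3,4)[OF assms(3)] by metis+
  obtain \<gamma>1 n1 where 1: "word_geodesic \<gamma>1 n1 x p" using word_geodesic_exists xy assms(4) by metis
  obtain \<gamma>2 n2 where 2: "word_geodesic \<gamma>2 n2 y p" using word_geodesic_exists xy assms(4) by metis
  define A where "A m \<longleftrightarrow> (\<exists>i\<le>n1. wd (\<gamma> m) (\<gamma>1 i) \<le> K)" for m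
  define B where "B m \<longleftrightarrow> (\<exists>i\<le>n2. wd (\<gamma> m) (\<gamma>2 i) \<le> K)" for m
  have AB: "A m \<or> B m" if "m \<le> n" for m
    using assms(1,3,4) 1 2 that unfolding slim_def A_def B_def by blast
  have A0: "A 0" unfolding A_def using word_geodesicD(2)[OF 1] word_geodesicD(2)[OF assms(3)] assms(2) xy by auto
  have Bn: "B n" unfolding B_def using word_geodesicD(2)[OF 2] word_geodesicD(3)[OF assms(3)] assms(2) xy by auto
  \<comment> \<open>Discrete connectedness: \<open>A\<close> holds at \<open>0\<close>,
    \<open>B\<close> at \<open>n\<close>, and every index satisfies one of them, so both occur at
    equal or consecutive indices.\<close>
  have "\<exists>m\<le>n. A m \<and> (B m \<or> (m < n \<and> B (Suc m)))"
  proof (rule ccontr)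
    assume no: "\<not> ?thesis"
    have "m \<le> n \<Longrightarrow> A m \<and> \<not> B m" for m
    proof (induction m)
      case 0 then show ?case using A0 no by auto
    next
      case (Suc m)
      then have "A m" "m < n" by simp_all
      then show ?case using no AB[of "Suc m"] Suc.prems by (meson Suc_leD)
    qed
    then show False using Bn by blast
  qed
  then obtain m m' where m: "m \<le> n" "A m" "B m'" "m' \<le> n" "m' = m \<or> m' = Suc m" by (metis Suc_leI)
  obtain i where i: "i \<le> n1" "wd (\<gamma> m) (\<gamma>1 i) \<le> K" using m(2) unfolding A_def by blast
  obtain j where j: "j \<le> n2" "wd (\<gamma> m') (\<gamma>2 j) \<le> K" using m(3) unfolding B_def by blast
  have mm: "wd (\<gamma> m) (\<gamma> m') \<le> 1" using m word_geodesicD(5)[OF assms(3), of m m'] \<gamma> by auto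
  have g1: "\<gamma>1 i \<in> carrier G" and g2: "\<gamma>2 j \<in> carrier G" using word_geodesicD(4) 1 2 by auto
  have j': "wd (\<gamma> m) (\<gamma>2 j) \<le> K + 1"
    using wd_triangle[of "\<gamma> m" "\<gamma> m'" "\<gamma>2 j"] mm j(2) \<gamma> g2 by simp
  have a: "wd x p = wd x (\<gamma>1 i) + wd (\<gamma>1 i) p"
    using word_geodesicD(1)[OF 1] word_geodesicD(6,7)[OF 1, of i] i(1) by (simp add: of_nat_diff)
  have b: "wd y p = wd y (\<gamma>2 j) + wd (\<gamma>2 j) p"
    using word_geodesicD(1)[OF 2] word_geodesicD(6,7)[OF 2, of j] j(1) by (simp add: of_nat_diff)
  have t: "wd x (\<gamma> m) \<le> wd x (\<gamma>1 i) + wd (\<gamma>1 i) (\<gamma> m)" "wd (\<gamma> m) p \<le> wd (\<gamma> m) (\<gamma>1 i) + wd (\<gamma>1 i) p"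
    "wd y (\<gamma> m) \<le> wd y (\<gamma>2 j) + wd (\<gamma>2 j) (\<gamma> m)" "wd (\<gamma> m) p \<le> wd (\<gamma> m) (\<gamma>2 j) + wd (\<gamma>2 j) p"
    "wd x y \<le> wd x (\<gamma> m) + wd (\<gamma> m) y"
    using xy \<gamma> g1 g2 assms(4) by (simp_all only: wd_triangle)
  have c: "wd (\<gamma> m) (\<gamma>1 i) = wd (\<gamma>1 i) (\<gamma> m)" "wd (\<gamma> m) (\<gamma>2 j) = wd (\<gamma>2 j) (\<gamma> m)"
    "wd (\<gamma> m) y = wd y (\<gamma> m)" "wd (\<gamma> m) p = wd p (\<gamma> m)"
    using xy \<gamma> g1 g2 assms(4) wd_commute by blast+
  have "2 * wd p (\<gamma> m) \<le> wd x p + wd y p - wd x y + 4 * (K + 1)"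
    using a b i(2) j' t c by argo
  then show ?thesis
    using m(1) wd_commute[of p x] wd_commute[of p y] xy assms(4)
    by (intro exI[of _ m]) (simp add: gromov_product_def field_simps)
qed

text \<open>Up to a constant the Gromov product is the distance from \<open>p\<close> to the
  geodesic, and slimness puts one of the other two sides within \<open>K\<close> of the point that
  realizes it.\<close>

lemma slim_imp_hyperbolic:
  assumes "slim K" "0 \<le> K" "x \<in> carrier G" "y \<in> carrier G" "z \<in> carrier G" "p \<in> carrier G"
  shows "gpb p x z \<ge> min (gpb p x y) (gpb p y z) - (3 * K + 2)"
proof -
  obtain \<gamma> n where 0: "word_geodesic \<gamma> n x z" using word_geodesic_exists assms by metis
  obtain \<gamma>1 n1 where 1: "word_geodesic \<gamma>1 n1 x y" using word_geodesic_exists assms by metis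
  obtain \<gamma>2 n2 where 2: "word_geodesic \<gamma>2 n2 z y" using word_geodesic_exists assms by metis
  obtain m where m: "m \<le> n" "wd p (\<gamma> m) \<le> gpb p x z + 2 * (K + 1)"
    using slim_dist_geodesic_le[OF assms(1,2) 0 assms(6)] by blast
  have \<gamma>: "\<gamma> i \<in> carrier G" "\<gamma>1 i \<in> carrier G" "\<gamma>2 i \<in> carrier G" for i
    using 0 1 2 word_geodesicD(4) by blast+
  have "(\<exists>i\<le>n1. wd (\<gamma> m) (\<gamma>1 i) \<le> K) \<or> (\<exists>i\<le>n2. wd (\<gamma> m) (\<gamma>2 i) \<le> K)"
    using assms 0 1 2 m(1) unfolding slim_def by blast
  then show ?thesis
  proof (elim disjE exE conjE)
    fix i assume "i \<le> n1" "wd (\<gamma> m) (\<gamma>1 i) \<le> K"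
    then show ?thesis
      using gpb_le_dist_geodesic[OF 1, of i p] wd_triangle[of p "\<gamma> m" "\<gamma>1 i"] m(2) \<gamma> assms by fastforce
  next
    fix i assume "i \<le> n2" "wd (\<gamma> m) (\<gamma>2 i) \<le> K"
    then show ?thesis
      using gpb_le_dist_geodesic[OF 2, of i p] gpb_commute[of z y p] wd_triangle[of p "\<gamma> m" "\<gamma>2 i"] m(2) \<gamma> assms
      by fastforce
  qed
qed

end

section \<open>Chains and almost geodesic points\<close>

locale hyperbolic_word_metric = word_metric +
  fixes \<delta> :: real
  assumes delta_nonneg: "0 \<le> \<delta>"
    and hyperbolic: "\<lbrakk>x \<in> carrier G; y \<in> carrier G; z \<in> carrier G; p \<in> carrier G\<rbrakk> \<Longrightarrow>
      gpb p x z \<ge> min (gpb p x y) (gpb p y z) - \<delta>"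
begin

text \<open>Halving the chain costs one \<open>\<delta>\<close> per level, so the loss is
  logarithmic instead of linear in the number of points. This is the source of exponential
  divergence.\<close>

lemma gpb_chain:
  assumes "range xs \<subseteq> carrier G" "p \<in> carrier G" "1 \<le> n" "n \<le> 2 ^ k"
  shows "\<exists>i<n. gpb p (xs i) (xs (Suc i)) \<le> gpb p (xs 0) (xs n) + real k * \<delta>"
  using assms(1,3,4)
proof (induction k arbitrary: xs n)
  case 0
  then show ?case by (intro exI[of _ 0]) simp
next
  case (Suc k)
  show ?case
  proof (cases "n = 1")
    case True
    then show ?thesis using delta_nonneg by (intro exI[of _ 0]) simp
  next
    case False
    define m where "m = n div 2"
    have m: "1 \<le> m" "m \<le> 2 ^ k" "1 \<le> n - m" "n - m \<le> 2 ^ k" "m < n"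
      using False Suc.prems by (auto simp: m_def)
    have "gpb p (xs 0) (xs n) \<ge> min (gpb p (xs 0) (xs m)) (gpb p (xs m) (xs n)) - \<delta>"
      using hyperbolic Suc.prems assms(2) by (simp add: range_subsetD)
    moreover obtain i where i: "i < m" "gpb p (xs i) (xs (Suc i)) \<le> gpb p (xs 0) (xs m) + real k * \<delta>"
      using Suc.IH[of xs m] Suc.prems m by blast
    moreover obtain j where j: "j < n - m"
      "gpb p (xs (m + j)) (xs (Suc (m + j))) \<le> gpb p (xs m) (xs n) + real k * \<delta>"
      using Suc.IH[of "\<lambda>i. xs (m + i)" "n - m"] Suc.prems m by auto
    ultimately have "gpb p (xs i) (xs (Suc i)) \<le> gpb p (xs 0) (xs n) + real (Suc k) * \<delta> \<or>
      gpb p (xs (m + j)) (xs (Suc (m + j))) \<le> gpb p (xs 0) (xs n) + real (Suc k) * \<delta>"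
      by (simp add: algebra_simps min_def split: if_splits)
    moreover have "i < n" "m + j < n" using i(1) j(1) m(5) by simp_all
    ultimately show ?thesis by blast
  qed
qed

text \<open>Compare \<open>x\<close> with the point of the geodesic at the same distance from
  \<open>p\<close>: seen from \<open>p\<close>, both have a large product with \<open>q\<close>,
  hence with each other.\<close>

lemma near_geodesic:
  assumes "word_geodesic \<gamma> n p q" "x \<in> carrier G" "gpb x p q \<le> s"
  shows "\<exists>i\<le>n. wd x (\<gamma> i) \<le> 2 * s + 2 * \<delta> \<and> i = min (word_dist G S p x) n"
proof -
  have pq: "p \<in> carrier G" "q \<in> carrier G" "\<And>i. \<gamma> i \<in> carrier G"
    using word_geodesicD(2,3,4)[OF assms(1)] by metis+
  define i where "i = min (word_dist G S p x) n"
  have "wd x (\<gamma> i) \<le> 2 * s + 2 * \<delta>"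
  proof (cases "word_dist G S p x \<le> n")
    case True
    then have i: "i = word_dist G S p x" "i \<le> n" by (simp_all add: i_def)
    have pi: "wd p (\<gamma> i) = wd p x" "wd (\<gamma> i) q = wd p q - wd p x"
      using word_geodesicD(1)[OF assms(1)] word_geodesicD(6,7)[OF assms(1), of i] i by (simp_all add: of_nat_diff)
    have "gpb p x (\<gamma> i) \<ge> min (gpb p x q) (gpb p q (\<gamma> i)) - \<delta>"
      using hyperbolic pq assms(2) by blast
    moreover have "gpb p q (\<gamma> i) = wd p x"
      using pi wd_commute[of q "\<gamma> i"] pq by (simp add: gromov_product_def)
    moreover have "gpb p x q = wd p x - gpb x p q"
      using wd_commute[of p x] pq assms(2) by (simp add: gromov_product_def field_simps)
    moreover have "gpb p x (\<gamma> i) = wd p x - wd x (\<gamma> i) / 2"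
      using pi by (simp add: gromov_product_def field_simps)
    moreover have "gpb x p q \<ge> 0" using gpb_nonneg pq assms(2) by blast
    ultimately show ?thesis using assms(3) by linarith
  next
    case False
    then have "\<gamma> i = q" "wd p q \<le> wd p x"
      using word_geodesicD(1,3)[OF assms(1)] by (auto simp: i_def)
    then show ?thesis
      using assms(3) wd_commute[of p x] pq assms(2) delta_nonneg by (simp add: gromov_product_def)
  qed
  then show ?thesis using i_def by (intro exI[of _ i]) simp
qed

end

section \<open>Quasi-isometry invariance of hyperbolicity\<close>

text \<open>\<open>S'\<close> is a generating system for which hyperbolicity is known,
  \<open>S\<close> the one to which it is transferred.\<close>

locale two_word_metrics = H: hyperbolic_word_metric G S' \<delta> + W: word_metric G S
  for G :: "('g, 'm) monoid_scheme" (structure) and S' \<delta> S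
begin

lemma comparison_constant:
  "\<exists>L::nat. (1::nat) \<le> L \<and> (\<forall>x\<in>carrier G. \<forall>y\<in>carrier G. H.wd x y \<le> L * W.wd x y \<and> W.wd x y \<le> L * H.wd x y)"
proof -
  define L where "L = Max (insert 1 (word_length G S' ` S \<union> word_length G S ` S'))"
  have fin: "finite (insert 1 (word_length G S' ` S \<union> word_length G S ` S'))"
    using H.finite_gens W.finite_gens by simp
  have 1: "H.len g \<le> L * W.len g" if "g \<in> carrier G" for g
  proof (rule W.len_le_of_generators[OF _ _ _ that])
    show "H.len (g \<otimes> h) \<le> H.len g + H.len h" if "g \<in> carrier G" "h \<in> carrier G" for g h
      using H.word_length_mult[OF that] by linarith
    show "H.len s \<le> real L" if "s \<in> S" for s
      using Max_ge[OF fin] that by (auto simp: L_def)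
  qed simp
  have 2: "W.len g \<le> L * H.len g" if "g \<in> carrier G" for g
  proof (rule H.len_le_of_generators[OF _ _ _ that])
    show "W.len (g \<otimes> h) \<le> W.len g + W.len h" if "g \<in> carrier G" "h \<in> carrier G" for g h
      using W.word_length_mult[OF that] by linarith
    show "W.len s \<le> real L" if "s \<in> S'" for s
      using Max_ge[OF fin] that by (auto simp: L_def)
  qed simp
  have "1 \<le> L" using Max_ge[OF fin] by (auto simp: L_def)
  then show ?thesis using 1 2 by (intro exI[of _ L]) (simp add: word_dist_def)
qed

definition L :: nat where
  "L = (SOME L::nat. (1::nat) \<le> L \<and> (\<forall>x\<in>carrier G. \<forall>y\<in>carrier G. H.wd x y \<le> L * W.wd x y \<and> W.wd x y \<le> L * H.wd x y))"

lemma L: "1 \<le> L" "x \<in> carrier G \<Longrightarrow> y \<in> carrier G \<Longrightarrow> H.wd x y \<le> L * W.wd x y"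
    "x \<in> carrier G \<Longrightarrow> y \<in> carrier G \<Longrightarrow> W.wd x y \<le> L * H.wd x y"
  using someI_ex[OF comparison_constant] unfolding L_def by blast+

text \<open>Exponential divergence: a path avoiding a ball of radius \<open>D\<close> around a point of a geodesic
  is exponentially long in \<open>D\<close>, whereas the detour along a quasi-geodesic is linear in \<open>D\<close>.\<close>

lemma detour_bound: "\<exists>K. \<forall>D k::nat. real D - L \<le> real k * \<delta> \<longrightarrow> 2 ^ k \<le> 2 * (6 * L * D + 2) \<longrightarrow> D \<le> K"
proof -
  have "eventually (\<lambda>x::real. L + \<delta> * log 2 (2 * (6 * real L * x + 2)) < x) at_top"
  proof (cases "\<delta> = 0")
    case True
    then show ?thesis by (simp add: eventually_gt_at_top)
  next
    case False
    then have "\<delta> > 0" "real L > 0" using H.delta_nonneg L(1) by simp_all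
    then show ?thesis by real_asymp
  qed
  then have "\<exists>K::real. \<forall>x\<ge>K. L + \<delta> * log 2 (2 * (6 * real L * x + 2)) < x"
    by (simp only: eventually_at_top_linorder)
  then obtain K :: real where K': "\<forall>x\<ge>K. L + \<delta> * log 2 (2 * (6 * real L * x + 2)) < x" ..
  have K: "L + \<delta> * log 2 (2 * (6 * real L * x + 2)) < x" if "x \<ge> K" for x
    using K'[rule_format, OF that] .
  have "D \<le> nat \<lceil>K\<rceil>" if D: "real D - L \<le> real k * \<delta>" "2 ^ k \<le> 2 * (6 * L * D + 2)" for D k :: nat
  proof (rule ccontr)
    assume "\<not> ?thesis"
    then have "K \<le> real D" by linarith
    then have 1: "L + \<delta> * log 2 (2 * (6 * real L * real D + 2)) < D" by (rule K)
    have "real (2 ^ k) \<le> real (2 * (6 * L * D + 2))" using D(2) of_nat_mono by blast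
    then have "log 2 (2 ^ k) \<le> log 2 (2 * (6 * real L * real D + 2))"
      by (intro log_mono) simp_all
    then have "real k \<le> log 2 (2 * (6 * real L * real D + 2))" by simp
    then have "real k * \<delta> \<le> \<delta> * log 2 (2 * (6 * real L * real D + 2))"
      using H.delta_nonneg by (simp add: mult.commute mult_left_mono)
    with 1 D(1) show False by linarith
  qed
  then show ?thesis by blast
qed

text \<open>The witness is the point at distance \<open>2 D\<close> from \<open>q\<close> towards \<open>x\<close>, or \<open>x\<close> itself.\<close>

lemma detour_start:
  assumes "x \<in> carrier G" "q \<in> carrier G" "\<gamma> i\<^sub>0 = x" "i\<^sub>0 \<le> (n::nat)" "\<And>i. \<gamma> i \<in> carrier G"
    and far: "\<And>i. i \<le> n \<Longrightarrow> D \<le> word_dist G S' q (\<gamma> i)"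
    and near: "\<And>p. p \<in> carrier G \<Longrightarrow> H.wd x p + H.wd p q = H.wd x q \<Longrightarrow> \<exists>i\<le>n. word_dist G S' p (\<gamma> i) \<le> D"
  shows "\<exists>p i. p \<in> carrier G \<and> i \<le> n \<and> H.wd x p + H.wd p q = H.wd x q \<and> H.wd q p \<le> 2 * real D \<and>
           H.wd p (\<gamma> i) \<le> D \<and> D \<le> H.gpb q p (\<gamma> i)"
proof (cases "2 * D \<le> word_dist G S' q x")
  case True
  obtain p where p: "p \<in> carrier G" "word_dist G S' q p = 2 * D" "word_dist G S' p x = word_dist G S' q x - 2 * D"
    using H.point_between[OF assms(2,1) True] .
  have b: "H.wd x p + H.wd p q = H.wd x q"
    using p True H.word_dist_commute[of x p] H.word_dist_commute[of p q] H.word_dist_commute[of x q] assms(1,2)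
    by (simp add: of_nat_diff)
  obtain i where i: "i \<le> n" "word_dist G S' p (\<gamma> i) \<le> D" using near[OF p(1) b] by blast
  have "real D \<le> H.wd q (\<gamma> i)" using far[OF i(1)] by simp
  then have "D \<le> H.gpb q p (\<gamma> i)" using p(2) i(2) by (simp add: gromov_product_def field_simps)
  then show ?thesis using p i b by (intro exI[of _ p] exI[of _ i]) auto
next
  case False
  have "real D \<le> H.gpb q x (\<gamma> i\<^sub>0)"
    using far[OF assms(4)] assms(1-3) by (simp add: gromov_product_def)
  then show ?thesis using False assms by (intro exI[of _ x] exI[of _ i\<^sub>0]) auto
qed

text \<open>First half of the Morse lemma. Let \<open>q\<close> be a point between \<open>x\<close>
  and \<open>y\<close> farthest from the path, at distance \<open>D\<close>. Leaving the geodesic on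
  one side of \<open>q\<close>, following the path and returning on the other side is a chain of
  length linear in \<open>D\<close> whose steps all have product at least \<open>D - L\<close> at
  \<open>q\<close>, although its ends have product zero. By \<open>gpb_chain\<close>,
  \<open>D\<close> is at most logarithmic in itself.\<close>

lemma geodesic_near_quasigeodesic:
  "\<exists>K::nat. \<forall>x y \<gamma> n q. W.word_geodesic \<gamma> n x y \<longrightarrow> q \<in> carrier G \<longrightarrow> H.gpb q x y = 0 \<longrightarrow>
     (\<exists>i\<le>n. H.wd q (\<gamma> i) \<le> K)"
proof -
  obtain K where K: "\<And>D k::nat. real D - L \<le> real k * \<delta> \<Longrightarrow> 2 ^ k \<le> 2 * (6 * L * D + 2) \<Longrightarrow> D \<le> K"
    using detour_bound by blast
  have "\<exists>i\<le>n. H.wd q0 (\<gamma> i) \<le> K"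
    if \<gamma>: "W.word_geodesic \<gamma> n x y" and q0: "q0 \<in> carrier G" "H.gpb q0 x y = 0" for x y \<gamma> n q0
  proof -
    have xy: "x \<in> carrier G" "y \<in> carrier G" "\<gamma> 0 = x" "\<gamma> n = y" and c: "\<And>i. \<gamma> i \<in> carrier G"
      using W.word_geodesicD(2,3,4)[OF \<gamma>] by metis+
    \<comment> \<open>Product zero means that \<open>q\<close> lies between \<open>x\<close> and
      \<open>y\<close> in the metric of \<open>S'\<close>. Distances from \<open>Q\<close> to the
      path are bounded, so the maximum below is attained.\<close>
    define Q where "Q = {q \<in> carrier G. H.gpb q x y = 0}"
    define f where "f q = Min ((\<lambda>i. word_dist G S' q (\<gamma> i)) ` {..n})" for q
    have f_le: "i \<le> n \<Longrightarrow> f q \<le> word_dist G S' q (\<gamma> i)" for q i unfolding f_def by (rule Min_le) auto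
    have f_att: "\<exists>i\<le>n. f q = word_dist G S' q (\<gamma> i)" for q
    proof -
      have "f q \<in> (\<lambda>i. word_dist G S' q (\<gamma> i)) ` {..n}" unfolding f_def by (rule Min_in) auto
      then show ?thesis by auto
    qed
    have Q_iff: "q \<in> Q \<longleftrightarrow> q \<in> carrier G \<and> H.wd x q + H.wd q y = H.wd x y" for q
      unfolding Q_def gromov_product_def using H.word_dist_commute[of x q] xy by auto
    have "f ` Q \<subseteq> {..word_dist G S' x y}"
    proof safe
      fix q assume "q \<in> Q"
      then have "word_dist G S' q x \<le> word_dist G S' x y"
        using Q_iff[of q] H.word_dist_commute[of x q] xy by auto
      then show "f q \<le> word_dist G S' x y" using f_le[of 0 q] xy by simp
    qed
    then have fin: "finite (f ` Q)" using finite_subset by blast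
    have q0Q: "q0 \<in> Q" using q0 by (simp add: Q_def)
    define D where "D = Max (f ` Q)"
    have D: "f q \<le> D" if "q \<in> Q" for q unfolding D_def using fin that by simp
    have "D \<in> f ` Q" unfolding D_def using Max_in[OF fin] q0Q by blast
    then obtain q where q: "q \<in> Q" "f q = D" by blast
    have qc: "q \<in> carrier G" and qxy: "H.wd x q + H.wd q y = H.wd x y" using q(1) Q_iff by auto
    have near: "\<exists>i\<le>n. word_dist G S' p (\<gamma> i) \<le> D" if "p \<in> Q" for p
      using f_att[of p] D[OF that] by metis
    have far: "i \<le> n \<Longrightarrow> D \<le> word_dist G S' q (\<gamma> i)" for i using f_le q(2) by blast
    have "\<exists>p i. p \<in> carrier G \<and> i \<le> n \<and> H.wd x p + H.wd p q = H.wd x q \<and> H.wd q p \<le> 2 * real D \<and>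
           H.wd p (\<gamma> i) \<le> D \<and> D \<le> H.gpb q p (\<gamma> i)"
    proof (rule detour_start[where \<gamma>=\<gamma> and i\<^sub>0=0 and n=n and D=D, OF xy(1) qc xy(3) _ c far])
      fix p assume p: "p \<in> carrier G" "H.wd x p + H.wd p q = H.wd x q"
      then have "p \<in> Q" using Q_iff qxy H.wd_triangle[of p q y] H.wd_triangle[of x p y] qc xy by fastforce
      then show "\<exists>i\<le>n. word_dist G S' p (\<gamma> i) \<le> D" by (rule near)
    qed auto
    then obtain p1 i1 where 1: "p1 \<in> carrier G" "i1 \<le> n" "H.wd x p1 + H.wd p1 q = H.wd x q"
      "H.wd q p1 \<le> 2 * real D" "H.wd p1 (\<gamma> i1) \<le> D" "D \<le> H.gpb q p1 (\<gamma> i1)" by blast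
    have "\<exists>p i. p \<in> carrier G \<and> i \<le> n \<and> H.wd y p + H.wd p q = H.wd y q \<and> H.wd q p \<le> 2 * real D \<and>
           H.wd p (\<gamma> i) \<le> D \<and> D \<le> H.gpb q p (\<gamma> i)"
    proof (rule detour_start[where \<gamma>=\<gamma> and i\<^sub>0=n and n=n and D=D, OF xy(2) qc xy(4) _ c far])
      fix p assume p: "p \<in> carrier G" "H.wd y p + H.wd p q = H.wd y q"
      have "H.wd y p = H.wd p y" "H.wd p q = H.wd q p" "H.wd y q = H.wd q y"
        using H.wd_commute p qc xy by blast+
      then have "p \<in> Q" using p Q_iff qxy H.wd_triangle[of x q p] H.wd_triangle[of x p y] qc xy by fastforce
      then show "\<exists>i\<le>n. word_dist G S' p (\<gamma> i) \<le> D" by (rule near)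
    qed auto
    then obtain p2 i2 where 2: "p2 \<in> carrier G" "i2 \<le> n" "H.wd y p2 + H.wd p2 q = H.wd y q"
      "H.wd q p2 \<le> 2 * real D" "H.wd p2 (\<gamma> i2) \<le> D" "D \<le> H.gpb q p2 (\<gamma> i2)" by blast
    have comm: "H.wd y p2 = H.wd p2 y" "H.wd p2 q = H.wd q p2" "H.wd y q = H.wd q y" "H.wd p1 q = H.wd q p1"
        "H.wd (\<gamma> i1) p1 = H.wd p1 (\<gamma> i1)"
      using H.wd_commute 1(1) 2(1) qc xy c by blast+
    have tri: "H.wd x y \<le> H.wd x p1 + H.wd p1 y" "H.wd p1 y \<le> H.wd p1 p2 + H.wd p2 y" "H.wd p1 p2 \<le> H.wd p1 q + H.wd q p2"
      "H.wd (\<gamma> i1) (\<gamma> i2) \<le> H.wd (\<gamma> i1) p1 + H.wd p1 (\<gamma> i2)" "H.wd p1 (\<gamma> i2) \<le> H.wd p1 p2 + H.wd p2 (\<gamma> i2)"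
      using H.wd_triangle 1(1) 2(1) qc xy c by blast+
    \<comment> \<open>\<open>p1\<close>, \<open>q\<close>, \<open>p2\<close> lie in this order on a
      geodesic of \<open>S'\<close>.\<close>
    have pp: "H.gpb q p1 p2 = 0"
      using 1(3) 2(3) comm tri qxy unfolding gromov_product_def by argo
    define N where "N = (if i1 \<le> i2 then i2 - i1 else i1 - i2)"
    define s where "s t = (if i1 \<le> i2 then i1 + t else i1 - t)" for t
    have s: "s 0 = i1" "s N = i2" "t \<le> N \<Longrightarrow> s t \<le> n" for t
      using 1(2) 2(2) by (auto simp: s_def N_def)
    have sW: "word_dist G S (\<gamma> (s t)) (\<gamma> (s (Suc t))) = 1" if "t < N" for t
    proof (cases "i1 \<le> i2")
      case True
      then show ?thesis using that 2(2) W.word_geodesicD(5)[OF \<gamma>, of "i1 + t" "i1 + Suc t"] by (auto simp: s_def N_def)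
    next
      case False
      then show ?thesis using that 1(2) W.word_geodesicD(5)[OF \<gamma>, of "i1 - Suc t" "i1 - t"]
          W.word_dist_commute[OF c c, of "i1 - t" "i1 - Suc t"] by (auto simp: s_def N_def)
    qed
    have "real N = W.wd (\<gamma> i1) (\<gamma> i2)"
      using W.word_geodesicD(5)[OF \<gamma>, of i1 i2] W.word_geodesicD(5)[OF \<gamma>, of i2 i1] 1(2) 2(2)
        W.word_dist_commute[OF c c, of i1 i2] by (auto simp: N_def)
    also have "\<dots> \<le> L * H.wd (\<gamma> i1) (\<gamma> i2)" using L(3) c by blast
    \<comment> \<open>At most \<open>D\<close> for each of the two descents to the path and at most
      \<open>2 * D\<close> from \<open>q\<close> to each of \<open>p1\<close> and
      \<open>p2\<close>.\<close>
    also have "\<dots> \<le> real L * (6 * real D)"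
      using comm tri 1(4,5) 2(4,5) by (intro mult_left_mono) simp_all
    finally have "real N \<le> real (6 * L * D)" by simp
    then have N: "N \<le> 6 * L * D" by (simp only: of_nat_le_iff)
    define xs where "xs t = (if t = 0 then p1 else if t \<le> Suc N then \<gamma> (s (t - 1)) else p2)" for t
    have xsc: "range xs \<subseteq> carrier G" using c 1(1) 2(1) by (auto simp: xs_def)
    obtain k where k: "N + 2 \<le> 2 ^ k" "2 ^ k \<le> 2 * (N + 2)"
    proof -
      obtain k where "2 ^ k \<le> N + 2" "N + 2 < 2 ^ (k + 1)"
        using ex_power_ivl1[of 2 "N + 2"] by auto
      then show thesis using that[of "Suc k"] by simp
    qed
    have "\<exists>t<N+2. H.gpb q (xs t) (xs (Suc t)) \<le> H.gpb q (xs 0) (xs (N + 2)) + real k * \<delta>"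
      using H.gpb_chain[OF xsc qc _ k(1)] by simp
    then obtain t where t: "t < N + 2" "H.gpb q (xs t) (xs (Suc t)) \<le> real k * \<delta>"
      using pp by (auto simp: xs_def)
    have "real D - L \<le> H.gpb q (xs t) (xs (Suc t))"
    proof -
      consider "t = 0" | t' where "t = Suc t'" "t' < N" | "t = Suc N" using t(1) by (cases t) (auto simp: less_Suc_eq)
      then show ?thesis
      proof cases
        case 1
        then show ?thesis using \<open>D \<le> H.gpb q p1 (\<gamma> i1)\<close> s by (simp add: xs_def)
      next
        case 3
        then show ?thesis using \<open>D \<le> H.gpb q p2 (\<gamma> i2)\<close> s H.gpb_commute[OF 2(1) c, of q i2] by (simp add: xs_def)
      next
        case 2
        \<comment> \<open>Neighbours on the path are \<open>1\<close> apart for \<open>S\<close>,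
          hence at most \<open>L\<close> apart for \<open>S'\<close>, and the first is at distance
          at least \<open>D\<close> from \<open>q\<close>.\<close>
        have d: "H.wd (\<gamma> (s t')) (\<gamma> (s (Suc t'))) \<le> L"
          using L(2)[OF c c, of "s t'" "s (Suc t')"] sW[OF 2(2)] by simp
        have g: "H.gpb q (\<gamma> (s t')) (\<gamma> (s t')) = H.wd q (\<gamma> (s t'))"
          using c by (simp add: gromov_product_def)
        have "H.gpb q (\<gamma> (s t')) (\<gamma> (s (Suc t'))) \<ge> H.wd q (\<gamma> (s t')) - H.wd (\<gamma> (s (Suc t'))) (\<gamma> (s t'))"
          using H.gpb_change_right[OF qc c[of "s t'"] c[of "s (Suc t')"] c[of "s t'"]] g by simp
        moreover have "real D \<le> H.wd q (\<gamma> (s t'))" using far s(3)[of t'] 2(2) by simp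
        ultimately show ?thesis using d H.wd_commute[OF c c, of "s t'" "s (Suc t')"] 2 by (simp add: xs_def)
      qed
    qed
    then have "real D - L \<le> real k * \<delta>" using t(2) by linarith
    moreover have "2 ^ k \<le> 2 * (6 * L * D + 2)" by (rule order_trans[OF k(2)]) (use N in \<open>simp add: ac_simps\<close>)
    ultimately have "D \<le> K" by (rule K)
    then show ?thesis using near[OF q0Q] by (meson of_nat_mono order_trans)
  qed
  then show ?thesis by blast
qed

text \<open>Second half of the Morse lemma. Every point of a geodesic of \<open>S'\<close> has a
  nearby index on the path, and neighbouring points have indices that differ by a bounded amount.
  Running from \<open>0\<close> to \<open>n\<close>, these indices cannot skip the vicinity of
  \<open>m\<close>.\<close>

lemma quasigeodesic_near_geodesic:
  "\<exists>K. \<forall>x y \<gamma> n m. W.word_geodesic \<gamma> n x y \<longrightarrow> m \<le> n \<longrightarrow> H.gpb (\<gamma> m) x y \<le> K"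
proof -
  obtain K :: nat where K: "\<And>x y \<gamma> n q. W.word_geodesic \<gamma> n x y \<Longrightarrow> q \<in> carrier G \<Longrightarrow> H.gpb q x y = 0 \<Longrightarrow>
     \<exists>i\<le>n. H.wd q (\<gamma> i) \<le> K"
    using geodesic_near_quasigeodesic by metis
  have "H.gpb (\<gamma> m) x y \<le> real L * (real L * (2 * real K + 1)) + K"
    if \<gamma>: "W.word_geodesic \<gamma> n x y" and m: "m \<le> n" for x y \<gamma> n m
  proof -
    have xy: "x \<in> carrier G" "y \<in> carrier G" "\<gamma> 0 = x" "\<gamma> n = y" and c: "\<And>i. \<gamma> i \<in> carrier G"
      using W.word_geodesicD(2,3,4)[OF \<gamma>] by metis+
    define M where "M = word_dist G S' x y"
    obtain \<eta> where \<eta>: "H.word_geodesic \<eta> M x y"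
      using H.word_geodesic_exists[OF xy(1,2)] unfolding M_def .
    have e: "\<eta> 0 = x" "\<eta> M = y" "\<And>i. \<eta> i \<in> carrier G" using H.word_geodesicD(2,3,4)[OF \<eta>] by metis+
    have "\<exists>i\<le>n. H.wd (\<eta> l) (\<gamma> i) \<le> K \<and> (l = M \<longrightarrow> i = n)" if "l \<le> M" for l
    proof (cases "l = M")
      case True then show ?thesis using e xy H.word_dist_eq_0[OF xy(2,2)] by auto
    next
      case False
      then show ?thesis using K[OF \<gamma>, of "\<eta> l"] H.word_geodesic_gpb[OF \<eta> that] e by auto
    qed
    then obtain f where f: "\<And>l. l \<le> M \<Longrightarrow> f l \<le> n \<and> H.wd (\<eta> l) (\<gamma> (f l)) \<le> K \<and> (l = M \<longrightarrow> f l = n)"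
      by metis
    \<comment> \<open>Index \<open>0\<close> is forced at the start, and \<open>f\<close> already
      gives \<open>n\<close> at the end; \<open>l\<close> is then the last position whose index does
      not exceed \<open>m\<close>.\<close>
    define g where "g l = (if l = 0 then 0 else f l)" for l
    have g: "g l \<le> n" "H.wd (\<eta> l) (\<gamma> (g l)) \<le> K" if "l \<le> M" for l
      using f[OF that] e xy H.word_dist_eq_0[OF xy(1,1)] by (auto simp: g_def)
    define l where "l = (GREATEST l. l \<le> M \<and> g l \<le> m)"
    have l: "l \<le> M \<and> g l \<le> m" unfolding l_def
      by (rule GreatestI_nat[of _ 0 M]) (auto simp: g_def)
    have lg: "l' \<le> l" if "l' \<le> M \<and> g l' \<le> m" for l' unfolding l_def
      by (rule Greatest_le_nat[of _ _ M]) (use that in auto)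
    have "H.wd (\<gamma> (g l)) (\<gamma> m) \<le> real L * (real L * (2 * real K + 1))"
    proof (cases "l = M")
      case True
      show ?thesis
      proof (cases "M = 0")
        case True
        then have "x = y" using xy M_def H.word_dist_eq_0 by simp
        then have "n = 0" using W.word_geodesicD(1)[OF \<gamma>] xy W.word_dist_eq_0 by simp
        then show ?thesis using m \<open>l = M\<close> True c by (simp add: g_def)
      next
        case False
        then have "g l = n" using True f[of M] by (simp add: g_def)
        then have "m = g l" using l m by simp
        then show ?thesis using c by simp
      qed
    next
      case False
      then have lM: "Suc l \<le> M" using l by simp
      then have gm: "m < g (Suc l)" using lg[of "Suc l"] by fastforce
      have "real (g (Suc l) - g l) = W.wd (\<gamma> (g l)) (\<gamma> (g (Suc l)))"
        using W.word_geodesicD(5)[OF \<gamma>, of "g l" "g (Suc l)"] l gm g[OF lM] by simp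
      also have "\<dots> \<le> L * H.wd (\<gamma> (g l)) (\<gamma> (g (Suc l)))" using L(3) c by blast
      also have "\<dots> \<le> real L * (2 * real K + 1)"
      proof (rule mult_left_mono)
        have "H.wd (\<gamma> (g l)) (\<gamma> (g (Suc l))) \<le> H.wd (\<gamma> (g l)) (\<eta> l) + H.wd (\<eta> l) (\<gamma> (g (Suc l)))"
          "H.wd (\<eta> l) (\<gamma> (g (Suc l))) \<le> H.wd (\<eta> l) (\<eta> (Suc l)) + H.wd (\<eta> (Suc l)) (\<gamma> (g (Suc l)))"
          by (intro H.wd_triangle c e(3))+
        moreover have "H.wd (\<gamma> (g l)) (\<eta> l) = H.wd (\<eta> l) (\<gamma> (g l))"
          by (intro H.wd_commute c e(3))
        ultimately show "H.wd (\<gamma> (g l)) (\<gamma> (g (Suc l))) \<le> 2 * real K + 1"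
          using H.word_geodesicD(5)[OF \<eta>, of l "Suc l"] lM g[OF lM] g[of l] l by simp
      qed simp
      finally have 1: "real (g (Suc l) - g l) \<le> real L * (2 * real K + 1)" .
      have "H.wd (\<gamma> (g l)) (\<gamma> m) \<le> L * W.wd (\<gamma> (g l)) (\<gamma> m)" using L(2) c by blast
      also have "W.wd (\<gamma> (g l)) (\<gamma> m) = real (m - g l)"
        using W.word_geodesicD(5)[OF \<gamma>, of "g l" m] l m by simp
      also have "L * real (m - g l) \<le> real L * (real L * (2 * real K + 1))"
      proof -
        have "real (m - g l) \<le> real (g (Suc l) - g l)" using gm by simp
        then show ?thesis using 1 mult_left_mono[of "real (m - g l)" "real L * (2 * real K + 1)" "real L"] by simp
      qed
      finally show ?thesis by simp
    qed
    moreover have "H.gpb (\<eta> l) x y \<ge> H.gpb (\<gamma> m) x y - H.wd (\<eta> l) (\<gamma> m)"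
      using H.gpb_change_base c e(3) xy by blast
    moreover have "H.gpb (\<eta> l) x y = 0" using H.word_geodesic_gpb[OF \<eta>] l by blast
    moreover have "H.wd (\<eta> l) (\<gamma> m) \<le> H.wd (\<eta> l) (\<gamma> (g l)) + H.wd (\<gamma> (g l)) (\<gamma> m)"
      using H.wd_triangle c e(3) by blast
    ultimately show ?thesis using g(2)[of l] l by simp
  qed
  then show ?thesis by blast
qed

text \<open>A point of a geodesic of \<open>S\<close> has bounded product for \<open>S'\<close> with
  respect to its ends. The four-point inequality passes this to one of the other sides, and the two
  halves of the Morse lemma lead back to a geodesic of \<open>S\<close>.\<close>

lemma word_metric_slim: "\<exists>K\<ge>0. W.slim K"
proof -
  obtain K :: nat where K: "\<And>x y \<gamma> n q. W.word_geodesic \<gamma> n x y \<Longrightarrow> q \<in> carrier G \<Longrightarrow> H.gpb q x y = 0 \<Longrightarrow>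
     \<exists>i\<le>n. H.wd q (\<gamma> i) \<le> K"
    using geodesic_near_quasigeodesic by metis
  obtain K1 where K1: "\<And>x y \<gamma> n m. W.word_geodesic \<gamma> n x y \<Longrightarrow> m \<le> n \<Longrightarrow> H.gpb (\<gamma> m) x y \<le> K1"
    using quasigeodesic_near_geodesic by metis
  define s where "s = max K1 0 + \<delta>"
  define K2 where "K2 = L * (2 * s + 2 * \<delta> + K)"
  have close: "\<exists>i\<le>n. W.wd z (\<gamma> i) \<le> K2"
    if z: "z \<in> carrier G" "H.gpb z x p \<le> s" and \<gamma>: "W.word_geodesic \<gamma> n x p" for x p \<gamma> n z
  proof -
    have xp: "x \<in> carrier G" "p \<in> carrier G" and c: "\<And>i. \<gamma> i \<in> carrier G"
      using W.word_geodesicD(2,3,4)[OF \<gamma>] by metis+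
    obtain \<eta> where \<eta>: "H.word_geodesic \<eta> (word_dist G S' x p) x p"
      using H.word_geodesic_exists[OF xp] .
    obtain l where l: "l \<le> word_dist G S' x p" "H.wd z (\<eta> l) \<le> 2 * s + 2 * \<delta>"
      using H.near_geodesic[OF \<eta> z] by blast
    have e: "\<eta> l \<in> carrier G" using H.word_geodesicD(4)[OF \<eta>] .
    obtain i where i: "i \<le> n" "H.wd (\<eta> l) (\<gamma> i) \<le> K"
      using K[OF \<gamma> e H.word_geodesic_gpb[OF \<eta> l(1)]] by blast
    have "H.wd z (\<gamma> i) \<le> H.wd z (\<eta> l) + H.wd (\<eta> l) (\<gamma> i)" using H.wd_triangle z(1) e c by blast
    then have "H.wd z (\<gamma> i) \<le> 2 * s + 2 * \<delta> + K" using l i by linarith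
    then have "L * H.wd z (\<gamma> i) \<le> K2" unfolding K2_def by (intro mult_left_mono) simp_all
    moreover have "W.wd z (\<gamma> i) \<le> L * H.wd z (\<gamma> i)" using L(3) z(1) c by blast
    ultimately have "W.wd z (\<gamma> i) \<le> K2" by linarith
    then show ?thesis using i(1) by blast
  qed
  have "W.slim K2"
    unfolding W.slim_def
  proof (intro allI impI)
    fix x y p \<gamma> \<gamma>1 \<gamma>2 n n1 n2 m
    assume p: "p \<in> carrier G" and \<gamma>: "W.word_geodesic \<gamma> n x y" and \<gamma>1: "W.word_geodesic \<gamma>1 n1 x p"
      and \<gamma>2: "W.word_geodesic \<gamma>2 n2 y p" and m: "m \<le> n"
    have xy: "x \<in> carrier G" "y \<in> carrier G" and c: "\<gamma> m \<in> carrier G"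
      using W.word_geodesicD(2,3,4)[OF \<gamma>] by metis+
    have "min (H.gpb (\<gamma> m) x p) (H.gpb (\<gamma> m) p y) \<le> s"
      using H.hyperbolic[OF xy(1) p xy(2) c] K1[OF \<gamma> m] unfolding s_def by linarith
    then have "H.gpb (\<gamma> m) x p \<le> s \<or> H.gpb (\<gamma> m) y p \<le> s"
      using H.gpb_commute[OF p xy(2), of "\<gamma> m"] by (simp add: min_def split: if_splits)
    then show "(\<exists>i\<le>n1. W.wd (\<gamma> m) (\<gamma>1 i) \<le> K2) \<or> (\<exists>i\<le>n2. W.wd (\<gamma> m) (\<gamma>2 i) \<le> K2)"
      using close[OF c _ \<gamma>1] close[OF c _ \<gamma>2] by blast
  qed
  moreover have "0 \<le> K2" unfolding K2_def s_def using H.delta_nonneg by simp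
  ultimately show ?thesis by blast
qed

lemma hyperbolic_transfer: "\<exists>\<delta>'. hyperbolic_word_metric G S \<delta>'"
proof -
  obtain K where K: "0 \<le> K" "W.slim K" using word_metric_slim by blast
  have "hyperbolic_word_metric G S (3 * K + 2)"
    by unfold_locales (use K W.slim_imp_hyperbolic[OF K(2,1)] in auto)
  then show ?thesis ..
qed

end

lemma hyperbolic_group_word_metric:
  fixes G :: "('g, 'm) monoid_scheme"
  assumes "hyperbolic_group G" "finite S" "symmetric_generating_system G S"
  shows "\<exists>\<delta>. hyperbolic_word_metric G S \<delta>"
proof -
  obtain S' where S': "group G" "finite S'" "symmetric_generating_system G S'"
    "gromov_hyperbolic (cayley_graph G S') (cayley_dist G S')"
    using assms(1) unfolding hyperbolic_group_def by blast
  interpret group G by fact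
  interpret H: word_metric G S' by unfold_locales fact+
  interpret W: word_metric G S by unfold_locales fact+
  obtain \<delta> where \<delta>: "\<delta> \<ge> 0" "\<And>x y z b. x \<in> cayley_graph G S' \<Longrightarrow> y \<in> cayley_graph G S' \<Longrightarrow>
     z \<in> cayley_graph G S' \<Longrightarrow> b \<in> cayley_graph G S' \<Longrightarrow>
        gromov_product (cayley_dist G S') b x z \<ge>
        min (gromov_product (cayley_dist G S') b x y) (gromov_product (cayley_dist G S') b y z) - \<delta>"
    using S'(4) unfolding gromov_hyperbolic_def by blast
  have v: "vertex g \<in> cayley_graph G S'" if "g \<in> carrier G" for g
    using that by (simp add: cayley_graph_def)
  have gp: "gromov_product (cayley_dist G S') (vertex p) (vertex x) (vertex y) = H.gpb p x y"
    if "p \<in> carrier G" "x \<in> carrier G" "y \<in> carrier G" for p x y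
    using that cayley_dist_vertex[OF S'(3)] by (simp add: gromov_product_def)
  have "hyperbolic_word_metric G S' \<delta>"
  proof (unfold_locales, goal_cases)
    case (2 x y z p)
    then show ?case using \<delta>(2)[of "vertex x" "vertex y" "vertex z" "vertex p"] v gp by simp
  qed (rule \<delta>(1))
  then interpret hyperbolic_word_metric G S' \<delta> .
  interpret two_word_metrics G S' \<delta> S by unfold_locales
  show ?thesis by (rule hyperbolic_transfer)
qed

section \<open>Gromov products at infinity and growth\<close>

context word_metric
begin

abbreviation gp :: "'g \<Rightarrow> 'g \<Rightarrow> real" where
  "gp x y \<equiv> gpb \<one> x y"

lemma gp_def: "x \<in> carrier G \<Longrightarrow> y \<in> carrier G \<Longrightarrow> gp x y = (len x + len y - wd x y) / 2"
  by (simp add: gromov_product_def)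

lemma len_mult: "x \<in> carrier G \<Longrightarrow> y \<in> carrier G \<Longrightarrow> len (x \<otimes> y) \<le> len x + len y"
  using word_length_mult[of x y] by linarith

lemma len_le_wd: "x \<in> carrier G \<Longrightarrow> y \<in> carrier G \<Longrightarrow> len x \<le> len y + wd x y"
  using wd_triangle[of \<one> y x] wd_commute[of x y] by simp

lemma gp_commute: "x \<in> carrier G \<Longrightarrow> y \<in> carrier G \<Longrightarrow> gp x y = gp y x"
  by (rule gpb_commute)

lemma gp_translate_ge:
  assumes "k \<in> carrier G" "x \<in> carrier G" "y \<in> carrier G"
  shows "gp x y - len k \<le> gp (k \<otimes> x) (k \<otimes> y)"
  using gpb_change_base[of \<one> k "k \<otimes> x" "k \<otimes> y"] gpb_translate[of k \<one> x y] assms by simp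

text \<open>\<open>gp (inv x) z\<close> is the length that cancels in the product
  \<open>x \<otimes> z\<close>, from either factor.\<close>

lemma gp_mult_right:
  "x \<in> carrier G \<Longrightarrow> z \<in> carrier G \<Longrightarrow> gp x (x \<otimes> z) = len x - gp (inv x) z"
  using wd_translate_inv[of x \<one> z] by (simp add: gp_def field_simps)

text \<open>Translating \<open>p\<close> to the identity. For \<open>p\<close> far out in a
  direction different from \<open>x\<close> and \<open>y\<close>, the right-hand side is
  large.\<close>

lemma gp_translate_inv:
  assumes "p \<in> carrier G" "x \<in> carrier G" "y \<in> carrier G"
  shows "gp (inv p \<otimes> x) (inv p \<otimes> y) = gp x y + len p - gp x p - gp y p"
proof -
  have "len (inv p \<otimes> z) = wd p z" if "z \<in> carrier G" for z by (simp add: word_dist_def)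
  then show ?thesis
    using assms wd_commute[of p x] wd_commute[of p y] by (simp add: gp_def field_simps)
qed

lemma gp_change_right:
  "x \<in> carrier G \<Longrightarrow> y \<in> carrier G \<Longrightarrow> z \<in> carrier G \<Longrightarrow> gp x z - wd y z \<le> gp x y"
  using gpb_change_right[of \<one> x y z] by simp

text \<open>Group elements are treated as constant sequences, so that one relation covers interior points
  and points at infinity.\<close>

definition gp_ge :: "(nat \<Rightarrow> 'g) \<Rightarrow> (nat \<Rightarrow> 'g) \<Rightarrow> real \<Rightarrow> bool" where
  "gp_ge u v r \<longleftrightarrow> (\<exists>N. \<forall>n\<ge>N. \<forall>m\<ge>N. r \<le> gp (u n) (v m))"

definition gromov_seq :: "(nat \<Rightarrow> 'g) \<Rightarrow> bool" where
  "gromov_seq u \<longleftrightarrow> range u \<subseteq> carrier G \<and> (\<forall>r. gp_ge u u r)"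

text \<open>The error \<open>2\<close> is what replacing points of a ray in the Cayley graph by
  vertices costs, see \<open>near_vertex_dist\<close>.\<close>

definition quasi_ray :: "(nat \<Rightarrow> 'g) \<Rightarrow> bool" where
  "quasi_ray u \<longleftrightarrow> range u \<subseteq> carrier G \<and> (\<forall>n m. \<bar>wd (u n) (u m) - \<bar>real n - real m\<bar>\<bar> \<le> 2)"

lemma gp_geI: "(\<And>n m. N \<le> n \<Longrightarrow> N \<le> m \<Longrightarrow> r \<le> gp (u n) (v m)) \<Longrightarrow> gp_ge u v r"
  unfolding gp_ge_def by blast

lemma gp_ge_mono: "gp_ge u v r \<Longrightarrow> s \<le> r \<Longrightarrow> gp_ge u v s"
  unfolding gp_ge_def by (meson order_trans)

lemma gp_ge_const: "gp_ge (\<lambda>_. x) (\<lambda>_. y) r \<longleftrightarrow> r \<le> gp x y"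
  unfolding gp_ge_def by blast

lemma gp_ge_commute:
  assumes "gp_ge u v r" "range u \<subseteq> carrier G" "range v \<subseteq> carrier G"
  shows "gp_ge v u r"
proof -
  obtain N where N: "\<And>n m. N \<le> n \<Longrightarrow> N \<le> m \<Longrightarrow> r \<le> gp (u n) (v m)" using assms(1) unfolding gp_ge_def by blast
  show ?thesis
  proof (rule gp_geI)
    fix n m assume "N \<le> n" "N \<le> m"
    then show "r \<le> gp (v n) (u m)" using N[of m n] gp_commute[of "u m" "v n"] assms(2,3) by (simp add: range_subsetD)
  qed
qed

lemma gp_ge_translate:
  assumes "gp_ge u v r" "range u \<subseteq> carrier G" "range v \<subseteq> carrier G" "k \<in> carrier G"
  shows "gp_ge (\<lambda>n. k \<otimes> u n) (\<lambda>n. k \<otimes> v n) (r - len k)"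
proof -
  obtain N where N: "\<And>n m. N \<le> n \<Longrightarrow> N \<le> m \<Longrightarrow> r \<le> gp (u n) (v m)" using assms(1) unfolding gp_ge_def by blast
  show ?thesis
  proof (rule gp_geI)
    fix n m assume "N \<le> n" "N \<le> m"
    then show "r - len k \<le> gp (k \<otimes> u n) (k \<otimes> v m)"
      using N[of n m] gp_translate_ge[of k "u n" "v m"] assms(2-4) by (simp add: range_subsetD)
  qed
qed

lemma quasi_ray_closed: "quasi_ray u \<Longrightarrow> u n \<in> carrier G"
  unfolding quasi_ray_def by blast

lemma quasi_rayD:
  assumes "quasi_ray u"
  shows "wd (u n) (u m) \<le> \<bar>real n - real m\<bar> + 2" "\<bar>real n - real m\<bar> - 2 \<le> wd (u n) (u m)"
proof -
  have "\<bar>wd (u n) (u m) - \<bar>real n - real m\<bar>\<bar> \<le> 2" using assms unfolding quasi_ray_def by blast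
  then show "wd (u n) (u m) \<le> \<bar>real n - real m\<bar> + 2" "\<bar>real n - real m\<bar> - 2 \<le> wd (u n) (u m)" by linarith+
qed

lemma quasi_ray_len:
  assumes "quasi_ray u"
  shows "len (u n) \<le> real n + 2 + len (u 0)" "real n - 2 - len (u 0) \<le> len (u n)"
  using len_le_wd[of "u n" "u 0"] len_le_wd[of "u 0" "u n"] quasi_rayD[OF assms, of n 0]
    wd_triangle[of "u 0" \<one> "u n"] wd_commute[of "u n" "u 0"] quasi_ray_closed[OF assms] by force+

lemma quasi_ray_gp:
  assumes "quasi_ray u"
  shows "min (real n) (real m) - len (u 0) - 3 \<le> gp (u n) (u m)"
  using quasi_ray_len(2)[OF assms, of n] quasi_ray_len(2)[OF assms, of m] quasi_rayD(1)[OF assms, of n m]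
    quasi_ray_closed[OF assms] by (cases "n \<le> m") (simp_all add: gp_def min_def field_simps)

lemma quasi_ray_gromov_seq: "quasi_ray u \<Longrightarrow> gromov_seq u"
  unfolding gromov_seq_def
proof safe
  fix r assume u: "quasi_ray u"
  show "gp_ge u u r"
  proof (rule gp_geI[of "nat \<lceil>r + len (u 0) + 3\<rceil>"])
    fix n m assume "nat \<lceil>r + len (u 0) + 3\<rceil> \<le> n" "nat \<lceil>r + len (u 0) + 3\<rceil> \<le> m"
    then have "r + len (u 0) + 3 \<le> min (real n) (real m)" by linarith
    then show "r \<le> gp (u n) (u m)" using quasi_ray_gp[OF u, of n m] by linarith
  qed
qed (use quasi_ray_closed in auto)

lemma quasi_ray_translate:
  "quasi_ray u \<Longrightarrow> k \<in> carrier G \<Longrightarrow> quasi_ray (\<lambda>n. k \<otimes> u n)"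
  unfolding quasi_ray_def by (auto simp: range_subsetD)

lemma bounded_dist_gp_ge:
  assumes "quasi_ray u" "quasi_ray v" "\<And>n. wd (u n) (v n) \<le> B"
  shows "gp_ge u v r"
proof (rule gp_geI[of "nat \<lceil>r + len (u 0) + B + 5\<rceil>"])
  fix n m assume nm: "nat \<lceil>r + len (u 0) + B + 5\<rceil> \<le> n" "nat \<lceil>r + len (u 0) + B + 5\<rceil> \<le> m"
  have "gp (u n) (u m) - wd (v m) (u m) \<le> gp (u n) (v m)"
    using gp_change_right quasi_ray_closed assms(1,2) by blast
  moreover have "wd (v m) (u m) \<le> B" using assms(3)[of m] wd_commute quasi_ray_closed assms(1,2) by metis
  moreover have "r + len (u 0) + B + 5 \<le> min (real n) (real m)" using nm by linarith
  ultimately show "r \<le> gp (u n) (v m)" using quasi_ray_gp[OF assms(1), of n m] by linarith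
qed

end

section \<open>Separation at infinity and linear growth\<close>

context hyperbolic_word_metric
begin

lemma gp_hyperbolic:
  "x \<in> carrier G \<Longrightarrow> y \<in> carrier G \<Longrightarrow> z \<in> carrier G \<Longrightarrow> min (gp x y) (gp y z) - \<delta> \<le> gp x z"
  by (rule hyperbolic) auto

lemma gp_hyperbolicD:
  "r \<le> gp x y \<Longrightarrow> s \<le> gp y z \<Longrightarrow> x \<in> carrier G \<Longrightarrow> y \<in> carrier G \<Longrightarrow> z \<in> carrier G \<Longrightarrow>
   min r s - \<delta> \<le> gp x z"
  using gp_hyperbolic[of x y z] by linarith

lemma gp_ge_trans:
  assumes "gp_ge u v r" "gp_ge v w s" "range u \<subseteq> carrier G" "range v \<subseteq> carrier G" "range w \<subseteq> carrier G"
  shows "gp_ge u w (min r s - \<delta>)"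
proof -
  obtain N where N: "\<And>n m. N \<le> n \<Longrightarrow> N \<le> m \<Longrightarrow> r \<le> gp (u n) (v m)" using assms(1) unfolding gp_ge_def by blast
  obtain N' where N': "\<And>n m. N' \<le> n \<Longrightarrow> N' \<le> m \<Longrightarrow> s \<le> gp (v n) (w m)" using assms(2) unfolding gp_ge_def by blast
  show ?thesis
  proof (rule gp_geI[of "max N N'"])
    fix n m assume nm: "max N N' \<le> n" "max N N' \<le> m"
    show "min r s - \<delta> \<le> gp (u n) (w m)"
      by (rule gp_hyperbolicD[OF N[of n "max N N'"] N'[of "max N N'" m]]) (use nm assms(3-5) in auto)
  qed
qed

lemma gp_ge_all_trans:
  assumes "\<And>r. gp_ge u v r" "gp_ge v w s" "range u \<subseteq> carrier G" "range v \<subseteq> carrier G" "range w \<subseteq> carrier G"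
  shows "gp_ge u w (s - \<delta>)"
  using gp_ge_trans[OF assms(1)[of s] assms(2-5)] by simp

text \<open>Failure of \<open>gp_ge\<close> by itself gives small products at some late indices
  only. One large product at late indices would make all of them large, so all late products are
  small, up to \<open>2 * \<delta>\<close>.\<close>

lemma not_gp_geD:
  assumes "\<not> gp_ge u v r" "gromov_seq u" "gromov_seq v"
  obtains N where "\<And>n m. N \<le> n \<Longrightarrow> N \<le> m \<Longrightarrow> gp (u n) (v m) < r + 2 * \<delta>"
proof -
  define R where "R = r + 2 * \<delta>"
  have c: "u n \<in> carrier G" "v n \<in> carrier G" for n using assms(2,3) unfolding gromov_seq_def by auto
  have "gp_ge u u R" using assms(2) unfolding gromov_seq_def by blast
  then obtain N where N: "\<And>n m. N \<le> n \<Longrightarrow> N \<le> m \<Longrightarrow> R \<le> gp (u n) (u m)"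
    unfolding gp_ge_def by blast
  have "gp_ge v v R" using assms(3) unfolding gromov_seq_def by blast
  then obtain N' where N': "\<And>n m. N' \<le> n \<Longrightarrow> N' \<le> m \<Longrightarrow> R \<le> gp (v n) (v m)"
    unfolding gp_ge_def by blast
  have "gp (u n) (v m) < r + 2 * \<delta>" if nm: "max N N' \<le> n" "max N N' \<le> m" for n m
  proof (rule ccontr)
    assume "\<not> ?thesis"
    then have big: "R \<le> gp (u n) (v m)" by (simp add: R_def)
    have "gp_ge u v r"
    proof (rule gp_geI[of "max N N'"])
      fix n' m' assume nm': "max N N' \<le> n'" "max N N' \<le> m'"
      have "min R R - \<delta> \<le> gp (u n') (v m)" by (rule gp_hyperbolicD[OF N big]) (use nm nm' c in auto)
      then have "min (min R R - \<delta>) R - \<delta> \<le> gp (u n') (v m')"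
        by (rule gp_hyperbolicD[OF _ N']) (use nm nm' c in auto)
      then show "r \<le> gp (u n') (v m')" using delta_nonneg unfolding R_def by simp
    qed
    then show False using assms(1) by blast
  qed
  then show thesis by (rule that)
qed

text \<open>At time \<open>t\<close>, pass from \<open>u t\<close> to \<open>u n\<close>, on to
  \<open>v n\<close> and back to \<open>v t\<close> for a late \<open>n\<close>: each of the three
  products is about \<open>t\<close>, so \<open>u t\<close> and \<open>v t\<close> are
  close.\<close>

lemma gp_ge_bounded_dist:
  assumes "quasi_ray u" "quasi_ray v" "\<And>r. gp_ge u v r"
  shows "\<exists>B. \<forall>n. wd (u n) (v n) \<le> B"
proof -
  define c where "c = len (u 0) + len (v 0) + 3"
  have cl: "u n \<in> carrier G" "v n \<in> carrier G" for n using assms(1,2) quasi_ray_closed by auto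
  have "wd (u t) (v t) \<le> 4 * \<delta> + 4 + 3 * c" for t
  proof -
    obtain N where N: "\<And>n m. N \<le> n \<Longrightarrow> N \<le> m \<Longrightarrow> real t \<le> gp (u n) (v m)"
      using assms(3)[of "real t"] unfolding gp_ge_def by blast
    define n where "n = max N t"
    have 1: "real t - c \<le> gp (u t) (u n)" using quasi_ray_gp[OF assms(1), of t n] by (simp add: c_def n_def)
    have 2: "real t - c \<le> gp (v n) (v t)" using quasi_ray_gp[OF assms(2), of n t] by (simp add: c_def n_def)
    have 3: "real t - c \<le> gp (u n) (v n)" using N[of n n] by (simp add: n_def c_def)
    have "min (real t - c) (real t - c) - \<delta> \<le> gp (u t) (v n)" by (rule gp_hyperbolicD[OF 1 3]) (rule cl)+
    then have "min (min (real t - c) (real t - c) - \<delta>) (real t - c) - \<delta> \<le> gp (u t) (v t)"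
      by (rule gp_hyperbolicD[OF _ 2]) (rule cl)+
    then have "real t - c - 2 * \<delta> \<le> gp (u t) (v t)" using delta_nonneg by simp
    then show ?thesis
      using quasi_ray_len(1)[OF assms(1), of t] quasi_ray_len(1)[OF assms(2), of t] cl[of t]
      by (simp add: gp_def c_def field_simps)
  qed
  then show ?thesis by blast
qed

text \<open>If every group element moves a sequence tending to infinity by a bounded amount, then, up to
  finitely many possibilities, it acts on the middle of a geodesic to a far point of the sequence as a
  shift, which is determined by one of linearly many shift lengths.\<close>

lemma linear_growth:
  assumes q: "range q \<subseteq> carrier G" "\<And>r. \<exists>n. r \<le> len (q n)"
    and bounded: "\<And>t. t \<in> carrier G \<Longrightarrow> \<exists>C. \<forall>n. wd (q n) (t \<otimes> q n) \<le> C"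
  shows "card {g \<in> carrier G. len g \<le> real R} \<le> (2 * R + 1) * card {g \<in> carrier G. len g \<le> 6 * \<delta>}"
proof -
  let ?B = "{g \<in> carrier G. len g \<le> real R}" and ?K = "{g \<in> carrier G. len g \<le> 6 * \<delta>}"
  obtain C where C: "\<And>t n. t \<in> carrier G \<Longrightarrow> wd (q n) (t \<otimes> q n) \<le> C t" using bounded by metis
  define Cm where "Cm = Max (insert 0 (C ` ?B))"
  have Cm: "wd (q n) (t \<otimes> q n) \<le> Cm" if "t \<in> ?B" for t n
  proof -
    have "C t \<le> Cm" unfolding Cm_def by (intro Max_ge finite.insertI finite_imageI finite_ball) (use that in auto)
    then show ?thesis using C[of t n] that by auto
  qed
  define m where "m = nat \<lceil>real R + 2 * \<delta> + 1\<rceil>"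
  have mR: "real R + 2 * \<delta> < real m" "R \<le> m" unfolding m_def using delta_nonneg by linarith+
  obtain n where n: "real m + real R + Cm + 2 * \<delta> + 1 \<le> len (q n)" using q(2) by blast
  define Q where "Q = q n"
  define N where "N = word_length G S Q"
  have Q: "Q \<in> carrier G" using q(1) by (auto simp: Q_def)
  have "0 \<le> Cm" unfolding Cm_def by (intro Max_ge finite.insertI finite_imageI finite_ball) auto
  then have N: "m + R \<le> N" "Cm + 2 * \<delta> < real N - real m"
    using n delta_nonneg unfolding N_def Q_def by linarith+
  obtain \<gamma> where "word_geodesic \<gamma> (word_dist G S \<one> Q) \<one> Q"
    using word_geodesic_exists[OF one_closed Q] .
  then have \<gamma>: "word_geodesic \<gamma> N \<one> Q" using Q by (simp add: N_def word_dist_def)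
  define z where "z = \<gamma> m"
  have z: "z \<in> carrier G" and \<gamma>c: "\<And>i. \<gamma> i \<in> carrier G" using word_geodesicD(4)[OF \<gamma>] by (simp_all add: z_def)
  have zlen: "word_length G S z = m" "wd z Q = real N - real m"
    using word_geodesicD(6,7)[OF \<gamma>, of m] N(1) z by (simp_all add: z_def word_dist_def of_nat_diff)
  have zg: "gpb z \<one> Q = 0" unfolding z_def using word_geodesic_gpb[OF \<gamma>] N(1) by simp
  have "t \<in> (\<lambda>(i, e). \<gamma> i \<otimes> e \<otimes> inv z) ` ({m - R..m + R} \<times> ?K)" if t: "t \<in> ?B" for t
  proof -
    have tc: "t \<in> carrier G" and tl: "len t \<le> real R" using t by auto
    define p where "p = t \<otimes> z"
    have p: "p \<in> carrier G" and tQ: "t \<otimes> Q \<in> carrier G" using tc z Q by (auto simp: p_def)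
    have 0: "gpb p t (t \<otimes> Q) = 0"
      using gpb_translate[OF tc z one_closed Q] zg tc by (simp add: p_def)
    have pt: "wd p t = real m"
      using word_dist_translate[OF tc z one_closed] zlen(1) tc z by (simp add: p_def)
    have pQ: "wd p (t \<otimes> Q) = real N - real m"
      using word_dist_translate[OF tc z Q] zlen(2) by (simp add: p_def)
    \<comment> \<open>Seen from \<open>p\<close>, the identity is in the direction of
      \<open>t\<close> and \<open>Q\<close> in that of \<open>t \<otimes> Q\<close>. Hence
      \<open>p\<close>, which lies on a geodesic from \<open>t\<close> to
      \<open>t \<otimes> Q\<close>, is also close to the geodesic from the identity to
      \<open>Q\<close>.\<close>
    have "gpb p t \<one> \<ge> wd p t - wd \<one> t"
      using gpb_change_right[OF p tc one_closed tc] tc by (simp add: gromov_product_def)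
    then have 1: "2 * \<delta> < gpb p t \<one>" using pt tl mR tc by simp
    have "gpb p (t \<otimes> Q) Q \<ge> wd p (t \<otimes> Q) - wd Q (t \<otimes> Q)"
      using gpb_change_right[OF p tQ Q tQ] tQ by (simp add: gromov_product_def)
    then have 2: "2 * \<delta> < gpb p Q (t \<otimes> Q)"
      using gpb_commute[OF tQ Q, of p] pQ N(2) Cm[OF t, of n] by (simp add: Q_def)
    have "gpb p t (t \<otimes> Q) \<ge> min (gpb p t \<one>) (gpb p \<one> (t \<otimes> Q)) - \<delta>"
      by (rule hyperbolic) (use tc tQ p in auto)
    moreover have "gpb p \<one> (t \<otimes> Q) \<ge> min (gpb p \<one> Q) (gpb p Q (t \<otimes> Q)) - \<delta>"
      by (rule hyperbolic) (use Q tQ p in auto)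
    ultimately have "gpb p \<one> Q \<le> 2 * \<delta>" using 0 1 2 delta_nonneg by linarith
    \<comment> \<open>\<open>near_geodesic\<close> with \<open>s = 2 * \<delta>\<close> gives the
      radius \<open>6 * \<delta>\<close> of the statement, and an index determined by the length of
      \<open>p\<close>, which differs from \<open>m\<close> by at most \<open>R\<close>.\<close>
    then obtain i where i: "wd p (\<gamma> i) \<le> 2 * (2 * \<delta>) + 2 * \<delta>" "i = min (word_dist G S \<one> p) N"
      using near_geodesic[OF \<gamma> p] by blast
    have "len p \<le> len t + len z" unfolding p_def using len_mult tc z by blast
    moreover have "len z \<le> len t + len p"
      using len_mult[of "inv t" p] tc z by (simp add: p_def m_assoc[symmetric])
    ultimately have ir: "i \<in> {m - R..m + R}"
      using i(2) zlen(1) tl N(1) p by (auto simp: word_dist_def)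
    define e where "e = inv (\<gamma> i) \<otimes> p"
    have ec: "e \<in> carrier G" using \<gamma>c p by (simp add: e_def)
    have "len e = wd (\<gamma> i) p" by (simp add: e_def word_dist_def)
    then have e: "e \<in> ?K" using i(1) wd_commute[OF p \<gamma>c, of i] ec by simp
    have "t = \<gamma> i \<otimes> e \<otimes> inv z"
      using tc z \<gamma>c[of i] by (simp add: e_def p_def m_assoc[symmetric]) (simp add: m_assoc)
    then show ?thesis using ir e by (intro image_eqI[of _ _ "(i, e)"]) auto
  qed
  then have "?B \<subseteq> (\<lambda>(i, e). \<gamma> i \<otimes> e \<otimes> inv z) ` ({m - R..m + R} \<times> ?K)" by blast
  then have "card ?B \<le> card ({m - R..m + R} \<times> ?K)"
    by (rule surj_card_le[rotated]) (use finite_ball in simp)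
  also have "\<dots> = card {m - R..m + R} * card ?K" by (rule card_cartesian_product)
  also have "\<dots> \<le> (2 * R + 1) * card ?K" using mR(2) by (intro mult_right_mono) auto
  finally show ?thesis .
qed

text \<open>Late points of diverging rays are distinct, so whenever the radius grows by
  \<open>3\<close> every ray contributes a new point, whereas the growth bound allows only
  \<open>6 * B\<close> new points.\<close>

lemma separated_rays_growth:
  assumes I: "finite I" and u: "\<And>i. i \<in> I \<Longrightarrow> quasi_ray (u i)"
    and sep: "\<And>i j. i \<in> I \<Longrightarrow> j \<in> I \<Longrightarrow> i \<noteq> j \<Longrightarrow> \<exists>r. \<not> gp_ge (u i) (u j) r"
    and growth: "\<And>R::nat. card {g \<in> carrier G. len g \<le> real R} \<le> (2 * R + 1) * B"
  shows "card I \<le> 6 * B"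
proof -
  have "\<exists>N K. \<forall>n m. N \<le> n \<longrightarrow> N \<le> m \<longrightarrow> gp (u i n) (u j m) < K" if "i \<in> I" "j \<in> I" "i \<noteq> j" for i j
    using sep[OF that] not_gp_geD quasi_ray_gromov_seq u that by metis
  then obtain N K where NK: "\<And>i j n m. i \<in> I \<Longrightarrow> j \<in> I \<Longrightarrow> i \<noteq> j \<Longrightarrow> N i j \<le> n \<Longrightarrow> N i j \<le> m \<Longrightarrow>
      gp (u i n) (u j m) < K i j" by metis
  define c where "c = Max (insert 0 ((\<lambda>i. word_length G S (u i 0)) ` I))"
  have c: "word_length G S (u i 0) \<le> c" if "i \<in> I" for i
    unfolding c_def using I that by (intro Max_ge) auto
  define K0 where "K0 = Max (insert 0 ((\<lambda>(i, j). K i j) ` (I \<times> I)))"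
  have K0: "K i j \<le> K0" if "i \<in> I" "j \<in> I" for i j
    unfolding K0_def using I that by (intro Max_ge) auto
  define N0 where "N0 = Max (insert (nat \<lceil>K0\<rceil> + 2 + c) ((\<lambda>(i, j). N i j) ` (I \<times> I)))"
  have N0: "N i j \<le> N0" if "i \<in> I" "j \<in> I" for i j
    unfolding N0_def using I that by (intro Max_ge) auto
  have N0': "nat \<lceil>K0\<rceil> + 2 + c \<le> N0" unfolding N0_def using I by (intro Max_ge) auto
  have main: "card I * T \<le> (2 * (3 * (N0 + T) + 2 + c) + 1) * B" for T
  proof -
    \<comment> \<open>Every third point is used: with an error of \<open>2\<close> in
      \<open>quasi_ray\<close>, closer points of one ray could coincide.\<close>
    let ?A = "I \<times> {N0..<N0 + T}" and ?f = "\<lambda>(i, n). u i (3 * n)"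
    have "inj_on ?f ?A"
    proof (intro inj_onI, clarsimp)
      fix i n j m assume ij: "i \<in> I" "j \<in> I" and nm: "N0 \<le> n" "N0 \<le> m" and eq: "u i (3 * n) = u j (3 * m)"
      have uc: "u i (3 * n) \<in> carrier G" using u ij quasi_ray_closed by blast
      have ij': "i = j"
      proof (rule ccontr)
        assume ne: "i \<noteq> j"
        have "gp (u i (3 * n)) (u j (3 * m)) < K i j"
          by (rule NK[OF ij ne]) (use N0[OF ij] nm in simp_all)
        then have "len (u i (3 * n)) < K0" using eq[symmetric] uc K0[OF ij] by (simp add: gp_def)
        moreover have "K0 \<le> real (3 * n) - 2 - real c" using N0' nm by linarith
        ultimately show False using quasi_ray_len(2)[OF u[OF ij(1)], of "3 * n"] c[OF ij(1)] by linarith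
      qed
      moreover have "n = m"
        using quasi_rayD(2)[OF u[OF ij(1)], of "3 * n" "3 * m"] eq ij' uc by (simp add: abs_if split: if_splits)
      ultimately show "i = j \<and> n = m" by simp
    qed
    then have "card I * T = card (?f ` ?A)" by (simp add: card_image card_cartesian_product)
    also have "\<dots> \<le> card {g \<in> carrier G. len g \<le> real (3 * (N0 + T) + 2 + c)}"
    proof (rule card_mono[OF finite_ball], safe)
      fix i n assume i: "i \<in> I" "n \<in> {N0..<N0 + T}"
      show "u i (3 * n) \<in> carrier G" using u i(1) quasi_ray_closed by blast
      show "len (u i (3 * n)) \<le> real (3 * (N0 + T) + 2 + c)"
        using quasi_ray_len(1)[OF u[OF i(1)], of "3 * n"] c[OF i(1)] i(2) by simp
    qed
    also have "\<dots> \<le> (2 * (3 * (N0 + T) + 2 + c) + 1) * B" by (rule growth)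
    finally show ?thesis .
  qed
  show ?thesis
  proof (rule ccontr)
    assume "\<not> ?thesis"
    then have "6 * B + 1 \<le> card I" by simp
    \<comment> \<open>Exceeds the part of the bound in \<open>main\<close> that does not depend on
      \<open>T\<close>.\<close>
    define T where "T = (6 * N0 + 5 + 2 * c) * B + 1"
    have "(6 * B + 1) * T \<le> card I * T" using \<open>6 * B + 1 \<le> card I\<close> by (rule mult_right_mono) simp
    also have "\<dots> \<le> (2 * (3 * (N0 + T) + 2 + c) + 1) * B" by (rule main)
    also have "\<dots> = 6 * B * T + (6 * N0 + 5 + 2 * c) * B" by (simp add: algebra_simps)
    also have "\<dots> < 6 * B * T + T" by (simp add: T_def)
    also have "\<dots> = (6 * B + 1) * T" by (simp add: algebra_simps)
    finally show False by simp
  qed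
qed

end

section \<open>Abstract boundaries and spread jumps\<close>

text \<open>A boundary known only through representing sequences of vertices. The action is tied to
  the group only via the representatives; its compatibility with products and its injectivity are
  consequences.\<close>

locale hyperbolic_boundary = hyperbolic_word_metric G S \<delta>
  for G :: "('g, 'm) monoid_scheme" (structure) and S \<delta> +
  fixes bd :: "'b set" and rep :: "'b \<Rightarrow> nat \<Rightarrow> 'g" and act :: "'g \<Rightarrow> 'b \<Rightarrow> 'b"
  assumes rep_quasi_ray: "\<xi> \<in> bd \<Longrightarrow> quasi_ray (rep \<xi>)"
    and rep_eqI: "\<lbrakk>\<xi> \<in> bd; \<eta> \<in> bd; \<And>r. gp_ge (rep \<xi>) (rep \<eta>) r\<rbrakk> \<Longrightarrow> \<xi> = \<eta>"
    and act_closed: "\<lbrakk>g \<in> carrier G; \<xi> \<in> bd\<rbrakk> \<Longrightarrow> act g \<xi> \<in> bd"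
    and act_rep: "\<lbrakk>g \<in> carrier G; \<xi> \<in> bd\<rbrakk> \<Longrightarrow> gp_ge (\<lambda>n. g \<otimes> rep \<xi> n) (rep (act g \<xi>)) r"
    and three_points: "infinite bd \<or> card bd > 2"
begin

lemma rep_closed: "\<xi> \<in> bd \<Longrightarrow> rep \<xi> n \<in> carrier G"
  using rep_quasi_ray quasi_ray_closed by blast

lemma rep_range: "\<xi> \<in> bd \<Longrightarrow> range (rep \<xi>) \<subseteq> carrier G"
  using rep_closed by blast

lemma translate_rep_range: "g \<in> carrier G \<Longrightarrow> \<xi> \<in> bd \<Longrightarrow> range (\<lambda>n. g \<otimes> rep \<xi> n) \<subseteq> carrier G"
  using rep_closed by blast

lemma rep_gromov_seq: "\<xi> \<in> bd \<Longrightarrow> gromov_seq (rep \<xi>)"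
  using rep_quasi_ray quasi_ray_gromov_seq by blast

lemma act_rep': "g \<in> carrier G \<Longrightarrow> \<xi> \<in> bd \<Longrightarrow> gp_ge (rep (act g \<xi>)) (\<lambda>n. g \<otimes> rep \<xi> n) r"
  by (rule gp_ge_commute[OF act_rep]) (simp_all add: translate_rep_range rep_range act_closed)

lemma gp_ge_act:
  assumes "g \<in> carrier G" "\<xi> \<in> bd" "\<eta> \<in> bd" "gp_ge (\<lambda>n. g \<otimes> rep \<xi> n) (\<lambda>n. g \<otimes> rep \<eta> n) r"
  shows "gp_ge (rep (act g \<xi>)) (rep (act g \<eta>)) (r - 2 * \<delta>)"
proof -
  have "gp_ge (rep (act g \<xi>)) (\<lambda>n. g \<otimes> rep \<eta> n) (min r r - \<delta>)"
    by (rule gp_ge_trans[OF act_rep' assms(4)]) (simp_all add: assms translate_rep_range rep_range act_closed)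
  then have "gp_ge (rep (act g \<xi>)) (rep (act g \<eta>)) (min (min r r - \<delta>) (min r r - \<delta>) - \<delta>)"
    by (rule gp_ge_trans[OF _ act_rep]) (simp_all add: assms translate_rep_range rep_range act_closed)
  then show ?thesis by (simp add: algebra_simps)
qed

lemma gp_ge_act_cancel:
  assumes "g \<in> carrier G" "\<xi> \<in> bd" "\<eta> \<in> bd" "gp_ge (rep (act g \<xi>)) (rep (act g \<eta>)) r"
  shows "gp_ge (\<lambda>n. g \<otimes> rep \<xi> n) (\<lambda>n. g \<otimes> rep \<eta> n) (r - 2 * \<delta>)"
proof -
  have "gp_ge (\<lambda>n. g \<otimes> rep \<xi> n) (rep (act g \<eta>)) (min r r - \<delta>)"
    by (rule gp_ge_trans[OF act_rep assms(4)]) (simp_all add: assms translate_rep_range rep_range act_closed)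
  then have "gp_ge (\<lambda>n. g \<otimes> rep \<xi> n) (\<lambda>n. g \<otimes> rep \<eta> n) (min (min r r - \<delta>) (min r r - \<delta>) - \<delta>)"
    by (rule gp_ge_trans[OF _ act_rep']) (simp_all add: assms translate_rep_range rep_range act_closed)
  then show ?thesis by (simp add: algebra_simps)
qed

lemma gp_ge_act_len:
  assumes "g \<in> carrier G" "\<xi> \<in> bd" "\<eta> \<in> bd" "gp_ge (rep \<xi>) (rep \<eta>) r"
  shows "gp_ge (rep (act g \<xi>)) (rep (act g \<eta>)) (r - len g - 2 * \<delta>)"
  by (rule gp_ge_act[OF assms(1-3) gp_ge_translate[OF assms(4)]]) (use assms rep_range in auto)

lemma gp_ge_act_cancel_len:
  assumes g: "g \<in> carrier G" and "\<xi> \<in> bd" "\<eta> \<in> bd" "gp_ge (rep (act g \<xi>)) (rep (act g \<eta>)) r"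
  shows "gp_ge (rep \<xi>) (rep \<eta>) (r - len g - 2 * \<delta>)"
proof -
  have "gp_ge (\<lambda>n. inv g \<otimes> (g \<otimes> rep \<xi> n)) (\<lambda>n. inv g \<otimes> (g \<otimes> rep \<eta> n)) (r - 2 * \<delta> - len (inv g))"
    by (rule gp_ge_translate[OF gp_ge_act_cancel[OF assms]])
      (use assms translate_rep_range in auto)
  moreover have "inv g \<otimes> (g \<otimes> rep \<zeta> n) = rep \<zeta> n" if "\<zeta> \<in> bd" for \<zeta> n
    using g rep_closed[OF that] by (simp add: m_assoc[symmetric])
  ultimately show ?thesis using assms(2,3) g by (simp add: algebra_simps)
qed

lemma act_inj:
  assumes "g \<in> carrier G" "\<xi> \<in> bd" "\<eta> \<in> bd" "act g \<xi> = act g \<eta>"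
  shows "\<xi> = \<eta>"
proof (rule rep_eqI[OF assms(2,3)])
  fix r
  have "gp_ge (rep (act g \<xi>)) (rep (act g \<eta>)) (r + len g + 2 * \<delta>)"
    using rep_gromov_seq[OF act_closed[OF assms(1,2)]] assms(4) by (simp add: gromov_seq_def)
  from gp_ge_act_cancel_len[OF assms(1-3) this] show "gp_ge (rep \<xi>) (rep \<eta>) r" by simp
qed

lemma act_mult:
  assumes "g \<in> carrier G" "h \<in> carrier G" "\<xi> \<in> bd"
  shows "act g (act h \<xi>) = act (g \<otimes> h) \<xi>"
proof (rule rep_eqI)
  fix r
  have "gp_ge (\<lambda>n. g \<otimes> rep (act h \<xi>) n) (\<lambda>n. g \<otimes> (h \<otimes> rep \<xi> n)) (r + 2 * \<delta> + len g - len g)"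
    by (rule gp_ge_translate[OF act_rep']) (use assms act_closed rep_range translate_rep_range in auto)
  then have 1: "gp_ge (\<lambda>n. g \<otimes> rep (act h \<xi>) n) (\<lambda>n. (g \<otimes> h) \<otimes> rep \<xi> n) (r + 2 * \<delta>)"
    using assms rep_closed by (simp add: m_assoc)
  have "gp_ge (rep (act g (act h \<xi>))) (\<lambda>n. (g \<otimes> h) \<otimes> rep \<xi> n) (r + 2 * \<delta> - \<delta>)"
    by (rule gp_ge_all_trans[OF act_rep' 1])
      (use assms act_closed in \<open>simp_all add: translate_rep_range rep_range\<close>)
  then have "gp_ge (rep (act g (act h \<xi>))) (rep (act (g \<otimes> h) \<xi>)) (min (r + 2 * \<delta> - \<delta>) (r + 2 * \<delta> - \<delta>) - \<delta>)"
    by (rule gp_ge_trans[OF _ act_rep])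
      (use assms act_closed in \<open>simp_all add: translate_rep_range rep_range\<close>)
  then show "gp_ge (rep (act g (act h \<xi>))) (rep (act (g \<otimes> h) \<xi>)) r" by simp
qed (use assms act_closed in auto)

lemma rep_separated:
  assumes "\<xi> \<in> bd" "\<eta> \<in> bd" "\<xi> \<noteq> \<eta>"
  obtains K N where "\<And>n m. N \<le> n \<Longrightarrow> N \<le> m \<Longrightarrow> gp (rep \<xi> n) (rep \<eta> m) < K"
proof -
  obtain r where "\<not> gp_ge (rep \<xi>) (rep \<eta>) r" using rep_eqI assms by blast
  then show thesis using not_gp_geD rep_gromov_seq assms that by metis
qed

section \<open>Finite invariant sets and infinite orbits\<close>

lemma third_point:
  obtains \<zeta> where "\<zeta> \<in> bd" "\<zeta> \<noteq> \<xi>" "\<zeta> \<noteq> \<eta>"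
proof -
  have "\<not> bd \<subseteq> {\<xi>, \<eta>}"
  proof
    assume "bd \<subseteq> {\<xi>, \<eta>}"
    then have "finite bd" "card bd \<le> card {\<xi>, \<eta>}" using finite_subset[of bd "{\<xi>, \<eta>}"] card_mono[of "{\<xi>, \<eta>}" bd] by auto
    moreover have "card {\<xi>, \<eta>} \<le> 2" by (simp add: card_insert_if)
    ultimately show False using three_points by linarith
  qed
  then show thesis using that by blast
qed

text \<open>Translating back along a ray to a third point \<open>\<zeta>\<close> makes the images of \<open>\<xi>\<close> and \<open>\<eta>\<close>
  arbitrarily close.\<close>

lemma finite_invariant_trivial:
  assumes F: "finite F" "F \<subseteq> bd" and inv: "\<And>g \<xi>. g \<in> carrier G \<Longrightarrow> \<xi> \<in> F \<Longrightarrow> act g \<xi> \<in> F"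
    and \<xi>: "\<xi> \<in> F" and \<eta>: "\<eta> \<in> F"
  shows "\<xi> = \<eta>"
proof (rule ccontr)
  assume ne: "\<xi> \<noteq> \<eta>"
  have bd: "\<xi> \<in> bd" "\<eta> \<in> bd" using F \<xi> \<eta> by auto
  obtain \<zeta> where \<zeta>: "\<zeta> \<in> bd" "\<zeta> \<noteq> \<xi>" "\<zeta> \<noteq> \<eta>" by (rule third_point)
  obtain K1 N1 where 1: "\<And>n m. N1 \<le> n \<Longrightarrow> N1 \<le> m \<Longrightarrow> gp (rep \<xi> n) (rep \<zeta> m) < K1"
    using rep_separated[OF bd(1) \<zeta>(1)] \<zeta>(2) by metis
  obtain K2 N2 where 2: "\<And>n m. N2 \<le> n \<Longrightarrow> N2 \<le> m \<Longrightarrow> gp (rep \<eta> n) (rep \<zeta> m) < K2"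
    using rep_separated[OF bd(2) \<zeta>(1)] \<zeta>(3) by metis
  have "\<exists>r. \<alpha> \<in> F \<longrightarrow> \<beta> \<in> F \<longrightarrow> \<alpha> \<noteq> \<beta> \<longrightarrow> \<not> gp_ge (rep \<alpha>) (rep \<beta>) r" for \<alpha> \<beta>
    using rep_eqI F(2) by blast
  then obtain r where r: "\<And>\<alpha> \<beta>. \<alpha> \<in> F \<Longrightarrow> \<beta> \<in> F \<Longrightarrow> \<alpha> \<noteq> \<beta> \<Longrightarrow> \<not> gp_ge (rep \<alpha>) (rep \<beta>) (r \<alpha> \<beta>)"
    by metis
  \<comment> \<open>A common threshold separating all distinct points of the finite set
    \<open>F\<close>; the translation by \<open>inv p\<close> will violate it.\<close>
  define R where "R = Max ((\<lambda>(\<alpha>, \<beta>). r \<alpha> \<beta>) ` (F \<times> F))"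
  have R: "r \<alpha> \<beta> \<le> R" if "\<alpha> \<in> F" "\<beta> \<in> F" for \<alpha> \<beta>
    unfolding R_def using F(1) that by (intro Max_ge) auto
  define n where "n = max (max N1 N2) (nat \<lceil>R + 2 * \<delta> + K1 + K2 + 2 + len (rep \<zeta> 0)\<rceil>)"
  define p where "p = rep \<zeta> n"
  have p: "p \<in> carrier G" unfolding p_def using rep_closed \<zeta> by blast
  have pl: "R + 2 * \<delta> + K1 + K2 \<le> len p"
    using quasi_ray_len(2)[OF rep_quasi_ray[OF \<zeta>(1)], of n] unfolding p_def n_def by linarith
  have "gp_ge (\<lambda>k. inv p \<otimes> rep \<xi> k) (\<lambda>k. inv p \<otimes> rep \<eta> k) (R + 2 * \<delta>)"
  proof (rule gp_geI[of "max N1 N2"])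
    fix k l assume kl: "max N1 N2 \<le> k" "max N1 N2 \<le> l"
    have c: "rep \<xi> k \<in> carrier G" "rep \<eta> l \<in> carrier G" using rep_closed bd by auto
    have "0 \<le> gp (rep \<xi> k) (rep \<eta> l)" using gpb_nonneg c by blast
    moreover have "gp (rep \<xi> k) p < K1" "gp (rep \<eta> l) p < K2"
      unfolding p_def by (rule 1 2; use kl in \<open>simp add: n_def\<close>)+
    ultimately show "R + 2 * \<delta> \<le> gp (inv p \<otimes> rep \<xi> k) (inv p \<otimes> rep \<eta> l)"
      using gp_translate_inv[OF p c] pl by linarith
  qed
  from gp_ge_act[OF _ bd this] have "gp_ge (rep (act (inv p) \<xi>)) (rep (act (inv p) \<eta>)) R"
    using p by simp
  moreover have "act (inv p) \<xi> \<noteq> act (inv p) \<eta>" using act_inj bd p ne by blast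
  moreover have F': "act (inv p) \<xi> \<in> F" "act (inv p) \<eta> \<in> F" using inv \<xi> \<eta> p by auto
  ultimately show False using r[OF F'] R[OF F'] gp_ge_mono by blast
qed

text \<open>Otherwise the boundary itself would be a finite invariant set with more than one
  point.\<close>

lemma infinite_boundary: "infinite bd"
proof
  assume fin: "finite bd"
  obtain \<xi> where "\<xi> \<in> bd" using third_point by blast
  moreover obtain \<eta> where "\<eta> \<in> bd" "\<eta> \<noteq> \<xi>" using third_point by blast
  ultimately show False using finite_invariant_trivial[OF fin order_refl] act_closed by blast
qed

text \<open>If all displacements were bounded, the growth would be linear, which leaves room for at
  most \<open>6 * B\<close> boundary points.\<close>

lemma exists_unbounded_displacement:
  assumes q: "range q \<subseteq> carrier G" "\<And>r. \<exists>n. r \<le> len (q n)"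
  obtains t where "t \<in> carrier G" "\<And>C. \<exists>n. C < wd (q n) (t \<otimes> q n)"
proof (rule ccontr)
  assume no: "\<not> thesis"
  define B where "B = card {g \<in> carrier G. len g \<le> 6 * \<delta>}"
  note found = that
  have "\<exists>C. \<forall>n. wd (q n) (t \<otimes> q n) \<le> C" if "t \<in> carrier G" for t
  proof (rule ccontr)
    assume "\<not> ?thesis"
    then have "\<exists>n. C < wd (q n) (t \<otimes> q n)" for C by (meson not_le)
    then show False using no found[OF \<open>t \<in> carrier G\<close>] by blast
  qed
  then have growth: "card {g \<in> carrier G. len g \<le> real R} \<le> (2 * R + 1) * B" for R :: nat
    unfolding B_def by (rule linear_growth[OF q])
  obtain I where I: "finite I" "card I = 6 * B + 1" "I \<subseteq> bd"
    using infinite_arbitrarily_large[OF infinite_boundary] by metis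
  have "card I \<le> 6 * B"
  proof (rule separated_rays_growth[OF I(1) _ _ growth])
    show "quasi_ray (rep \<xi>)" if "\<xi> \<in> I" for \<xi> using rep_quasi_ray I(3) that by blast
    show "\<exists>r. \<not> gp_ge (rep \<xi>) (rep \<eta>) r" if "\<xi> \<in> I" "\<eta> \<in> I" "\<xi> \<noteq> \<eta>" for \<xi> \<eta>
      using rep_eqI I(3) that by blast
  qed
  then show False using I(2) by simp
qed

lemma rep_len_unbounded: "\<xi> \<in> bd \<Longrightarrow> \<exists>n. r \<le> len (rep \<xi> n)"
proof -
  assume "\<xi> \<in> bd"
  then have "r \<le> len (rep \<xi> (nat \<lceil>r + 2 + len (rep \<xi> 0)\<rceil>))"
    using quasi_ray_len(2)[OF rep_quasi_ray, of \<xi> "nat \<lceil>r + 2 + len (rep \<xi> 0)\<rceil>"] by linarith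
  then show ?thesis by blast
qed

text \<open>A finite orbit would be a single point. Every group element would then move the ray to
  this point by a bounded amount, against \<open>exists_unbounded_displacement\<close>.\<close>

lemma infinite_orbit:
  assumes \<xi>: "\<xi> \<in> bd" shows "infinite ((\<lambda>g. act g \<xi>) ` carrier G)"
proof
  assume fin: "finite ((\<lambda>g. act g \<xi>) ` carrier G)"
  have fixed: "act g \<xi> = act h \<xi>" if "g \<in> carrier G" "h \<in> carrier G" for g h
  proof (rule finite_invariant_trivial[OF fin])
    show "act g' \<eta> \<in> (\<lambda>g. act g \<xi>) ` carrier G" if "g' \<in> carrier G" "\<eta> \<in> (\<lambda>g. act g \<xi>) ` carrier G" for g' \<eta>
      using that act_mult[OF _ _ \<xi>] by auto
  qed (use \<xi> act_closed that in auto)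
  obtain t where t: "t \<in> carrier G" "\<And>C. \<exists>n. C < wd (rep (act \<one> \<xi>) n) (t \<otimes> rep (act \<one> \<xi>) n)"
    using exists_unbounded_displacement[of "rep (act \<one> \<xi>)"] rep_range rep_len_unbounded act_closed \<xi> one_closed by metis
  have o: "act \<one> \<xi> \<in> bd" using act_closed \<xi> by blast
  have "act t (act \<one> \<xi>) = act \<one> \<xi>" using fixed[of "t \<otimes> \<one>" \<one>] act_mult[OF t(1) one_closed \<xi>] t by simp
  then have "gp_ge (rep (act \<one> \<xi>)) (\<lambda>n. t \<otimes> rep (act \<one> \<xi>) n) r" for r
    using act_rep'[OF t(1) o, of r] by simp
  then obtain B where "\<And>n. wd (rep (act \<one> \<xi>) n) (t \<otimes> rep (act \<one> \<xi>) n) \<le> B"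
    using gp_ge_bounded_dist[OF rep_quasi_ray[OF o] quasi_ray_translate[OF rep_quasi_ray[OF o] t(1)]] by blast
  then show False using t(2)[of B] by (meson not_le)
qed

text \<open>Long symmetric jumps whose initial (hence also final) directions are spread out: the elements
  \<open>f\<^sub>i g\<^sup>\<plusminus>\<^sup>1 f\<^sub>l\<inverse>\<close>, where both \<open>g = v t v\<inverse>\<close> and \<open>g\<inverse>\<close> are close to a boundary point whose
  translates by the \<open>f\<^sub>i\<close> are distinct.\<close>

lemma spread_jumps:
  fixes M :: nat
  assumes "1 \<le> M"
  obtains c :: nat where "\<And>k\<^sub>0. \<exists>k\<ge>k\<^sub>0. \<exists>\<rho> :: 'g pmf. finite (set_pmf \<rho>) \<and> card (set_pmf \<rho>) \<le> 2 * M\<^sup>2 \<and>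
     set_pmf \<rho> \<subseteq> carrier G \<and> (\<forall>w\<in>set_pmf \<rho>. k \<le> word_length G S w \<and> word_length G S w \<le> k + c) \<and>
     map_pmf (\<lambda>w. inv w) \<rho> = \<rho> \<and>
     (\<forall>y\<in>carrier G. measure_pmf.prob \<rho> {w. real c \<le> gp y w} \<le> 1 / real M)"
proof -
  obtain \<xi> where \<xi>: "\<xi> \<in> bd" using third_point by blast
  define v where "v = rep \<xi>"
  have v: "v n \<in> carrier G" for n unfolding v_def using rep_closed \<xi> by blast
  obtain A where A: "finite A" "card A = M" "A \<subseteq> (\<lambda>g. act g \<xi>) ` carrier G"
    using infinite_arbitrarily_large[OF infinite_orbit[OF \<xi>]] by metis
  obtain e where e: "bij_betw e {..<M} A"
    using ex_bij_betw_nat_finite[OF A(1)] A(2) by (auto simp: atLeast0LessThan)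
  have "\<exists>g. g \<in> carrier G \<and> e i = act g \<xi>" if "i < M" for i
  proof -
    have "e i \<in> A" using bij_betwE[OF e] that by simp
    then show ?thesis using A(3) by blast
  qed
  then obtain f' where f': "\<And>i. i < M \<Longrightarrow> f' i \<in> carrier G" "\<And>i. i < M \<Longrightarrow> e i = act (f' i) \<xi>"
    by metis
  define f where "f i = (if i < M then f' i else \<one>)" for i
  have f: "f i \<in> carrier G" for i using f' by (simp add: f_def)
  have ne: "act (f i) \<xi> \<noteq> act (f j) \<xi>" if "i < M" "j < M" "i \<noteq> j" for i j
    using that f' e unfolding f_def bij_betw_def inj_on_def by auto
  have "\<exists>K N. i < M \<longrightarrow> j < M \<longrightarrow> i \<noteq> j \<longrightarrow> (\<forall>n m. N \<le> n \<longrightarrow> N \<le> m \<longrightarrow> gp (f i \<otimes> v n) (f j \<otimes> v m) < K)" for i j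
  proof (cases "i < M \<and> j < M \<and> i \<noteq> j")
    case True
    then have "act (f i) \<xi> \<noteq> act (f j) \<xi>" using ne by blast
    then obtain r where r: "\<not> gp_ge (rep (act (f i) \<xi>)) (rep (act (f j) \<xi>)) r"
      using rep_eqI act_closed f \<xi> by metis
    have "\<not> gp_ge (\<lambda>n. f i \<otimes> v n) (\<lambda>n. f j \<otimes> v n) (r + 2 * \<delta>)"
    proof
      assume g: "gp_ge (\<lambda>n. f i \<otimes> v n) (\<lambda>n. f j \<otimes> v n) (r + 2 * \<delta>)"
      have "gp_ge (rep (act (f i) \<xi>)) (\<lambda>n. f j \<otimes> v n) (min (r + 2 * \<delta>) (r + 2 * \<delta>) - \<delta>)"
        by (rule gp_ge_trans[OF _ g]) (use \<xi> f act_rep' act_closed rep_closed v in \<open>auto simp: v_def\<close>)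
      then have "gp_ge (rep (act (f i) \<xi>)) (rep (act (f j) \<xi>)) (min (r + \<delta>) (r + \<delta>) - \<delta>)"
        by (intro gp_ge_trans[where v = "\<lambda>n. f j \<otimes> v n"])
          (use \<xi> f act_rep act_closed rep_closed v in \<open>auto simp: v_def algebra_simps\<close>)
      then show False using r by simp
    qed
    moreover have "gromov_seq (\<lambda>n. f k \<otimes> v n)" for k
      using quasi_ray_gromov_seq quasi_ray_translate rep_quasi_ray \<xi> f unfolding v_def by blast
    ultimately show ?thesis using not_gp_geD by metis
  qed auto
  then obtain K N where KN: "\<And>i j n m. i < M \<Longrightarrow> j < M \<Longrightarrow> i \<noteq> j \<Longrightarrow> N i j \<le> n \<Longrightarrow> N i j \<le> m \<Longrightarrow>
      gp (f i \<otimes> v n) (f j \<otimes> v m) < K i j" by metis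
  define K0 where "K0 = Max ((\<lambda>(i, j). K i j) ` ({..<M} \<times> {..<M}))"
  have K0: "K i j \<le> K0" if "i < M" "j < M" for i j
    unfolding K0_def using that by (intro Max_ge) auto
  define N0 where "N0 = Max ((\<lambda>(i, j). N i j) ` ({..<M} \<times> {..<M}))"
  have N0: "N i j \<le> N0" if "i < M" "j < M" for i j
    unfolding N0_def using that by (intro Max_ge) auto
  define cF where "cF = Max ((\<lambda>i. word_length G S (f i)) ` {..<M})"
  have cF: "word_length G S (f i) \<le> cF" if "i < M" for i
    unfolding cF_def using that by (intro Max_ge) auto
  \<comment> \<open>The displacement of \<open>inv (v n)\<close> by \<open>t\<close> is the length
    of the conjugate of \<open>t\<close> by \<open>v n\<close>, so this makes the conjugates
    arbitrarily long.\<close>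
  obtain t where t: "t \<in> carrier G" "\<And>C. \<exists>n. C < wd (inv (v n)) (t \<otimes> inv (v n))"
    using exists_unbounded_displacement[of "\<lambda>n. inv (v n)"] v rep_len_unbounded[OF \<xi>]
    unfolding v_def by (auto simp: image_subset_iff)
  \<comment> \<open>The first summand exceeds the products between distinct directions plus the
    losses of the hyperbolic inequality. The outer factors change the length of \<open>g\<close> by
    at most \<open>2 * cF\<close> either way, whence \<open>4 * cF\<close>.\<close>
  define c where "c = nat \<lceil>K0 + 3 * \<delta> + 1\<rceil> + 4 * cF"
  have c: "K0 + 3 * \<delta> < real c" "4 * cF \<le> c" unfolding c_def by linarith+
  have "\<exists>k\<ge>k0. \<exists>\<rho> :: 'g pmf. finite (set_pmf \<rho>) \<and> card (set_pmf \<rho>) \<le> 2 * M\<^sup>2 \<and>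
     set_pmf \<rho> \<subseteq> carrier G \<and> (\<forall>w\<in>set_pmf \<rho>. k \<le> word_length G S w \<and> word_length G S w \<le> k + c) \<and>
     map_pmf (\<lambda>w. inv w) \<rho> = \<rho> \<and>
     (\<forall>y\<in>carrier G. measure_pmf.prob \<rho> {w. real c \<le> gp y w} \<le> 1 / real M)" for k0
  proof -
    \<comment> \<open>The first part of the bound makes the jumps at least as long as
      \<open>k0\<close>, the second gives each of them product at least \<open>c\<close> with its
      direction, the third forces \<open>N0 < n\<close>.\<close>
    obtain n where n: "real k0 + 2 * real cF + (len t + 4 * cF + 2 * c) + (2 * (N0 + 2 + len (v 0)) + len t) < wd (inv (v n)) (t \<otimes> inv (v n))"
      using t(2) by blast
    define g where "g = v n \<otimes> (t \<otimes> inv (v n))"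
    have g: "g \<in> carrier G" using v t by (simp add: g_def)
    have gl: "len g = wd (inv (v n)) (t \<otimes> inv (v n))" using v by (simp add: g_def word_dist_def)
    have "len g \<le> 2 * len (v n) + len t"
      using len_mult[of "v n" "t \<otimes> inv (v n)"] len_mult[of t "inv (v n)"] v t by (simp add: g_def)
    then have "real N0 < real n"
      using n gl quasi_ray_len(1)[OF rep_quasi_ray[OF \<xi>], of n] unfolding v_def by simp
    then have nN: "N0 \<le> n" by simp
    \<comment> \<open>Conjugation by \<open>v n\<close> makes an element start along
      \<open>v n\<close>. The bound is the same for \<open>t\<close> and \<open>inv t\<close>, hence
      for \<open>g\<close> and \<open>inv g\<close>.\<close>
    have gv: "(len (v n \<otimes> (s \<otimes> inv (v n))) - len s) / 2 \<le> gp (v n \<otimes> (s \<otimes> inv (v n))) (v n)" if s: "s \<in> carrier G" for s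
    proof -
      have "wd (v n \<otimes> (s \<otimes> inv (v n))) (v n) = len (s \<otimes> inv (v n))"
        using wd_commute[of "v n \<otimes> (s \<otimes> inv (v n))" "v n"] v s by simp
      also have "\<dots> \<le> len s + len (v n)" using len_mult[of s "inv (v n)"] v s by simp
      finally show ?thesis using v s by (simp add: gp_def)
    qed
    have gi: "inv g = v n \<otimes> (inv t \<otimes> inv (v n))"
      using v t by (simp add: g_def inv_mult_group m_assoc)
    define \<phi> where "\<phi> = (\<lambda>(s, i, l). f i \<otimes> ((if s then g else inv g) \<otimes> inv (f l)))"
    define I where "I = (UNIV :: bool set) \<times> {..<M} \<times> {..<M}"
    have I: "finite I" "I \<noteq> {}" "card I = 2 * M\<^sup>2"
      using assms unfolding I_def by (auto simp: card_cartesian_product power2_eq_square lessThan_empty_iff)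
    \<comment> \<open>The image of the uniform law and not the uniform law on the image:
      \<open>\<phi>\<close> may fail to be injective.\<close>
    define \<rho> where "\<rho> = map_pmf \<phi> (pmf_of_set I)"
    have set: "set_pmf \<rho> = \<phi> ` I" using I by (simp add: \<rho>_def)
    define k where "k = word_length G S g - 2 * cF"
    have kg: "real k = len g - 2 * cF" "k0 \<le> k" using n gl unfolding k_def by (auto simp: of_nat_diff)
    have len\<phi>: "k \<le> word_length G S w \<and> word_length G S w \<le> k + c" if "w \<in> \<phi> ` I" for w
    proof -
      obtain s i l where w: "w = f i \<otimes> ((if s then g else inv g) \<otimes> inv (f l))" "i < M" "l < M"
        using \<open>w \<in> \<phi> ` I\<close> unfolding \<phi>_def I_def by auto
      define h where "h = (if s then g else inv g)"
      have h: "h \<in> carrier G" "len h = len g" using g by (auto simp: h_def)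
      have w': "w = f i \<otimes> (h \<otimes> inv (f l))" using w(1) by (simp add: h_def)
      have wc: "w \<in> carrier G" using w' f h by simp
      have "len w \<le> len (f i) + (len h + len (f l))"
        using len_mult[of "f i" "h \<otimes> inv (f l)"] len_mult[of h "inv (f l)"] f h w' by simp
      moreover have "h = inv (f i) \<otimes> (w \<otimes> f l)"
        using w' f h by (simp add: m_assoc) (simp add: m_assoc[symmetric])
      then have "len h \<le> len (f i) + (len w + len (f l))"
        using len_mult[of "inv (f i)" "w \<otimes> f l"] len_mult[of w "f l"] f wc by simp
      ultimately show ?thesis using kg(1) h(2) cF[OF w(2)] cF[OF w(3)] c(2) by linarith
    qed
    have near: "real c \<le> gp (\<phi> (s, i, l)) (f i \<otimes> v n)" if "i < M" "l < M" for s i l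
    proof -
      define h where "h = (if s then g else inv g)"
      have h: "h \<in> carrier G" using g by (auto simp: h_def)
      have "(len g - len t) / 2 \<le> gp h (v n)"
        using gv[OF t(1)] gv[of "inv t"] t(1) g unfolding h_def gi[symmetric] g_def[symmetric] by simp
      moreover have "gp h (v n) - len (f i) \<le> gp (f i \<otimes> h) (f i \<otimes> v n)"
        using gp_translate_ge f h v by blast
      moreover have "gp (f i \<otimes> v n) (f i \<otimes> h) - wd (f i \<otimes> (h \<otimes> inv (f l))) (f i \<otimes> h) \<le> gp (f i \<otimes> v n) (f i \<otimes> (h \<otimes> inv (f l)))"
        by (intro gp_change_right) (simp_all add: f h v)
      moreover have "wd (f i \<otimes> (h \<otimes> inv (f l))) (f i \<otimes> h) = len (f l)"
        using wd_commute[of "h \<otimes> inv (f l)" h] f h by simp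
      moreover have "gp (f i \<otimes> v n) (f i \<otimes> h) = gp (f i \<otimes> h) (f i \<otimes> v n)"
        "gp (f i \<otimes> v n) (f i \<otimes> (h \<otimes> inv (f l))) = gp (f i \<otimes> (h \<otimes> inv (f l))) (f i \<otimes> v n)"
        by (intro gp_commute; simp add: f h v)+
      ultimately have "(len g - len t) / 2 - real cF - real cF \<le> gp (f i \<otimes> (h \<otimes> inv (f l))) (f i \<otimes> v n)"
        using cF[OF that(1)] cF[OF that(2)] by linarith
      moreover have "2 * real c + 4 * real cF + len t \<le> len g" using n gl by simp
      then have "real c \<le> (len g - len t) / 2 - real cF - real cF" by (simp add: field_simps)
      ultimately have "real c \<le> gp (f i \<otimes> (h \<otimes> inv (f l))) (f i \<otimes> v n)" by (rule order_trans[rotated])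
      then show ?thesis unfolding \<phi>_def h_def by (cases s) simp_all
    qed
    have "measure_pmf.prob \<rho> {w. real c \<le> gp y w} \<le> 1 / real M" if y: "y \<in> carrier G" for y
    proof -
      define J where "J = {x \<in> I. real c \<le> gp y (\<phi> x)}"
      have \<phi>c: "\<phi> (s, i, l) \<in> carrier G" for s i l unfolding \<phi>_def using f g by simp
      \<comment> \<open>No \<open>y\<close> is aligned with two directions, so at most
        \<open>2 * M\<close> of the \<open>2 * M\<^sup>2\<close> indices are bad. This gives
        \<open>1 / M\<close>.\<close>
      have one: "i = j" if "(s, i, l) \<in> J" "(s', j, l') \<in> J" for s i l s' j l'
      proof (rule ccontr)
        assume ij: "i \<noteq> j"
        have lt: "i < M" "l < M" "j < M" "l' < M" and big: "real c \<le> gp y (\<phi> (s, i, l))" "real c \<le> gp y (\<phi> (s', j, l'))"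
          using that unfolding J_def I_def by auto
        have fv: "f i \<otimes> v n \<in> carrier G" "f j \<otimes> v n \<in> carrier G" using f v by auto
        have 1: "real c \<le> gp (f i \<otimes> v n) (\<phi> (s, i, l))" using near[OF lt(1,2)] gp_commute[OF \<phi>c fv(1)] by simp
        have 2: "real c \<le> gp (\<phi> (s, i, l)) y" using big(1) gp_commute[OF \<phi>c y] by simp
        have 3: "min (real c) (real c) - \<delta> \<le> gp (f i \<otimes> v n) y" by (rule gp_hyperbolicD[OF 1 2]) (use fv \<phi>c y in auto)
        have 4: "min (real c) (real c) - \<delta> \<le> gp y (f j \<otimes> v n)"
          by (rule gp_hyperbolicD[OF big(2) near[OF lt(3,4)]]) (use fv \<phi>c y in auto)
        have "min (min (real c) (real c) - \<delta>) (min (real c) (real c) - \<delta>) - \<delta> \<le> gp (f i \<otimes> v n) (f j \<otimes> v n)"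
          by (rule gp_hyperbolicD[OF 3 4]) (use fv y in auto)
        moreover have "gp (f i \<otimes> v n) (f j \<otimes> v n) < K i j"
          by (rule KN[OF lt(1,3) ij]) (use nN N0[OF lt(1,3)] in simp_all)
        ultimately show False using K0[OF lt(1,3)] c(1) delta_nonneg by simp
      qed
      have "\<exists>i. J \<subseteq> UNIV \<times> {i} \<times> {..<M}"
      proof (cases "J = {}")
        case False
        then obtain s i l where "(s, i, l) \<in> J" by (metis ex_in_conv prod_cases3)
        then have "J \<subseteq> UNIV \<times> {i} \<times> {..<M}" using one unfolding J_def I_def by auto
        then show ?thesis ..
      qed simp
      then obtain i where "J \<subseteq> UNIV \<times> {i} \<times> {..<M}" ..
      then have "card J \<le> card ((UNIV :: bool set) \<times> {i} \<times> {..<M})" by (intro card_mono) auto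
      then have Jc: "card J \<le> 2 * M" by (simp add: card_cartesian_product)
      have "measure_pmf.prob \<rho> {w. real c \<le> gp y w} = real (card (I \<inter> \<phi> -` {w. real c \<le> gp y w})) / real (card I)"
        unfolding \<rho>_def by (simp add: measure_pmf_of_set I)
      also have "I \<inter> \<phi> -` {w. real c \<le> gp y w} = J" by (auto simp: J_def)
      also have "real (card J) / real (card I) \<le> (2 * real M) / (2 * (real M)\<^sup>2)"
        using Jc I(3) assms by (intro divide_mono) auto
      also have "\<dots> = 1 / real M" using assms by (simp add: power2_eq_square)
      finally show ?thesis .
    qed
    moreover have "map_pmf (\<lambda>w. inv w) \<rho> = \<rho>"
    proof -
      \<comment> \<open>Inversion exchanges \<open>g\<close> with \<open>inv g\<close> and swaps the
        outer factors.\<close>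
      define sw where "sw = (\<lambda>(s :: bool, i :: nat, l :: nat). (\<not> s, l, i))"
      have "bij_betw sw I I"
        by (rule bij_betw_byWitness[of _ sw]) (auto simp: sw_def I_def)
      then have "map_pmf sw (pmf_of_set I) = pmf_of_set I"
        using I by (intro map_pmf_of_set_bij_betw) auto
      moreover have "inv (\<phi> x) = \<phi> (sw x)" for x
        using f g by (cases x) (auto simp: \<phi>_def sw_def inv_mult_group m_assoc)
      then have "map_pmf (\<lambda>w. inv w) \<rho> = map_pmf \<phi> (map_pmf sw (pmf_of_set I))"
        unfolding \<rho>_def by (simp add: pmf.map_comp comp_def)
      ultimately show ?thesis unfolding \<rho>_def by simp
    qed
    moreover have "set_pmf \<rho> \<subseteq> carrier G" unfolding set \<phi>_def using f g by auto
    moreover have "card (set_pmf \<rho>) \<le> 2 * M\<^sup>2" unfolding set using card_image_le[OF I(1)] I(3) by metis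
    ultimately show ?thesis
      using kg(2) len\<phi> set I(1) by (intro exI[of _ k] conjI exI[of _ \<rho>]) auto
  qed
  then show thesis by (rule that)
qed

end

section \<open>Hausdorff measure\<close>

definition hausdorff_covers ::
    "'q set \<Rightarrow> ('q \<Rightarrow> 'q \<Rightarrow> real) \<Rightarrow> 'q set \<Rightarrow> real \<Rightarrow> (nat \<Rightarrow> 'q set) set" where
  "hausdorff_covers M d Z \<epsilon> =
     {U. (\<forall>n. openin (Metric_space.mtopology M d) (U n) \<and> ediam d (U n) \<le> ennreal \<epsilon>) \<and> Z \<subseteq> (\<Union>n. U n)}"

definition hausdorff_content ::
    "'q set \<Rightarrow> ('q \<Rightarrow> 'q \<Rightarrow> real) \<Rightarrow> 'q set \<Rightarrow> real \<Rightarrow> real \<Rightarrow> ennreal" where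
  "hausdorff_content M d Z \<alpha> \<epsilon> = (INF U\<in>hausdorff_covers M d Z \<epsilon>. \<Sum>n. diam_pow d \<alpha> (U n))"

lemma hausdorff_content_antimono:
  assumes "\<epsilon> \<le> \<epsilon>'" shows "hausdorff_content M d Z \<alpha> \<epsilon>' \<le> hausdorff_content M d Z \<alpha> \<epsilon>"
proof -
  have "hausdorff_covers M d Z \<epsilon> \<subseteq> hausdorff_covers M d Z \<epsilon>'"
    using ennreal_leI[OF assms] unfolding hausdorff_covers_def by (blast intro: order_trans)
  then show ?thesis unfolding hausdorff_content_def by (intro INF_superset_mono) auto
qed

text \<open>\<open>Lim\<close> is informative only once the limit exists. It does, because the
  infimum increases as \<open>\<epsilon>\<close> decreases.\<close>

lemma hausdorff_measure_eq_SUP: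
  "hausdorff_measure M d Z \<alpha> = (SUP \<epsilon>\<in>{0<..}. hausdorff_content M d Z \<alpha> \<epsilon>)"
proof -
  let ?F = "hausdorff_content M d Z \<alpha>"
  have "hausdorff_measure M d Z \<alpha> = Lim (at_right 0) ?F"
    unfolding hausdorff_measure_def hausdorff_content_def hausdorff_covers_def
    by (intro arg_cong2[where f = Lim] refl ext arg_cong[where f = Inf]) blast
  moreover have "(?F \<longlongrightarrow> (SUP \<epsilon>\<in>{0<..}. ?F \<epsilon>)) (at_right 0)"
  proof (rule order_tendstoI)
    fix a assume "a < (SUP \<epsilon>\<in>{0<..}. ?F \<epsilon>)"
    then obtain e where e: "e > 0" "a < ?F e" unfolding less_SUP_iff by auto
    have "eventually (\<lambda>x. x \<in> {0<..<e}) (at_right 0)" using e(1) by (rule eventually_at_right_real)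
    then show "eventually (\<lambda>x. a < ?F x) (at_right 0)"
    proof eventually_elim
      case (elim x)
      then have "?F e \<le> ?F x" by (intro hausdorff_content_antimono) simp
      then show ?case using e(2) by simp
    qed
  next
    fix a assume a: "(SUP \<epsilon>\<in>{0<..}. ?F \<epsilon>) < a"
    have "eventually (\<lambda>x::real. x \<in> {0<..<1}) (at_right 0)" by (rule eventually_at_right_real) simp
    then show "eventually (\<lambda>x. ?F x < a) (at_right 0)"
    proof eventually_elim
      case (elim x)
      then have "?F x \<le> (SUP \<epsilon>\<in>{0<..}. ?F \<epsilon>)" by (intro SUP_upper) simp
      then show ?case using a by simp
    qed
  qed
  ultimately show ?thesis using tendsto_Lim trivial_limit_at_right_real by metis
qed

lemma hausdorff_content_le:
  "0 < \<epsilon> \<Longrightarrow> hausdorff_content M d Z \<alpha> \<epsilon> \<le> hausdorff_measure M d Z \<alpha>"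
  unfolding hausdorff_measure_eq_SUP by (intro SUP_upper) simp

lemma hausdorff_measure_leI:
  "(\<And>\<epsilon>. 0 < \<epsilon> \<Longrightarrow> hausdorff_content M d Z \<alpha> \<epsilon> \<le> c) \<Longrightarrow> hausdorff_measure M d Z \<alpha> \<le> c"
  unfolding hausdorff_measure_eq_SUP by (intro SUP_least) simp

lemma hausdorff_measure_mono:
  assumes "Z \<subseteq> Z'" shows "hausdorff_measure M d Z \<alpha> \<le> hausdorff_measure M d Z' \<alpha>"
  unfolding hausdorff_measure_eq_SUP hausdorff_content_def hausdorff_covers_def
  using assms by (intro SUP_mono bexI INF_superset_mono) auto

lemma ediam_le: "(\<And>x y. x \<in> U \<Longrightarrow> y \<in> U \<Longrightarrow> d x y \<le> r) \<Longrightarrow> ediam d U \<le> ennreal r"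
  unfolding ediam_def by (intro SUP_least ennreal_leI) auto

lemma ediam_ge: "x \<in> U \<Longrightarrow> y \<in> U \<Longrightarrow> ennreal (d x y) \<le> ediam d U"
  unfolding ediam_def by (blast intro: SUP_upper2)

lemma diam_pow_le:
  assumes "\<And>x y. x \<in> U \<Longrightarrow> y \<in> U \<Longrightarrow> d x y \<le> r" "0 \<le> r" "0 < \<alpha>"
  shows "diam_pow d \<alpha> U \<le> ennreal (r powr \<alpha>)"
proof -
  have "enn2real (ediam d U) \<le> r" using ediam_le[of U d r] assms by (intro enn2real_leI) auto
  then show ?thesis
    using assms(2,3) unfolding diam_pow_def by (auto intro!: ennreal_leI powr_mono2)
qed

text \<open>For a negative exponent every cover by small sets of positive diameter is expensive, while sets of
  diameter zero cost nothing because \<open>0 powr \<alpha> = 0\<close>. For exponent zero covers are counted.\<close>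

lemma hausdorff_exponent_pos:
  assumes M: "Metric_space M d" and inf: "infinite M"
    and pos: "hausdorff_measure M d M \<alpha> \<noteq> 0" and fin: "hausdorff_measure M d M \<alpha> \<noteq> \<infinity>"
  shows "0 < \<alpha>"
proof (rule ccontr)
  interpret Metric_space M d by fact
  assume "\<not> 0 < \<alpha>"
  then consider "\<alpha> = 0" | "\<alpha> < 0" by linarith
  then show False
  proof cases
    case 1
    obtain n :: nat where n: "hausdorff_measure M d M \<alpha> < of_nat n"
      using fin by (metis ennreal_Ex_less_of_nat infinity_ennreal_def top.not_eq_extremum)
    obtain A where A: "finite A" "card A = n" "A \<subseteq> M" using infinite_arbitrarily_large[OF inf] by metis
    \<comment> \<open>Half the least distance in \<open>A\<close>, so that a set of diameter at most
      \<open>e\<close> contains at most one point of \<open>A\<close>.\<close>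
    define e where "e = Min (insert 1 ((\<lambda>(x, y). d x y) ` ({(x, y). x \<in> A \<and> y \<in> A \<and> x \<noteq> y}))) / 2"
    have finA: "finite {(x, y). x \<in> A \<and> y \<in> A \<and> x \<noteq> y}"
      by (rule finite_subset[of _ "A \<times> A"]) (use A(1) in auto)
    have e0: "e > 0"
      unfolding e_def using finA A(3) by (auto simp: Min_gr_iff intro!: mdist_pos_less)
    have eA: "e < d x y" if "x \<in> A" "y \<in> A" "x \<noteq> y" for x y
    proof -
      have "2 * e \<le> d x y" unfolding e_def using finA that by (simp, intro Min_le) auto
      then show ?thesis using e0 by simp
    qed
    have "hausdorff_content M d M \<alpha> e < of_nat n"
      using hausdorff_content_le[OF e0] n by (rule order.strict_trans1)
    then obtain U where U: "U \<in> hausdorff_covers M d M e" "(\<Sum>n. diam_pow d \<alpha> (U n)) < of_nat n"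
      unfolding hausdorff_content_def INF_less_iff by blast
    have "\<forall>x\<in>A. \<exists>k. x \<in> U k" using U(1) A(3) unfolding hausdorff_covers_def by blast
    then obtain k where k: "\<And>x. x \<in> A \<Longrightarrow> x \<in> U (k x)" by metis
    have "inj_on k A"
    proof (rule inj_onI, rule ccontr)
      fix x y assume xy: "x \<in> A" "y \<in> A" "k x = k y" "x \<noteq> y"
      have "ennreal (d x y) \<le> ediam d (U (k x))" using k[OF xy(1)] k[OF xy(2)] xy(3) by (intro ediam_ge) simp_all
      also have "\<dots> \<le> ennreal e" using U(1) unfolding hausdorff_covers_def by blast
      finally show False using eA[OF xy(1,2,4)] e0 by (simp add: ennreal_le_iff)
    qed
    then have "of_nat n = (\<Sum>i\<in>k ` A. 1 :: ennreal)" using A(2) by (simp add: card_image)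
    also have "\<dots> \<le> (\<Sum>i\<in>k ` A. diam_pow d \<alpha> (U i))"
      using k 1 by (intro sum_mono) (auto simp: diam_pow_def)
    also have "\<dots> \<le> (\<Sum>i. diam_pow d \<alpha> (U i))" using A(1) by (intro sum_le_suminf) auto
    finally show False using U(2) by simp
  next
    case 2
    obtain c where c: "0 \<le> c" "hausdorff_measure M d M \<alpha> = ennreal c"
      using fin by (cases "hausdorff_measure M d M \<alpha>") auto
    \<comment> \<open>Every set of positive diameter at most this value costs at least
      \<open>c + 1\<close>.\<close>
    define \<epsilon>\<^sub>0 where "\<epsilon>\<^sub>0 = (c + 1) powr (1 / \<alpha>)"
    have e0: "\<epsilon>\<^sub>0 > 0" unfolding \<epsilon>\<^sub>0_def using c(1) by simp
    have e0p: "\<epsilon>\<^sub>0 powr \<alpha> = c + 1" unfolding \<epsilon>\<^sub>0_def using 2 c(1) by (simp add: powr_powr)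
    have "hausdorff_measure M d M \<alpha> \<le> 0"
    proof (rule hausdorff_measure_leI)
      fix \<epsilon> :: real assume \<epsilon>: "0 < \<epsilon>"
      define e where "e = min \<epsilon> \<epsilon>\<^sub>0"
      have e: "0 < e" "e \<le> \<epsilon>" "e \<le> \<epsilon>\<^sub>0" using \<epsilon> e0 by (auto simp: e_def)
      have "hausdorff_content M d M \<alpha> e < ennreal (c + 1)"
        using hausdorff_content_le[OF e(1), of M d M \<alpha>] c by (simp add: order.strict_trans1 ennreal_less_iff)
      then obtain U where U: "U \<in> hausdorff_covers M d M e" "(\<Sum>n. diam_pow d \<alpha> (U n)) < ennreal (c + 1)"
        unfolding hausdorff_content_def INF_less_iff by blast
      have "diam_pow d \<alpha> (U n) = 0" for n
      proof (rule ccontr)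
        assume ne: "diam_pow d \<alpha> (U n) \<noteq> 0"
        have dle: "ediam d (U n) \<le> ennreal e" using U(1) unfolding hausdorff_covers_def by blast
        define t where "t = enn2real (ediam d (U n))"
        have "diam_pow d \<alpha> (U n) = ennreal (t powr \<alpha>)"
          using ne 2 unfolding diam_pow_def t_def by (auto split: if_splits)
        moreover have "t \<noteq> 0" using ne 2 unfolding diam_pow_def t_def by (auto split: if_splits)
        then have "0 < t" unfolding t_def using enn2real_nonneg by (metis order_le_less)
        moreover have "t \<le> \<epsilon>\<^sub>0" unfolding t_def using enn2real_leI[OF _ dle] e by linarith
        ultimately have "ennreal (c + 1) \<le> diam_pow d \<alpha> (U n)"
          using powr_mono2'[of \<alpha> t \<epsilon>\<^sub>0] 2 e0p by (auto intro!: ennreal_leI)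
        also have "\<dots> \<le> (\<Sum>n. diam_pow d \<alpha> (U n))"
          using sum_le_suminf[of "\<lambda>n. diam_pow d \<alpha> (U n)" "{n}"] by simp
        finally show False using U(2) by simp
      qed
      then have "(\<Sum>n. diam_pow d \<alpha> (U n)) = 0" by simp
      then have "hausdorff_content M d M \<alpha> e \<le> 0"
        using U(1) unfolding hausdorff_content_def by (metis INF_lower)
      then show "hausdorff_content M d M \<alpha> \<epsilon> \<le> 0"
        using hausdorff_content_antimono[OF e(2)] order_trans by blast
    qed
    then show False using pos by simp
  qed
qed

text \<open>If the sum of the \<open>r i powr \<alpha>\<close> is at most
  \<open>\<epsilon> powr \<alpha>\<close>, then every \<open>r i\<close> is at most
  \<open>\<epsilon>\<close>; a cheap cover is automatically fine.\<close>

lemma hausdorff_measure_null: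
  assumes M: "Metric_space M d" and \<alpha>: "0 < \<alpha>"
    and cover: "\<And>\<epsilon>. 0 < \<epsilon> \<Longrightarrow> \<exists>(I :: 'i set) V r. finite I \<and> Z \<subseteq> (\<Union>i\<in>I. V i) \<and> (\<Sum>i\<in>I. r i powr \<alpha>) \<le> \<epsilon> \<and>
       (\<forall>i\<in>I. openin (Metric_space.mtopology M d) (V i) \<and> 0 \<le> r i \<and> (\<forall>x\<in>V i. \<forall>y\<in>V i. d x y \<le> r i))"
  shows "hausdorff_measure M d Z \<alpha> = 0"
proof -
  have small: "hausdorff_content M d Z \<alpha> \<epsilon> \<le> ennreal \<eta>" if "0 < \<epsilon>" "0 < \<eta>" for \<epsilon> \<eta>
  proof -
    define \<theta> where "\<theta> = min \<eta> (\<epsilon> powr \<alpha>)"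
    have \<theta>: "0 < \<theta>" "\<theta> \<le> \<eta>" "\<theta> \<le> \<epsilon> powr \<alpha>" using that by (auto simp: \<theta>_def)
    obtain I :: "'i set" and V r where I: "finite I" "Z \<subseteq> (\<Union>i\<in>I. V i)" "(\<Sum>i\<in>I. r i powr \<alpha>) \<le> \<theta>"
      and V: "\<And>i. i \<in> I \<Longrightarrow> openin (Metric_space.mtopology M d) (V i)" "\<And>i. i \<in> I \<Longrightarrow> 0 \<le> r i"
        "\<And>i x y. i \<in> I \<Longrightarrow> x \<in> V i \<Longrightarrow> y \<in> V i \<Longrightarrow> d x y \<le> r i"
      using cover[OF \<theta>(1)] by metis
    obtain h where h: "bij_betw h {..<card I} I"
      using ex_bij_betw_nat_finite[OF I(1)] by (auto simp: atLeast0LessThan)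
    have hI: "h n \<in> I" if "n < card I" for n using bij_betwE[OF h] that by simp
    define U where "U n = (if n < card I then V (h n) else {})" for n
    have re: "r i \<le> \<epsilon>" if "i \<in> I" for i
    proof (rule ccontr)
      assume "\<not> r i \<le> \<epsilon>"
      then have "\<epsilon> powr \<alpha> < r i powr \<alpha>" using \<open>0 < \<epsilon>\<close> \<alpha> by (intro powr_less_mono2) auto
      also have "\<dots> \<le> (\<Sum>i\<in>I. r i powr \<alpha>)" using I(1) that by (intro member_le_sum) auto
      finally show False using I(3) \<theta>(3) by linarith
    qed
    have "U \<in> hausdorff_covers M d Z \<epsilon>"
      unfolding hausdorff_covers_def
    proof (intro CollectI conjI allI)
      fix n show "openin (Metric_space.mtopology M d) (U n)" using V(1) hI by (simp add: U_def)
      show "ediam d (U n) \<le> ennreal \<epsilon>"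
      proof (cases "n < card I")
        case True
        then show ?thesis using V(3)[OF hI[OF True]] re[OF hI[OF True]]
          by (intro ediam_le) (force simp: U_def)
      qed (simp add: U_def ediam_def)
    next
      show "Z \<subseteq> (\<Union>n. U n)"
      proof
        fix z assume "z \<in> Z"
        then obtain i where "i \<in> I" "z \<in> V i" using I(2) by blast
        moreover obtain n where "n < card I" "h n = i"
          using h \<open>i \<in> I\<close> unfolding bij_betw_def by force
        ultimately have "z \<in> U n" by (simp add: U_def)
        then show "z \<in> (\<Union>n. U n)" by blast
      qed
    qed
    then have "hausdorff_content M d Z \<alpha> \<epsilon> \<le> (\<Sum>n. diam_pow d \<alpha> (U n))"
      unfolding hausdorff_content_def by (rule INF_lower)
    also have "\<dots> = (\<Sum>n<card I. diam_pow d \<alpha> (U n))"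
      by (rule suminf_finite) (auto simp: U_def diam_pow_def)
    also have "\<dots> \<le> (\<Sum>n<card I. ennreal (r (h n) powr \<alpha>))"
    proof (rule sum_mono)
      fix n assume n: "n \<in> {..<card I}"
      then show "diam_pow d \<alpha> (U n) \<le> ennreal (r (h n) powr \<alpha>)"
        using V(2,3) hI[of n] \<alpha> by (intro diam_pow_le) (auto simp: U_def)
    qed
    also have "\<dots> = (\<Sum>i\<in>I. ennreal (r i powr \<alpha>))" by (rule sum.reindex_bij_betw[OF h])
    also have "\<dots> = ennreal (\<Sum>i\<in>I. r i powr \<alpha>)" by (rule sum_ennreal) simp
    also have "\<dots> \<le> ennreal \<eta>" using I(3) \<theta>(2) by (intro ennreal_leI) simp
    finally show ?thesis .
  qed
  have "hausdorff_measure M d Z \<alpha> \<le> 0"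
  proof (rule hausdorff_measure_leI)
    fix \<epsilon> :: real assume \<epsilon>: "0 < \<epsilon>"
    show "hausdorff_content M d Z \<alpha> \<epsilon> \<le> 0"
    proof (rule ennreal_le_epsilon)
      fix e :: real assume "0 < e"
      then show "hausdorff_content M d Z \<alpha> \<epsilon> \<le> 0 + ennreal e" using small[OF \<epsilon>] by simp
    qed
  qed
  then show ?thesis by simp
qed

lemma hausdorff_measure_singleton:
  assumes M: "Metric_space M d" and \<alpha>: "0 < \<alpha>" and x: "x \<in> M"
  shows "hausdorff_measure M d {x} \<alpha> = 0"
proof (rule hausdorff_measure_null[OF M \<alpha>, where 'i = unit])
  interpret Metric_space M d by fact
  fix \<epsilon> :: real assume \<epsilon>: "0 < \<epsilon>"
  define r where "r = \<epsilon> powr (1 / \<alpha>) / 2"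
  have r: "0 < r" "(2 * r) powr \<alpha> = \<epsilon>" using \<epsilon> \<alpha> by (auto simp: r_def powr_powr)
  have "d y z \<le> 2 * r" if "y \<in> mball x r" "z \<in> mball x r" for y z
    using that triangle[of y x z] commute[of x y] by auto
  then show "\<exists>(I :: unit set) V r. finite I \<and> {x} \<subseteq> (\<Union>i\<in>I. V i) \<and> (\<Sum>i\<in>I. r i powr \<alpha>) \<le> \<epsilon> \<and>
       (\<forall>i\<in>I. openin mtopology (V i) \<and> 0 \<le> r i \<and> (\<forall>y\<in>V i. \<forall>z\<in>V i. d y z \<le> r i))"
    using r x by (intro exI[of _ "{()}"] exI[of _ "\<lambda>_. mball x r"] exI[of _ "\<lambda>_. 2 * r"]) auto
qed

text \<open>Covers of the image pull back to covers of \<open>E\<close> with diameters enlarged by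
  at most the factor \<open>K\<close>; the Lipschitz bound makes the preimages open.\<close>

lemma hausdorff_measure_expanding:
  assumes M: "Metric_space M d" and \<alpha>: "0 < \<alpha>" and K: "0 < K"
    and \<phi>: "\<phi> ` M \<subseteq> M" "\<And>x y. x \<in> M \<Longrightarrow> y \<in> M \<Longrightarrow> d x y \<le> K * d (\<phi> x) (\<phi> y)"
    and lip: "0 < L" "\<And>x y. x \<in> M \<Longrightarrow> y \<in> M \<Longrightarrow> d (\<phi> x) (\<phi> y) \<le> L * d x y"
    and E: "E \<subseteq> M"
  shows "hausdorff_measure M d E \<alpha> \<le> ennreal (K powr \<alpha>) * hausdorff_measure M d (\<phi> ` E) \<alpha>"
proof (rule hausdorff_measure_leI)
  interpret Metric_space M d by fact
  fix \<epsilon> :: real assume \<epsilon>: "0 < \<epsilon>"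
  have step: "hausdorff_content M d E \<alpha> \<epsilon> \<le> ennreal (K powr \<alpha>) * (\<Sum>n. diam_pow d \<alpha> (U n))"
    if U: "U \<in> hausdorff_covers M d (\<phi> ` E) (\<epsilon> / K)" for U
  proof -
    define V where "V n = M \<inter> \<phi> -` U n" for n
    have Uo: "openin mtopology (U n)" and Ud: "ediam d (U n) \<le> ennreal (\<epsilon> / K)" for n
      using U unfolding hausdorff_covers_def by auto
    have dU: "ediam d (U n) = ennreal (enn2real (ediam d (U n)))" for n
      using Ud[of n] by (metis ennreal_enn2real ennreal_less_top order.strict_trans1 infinity_ennreal_def)
    have dV: "d x y \<le> K * enn2real (ediam d (U n))" if "x \<in> V n" "y \<in> V n" for x y n
    proof -
      have "ennreal (d (\<phi> x) (\<phi> y)) \<le> ediam d (U n)" using that by (intro ediam_ge) (auto simp: V_def)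
      then have "d (\<phi> x) (\<phi> y) \<le> enn2real (ediam d (U n))"
        using dU[of n] by (metis enn2real_nonneg ennreal_le_iff)
      then have "K * d (\<phi> x) (\<phi> y) \<le> K * enn2real (ediam d (U n))" using K by simp
      then show ?thesis using \<phi>(2)[of x y] that by (auto simp: V_def)
    qed
    have "V \<in> hausdorff_covers M d E \<epsilon>"
      unfolding hausdorff_covers_def
    proof (intro CollectI conjI allI)
      fix n
      show "openin mtopology (V n)"
        unfolding openin_mtopology
      proof (intro conjI allI impI)
        fix x assume x: "x \<in> V n"
        then obtain r where r: "r > 0" "mball (\<phi> x) r \<subseteq> U n" using Uo[of n] unfolding openin_mtopology V_def by auto
        have "mball x (r / L) \<subseteq> V n"
        proof
          fix y assume y: "y \<in> mball x (r / L)"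
          then have "L * d x y < r" using lip(1) by (simp add: field_simps)
          then have "d (\<phi> x) (\<phi> y) < r" using lip(2)[of x y] y by auto
          then have "\<phi> y \<in> mball (\<phi> x) r" using \<phi>(1) y by auto
          then show "y \<in> V n" using r(2) y by (auto simp: V_def)
        qed
        then show "\<exists>r>0. mball x r \<subseteq> V n" using r(1) lip(1) by (intro exI[of _ "r / L"]) auto
      qed (auto simp: V_def)
      have "K * enn2real (ediam d (U n)) \<le> \<epsilon>"
      proof -
        have "enn2real (ediam d (U n)) \<le> \<epsilon> / K" using \<epsilon> K Ud[of n] by (intro enn2real_leI) auto
        then show ?thesis using K by (simp add: field_simps)
      qed
      then show "ediam d (V n) \<le> ennreal \<epsilon>" using dV by (intro ediam_le) force
    next
      have "\<phi> ` E \<subseteq> (\<Union>n. U n)" using U unfolding hausdorff_covers_def by blast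
      then show "E \<subseteq> (\<Union>n. V n)" using E unfolding V_def by blast
    qed
    then have "hausdorff_content M d E \<alpha> \<epsilon> \<le> (\<Sum>n. diam_pow d \<alpha> (V n))"
      unfolding hausdorff_content_def by (rule INF_lower)
    also have "\<dots> \<le> (\<Sum>n. ennreal (K powr \<alpha>) * diam_pow d \<alpha> (U n))"
    proof (rule suminf_le)
      fix n
      show "diam_pow d \<alpha> (V n) \<le> ennreal (K powr \<alpha>) * diam_pow d \<alpha> (U n)"
      proof (cases "V n = {}")
        case False
        then have "U n \<noteq> {}" by (auto simp: V_def)
        then have "diam_pow d \<alpha> (U n) = ennreal (enn2real (ediam d (U n)) powr \<alpha>)"
          using \<alpha> by (simp add: diam_pow_def)
        moreover have "diam_pow d \<alpha> (V n) \<le> ennreal ((K * enn2real (ediam d (U n))) powr \<alpha>)"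
          using dV K \<alpha> by (intro diam_pow_le) auto
        ultimately show ?thesis using K by (simp add: powr_mult ennreal_mult)
      qed (simp add: diam_pow_def)
    qed auto
    also have "\<dots> = ennreal (K powr \<alpha>) * (\<Sum>n. diam_pow d \<alpha> (U n))" by simp
    finally show ?thesis .
  qed
  let ?k = "ennreal (K powr \<alpha>)"
  have k: "?k \<noteq> 0" "?k \<noteq> \<infinity>" using K by auto
  have "hausdorff_content M d E \<alpha> \<epsilon> / ?k \<le> hausdorff_content M d (\<phi> ` E) \<alpha> (\<epsilon> / K)"
    unfolding hausdorff_content_def[of M d "\<phi> ` E"]
  proof (rule INF_greatest)
    fix U assume "U \<in> hausdorff_covers M d (\<phi> ` E) (\<epsilon> / K)"
    from step[OF this] show "hausdorff_content M d E \<alpha> \<epsilon> / ?k \<le> (\<Sum>n. diam_pow d \<alpha> (U n))"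
      using k by (intro divide_le_posI_ennreal) (auto simp: zero_less_iff_neq_zero)
  qed
  also have "\<dots> \<le> hausdorff_measure M d (\<phi> ` E) \<alpha>" using \<epsilon> K by (intro hausdorff_content_le) simp
  finally have "?k * (hausdorff_content M d E \<alpha> \<epsilon> / ?k) \<le> ?k * hausdorff_measure M d (\<phi> ` E) \<alpha>"
    by (rule mult_left_mono) simp
  moreover have "?k * (hausdorff_content M d E \<alpha> \<epsilon> / ?k) = hausdorff_content M d E \<alpha> \<epsilon>"
    unfolding ennreal_times_divide mult.commute[of ?k] using k by (intro ennreal_mult_divide_eq) auto
  ultimately show "hausdorff_content M d E \<alpha> \<epsilon> \<le> ?k * hausdorff_measure M d (\<phi> ` E) \<alpha>" by simp
qed

section \<open>Visual metrics and shadows\<close>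

lemma space_borel_of: "space (borel_of T) = topspace T"
  unfolding borel_of_def by (rule space_measure_of) (auto dest: openin_subset)

lemma sets_borel_of: "sets (borel_of T) = sigma_sets (topspace T) {U. openin T U}"
  unfolding borel_of_def by (rule sets_measure_of) (auto dest: openin_subset)

lemma openin_sets_borel_of: "openin T U \<Longrightarrow> U \<in> sets (borel_of T)"
  unfolding sets_borel_of by (rule sigma_sets.Basic) simp

text \<open>The two visual inequalities, phrased with thresholds because \<open>gp_ge\<close>
  assigns no numerical product to a pair of boundary points.\<close>

locale visual_boundary = hyperbolic_boundary G S \<delta> bd rep act + da: Metric_space bd da
  for G :: "('g, 'm) monoid_scheme" (structure) and S \<delta> and bd :: "'b set" and rep act da +
  fixes a C :: real
  assumes a_gt_1: "1 < a" and C_pos: "0 < C"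
    and da_le: "\<lbrakk>\<xi> \<in> bd; \<eta> \<in> bd; gp_ge (rep \<xi>) (rep \<eta>) r\<rbrakk> \<Longrightarrow> da \<xi> \<eta> \<le> C * a powr (- r)"
    and gp_ge_of_da: "\<lbrakk>\<xi> \<in> bd; \<eta> \<in> bd; da \<xi> \<eta> < a powr (- r) / C\<rbrakk> \<Longrightarrow> gp_ge (rep \<xi>) (rep \<eta>) r"
begin

lemma da_compare:
  assumes "\<xi> \<in> bd" "\<eta> \<in> bd" "\<xi>' \<in> bd" "\<eta>' \<in> bd" "\<xi> \<noteq> \<eta>"
    and "\<And>r. gp_ge (rep \<xi>) (rep \<eta>) r \<Longrightarrow> gp_ge (rep \<xi>') (rep \<eta>') (r - s)"
  shows "da \<xi>' \<eta>' \<le> C\<^sup>2 * a powr (s + 1) * da \<xi> \<eta>"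
proof -
  define t where "t = da \<xi> \<eta>"
  have t: "0 < t" unfolding t_def using assms da.mdist_pos_less by blast
  \<comment> \<open>One unit below the threshold that matches the distance exactly, since
    \<open>gp_ge_of_da\<close> needs a strict inequality; hence \<open>s + 1\<close> in the
    bound.\<close>
  define r where "r = - log a (C * t) - 1"
  have ar: "a powr (- r) = C * t * a"
    using a_gt_1 C_pos t by (simp add: r_def powr_add)
  have "da \<xi> \<eta> < a powr (- r) / C" using ar a_gt_1 C_pos t by (simp add: t_def)
  then have "da \<xi>' \<eta>' \<le> C * a powr (- (r - s))" using assms gp_ge_of_da da_le by blast
  also have "a powr (- (r - s)) = a powr (- r) * a powr s" by (simp add: powr_add[symmetric])
  finally show ?thesis
    unfolding ar t_def using a_gt_1 by (simp add: powr_add power2_eq_square algebra_simps)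
qed

lemma da_act_expand:
  assumes "g \<in> carrier G" "\<xi> \<in> bd" "\<eta> \<in> bd"
  shows "da \<xi> \<eta> \<le> C\<^sup>2 * a powr (len g + 2 * \<delta> + 1) * da (act g \<xi>) (act g \<eta>)"
proof (cases "\<xi> = \<eta>")
  case True
  then show ?thesis using assms act_closed by simp
next
  case False
  show ?thesis
    by (rule da_compare) (use assms act_closed act_inj False gp_ge_act_cancel_len in \<open>auto simp: diff_diff_eq\<close>)
qed

lemma da_act_lipschitz:
  assumes "g \<in> carrier G" "\<xi> \<in> bd" "\<eta> \<in> bd"
  shows "da (act g \<xi>) (act g \<eta>) \<le> C\<^sup>2 * a powr (len g + 2 * \<delta> + 1) * da \<xi> \<eta>"
proof (cases "\<xi> = \<eta>")
  case True
  then show ?thesis using assms act_closed by simp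
next
  case False
  show ?thesis
    by (rule da_compare) (use assms act_closed False gp_ge_act_len in \<open>auto simp: diff_diff_eq\<close>)
qed

text \<open>For \<open>s\<close> close to \<open>len x\<close> this is the usual shadow: the limits
  of rays that pass near \<open>x\<close>.\<close>

definition shadow :: "'g \<Rightarrow> real \<Rightarrow> 'b set" where
  "shadow x s = {\<xi> \<in> bd. gp_ge (\<lambda>_. x) (rep \<xi>) s}"

lemma shadow_da:
  assumes "x \<in> carrier G" "\<xi> \<in> shadow x s" "\<eta> \<in> shadow x s"
  shows "da \<xi> \<eta> \<le> C * a powr (\<delta> - s)"
proof -
  have bd: "\<xi> \<in> bd" "\<eta> \<in> bd" and g: "gp_ge (\<lambda>_. x) (rep \<xi>) s" "gp_ge (\<lambda>_. x) (rep \<eta>) s"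
    using assms by (auto simp: shadow_def)
  have "gp_ge (rep \<xi>) (\<lambda>_. x) s" by (rule gp_ge_commute[OF g(1)]) (use assms(1) bd rep_range in auto)
  then have "gp_ge (rep \<xi>) (rep \<eta>) (min s s - \<delta>)"
    by (rule gp_ge_trans[OF _ g(2)]) (use assms(1) bd rep_range in auto)
  then show ?thesis using da_le[OF bd, of "s - \<delta>"] by simp
qed

lemma not_gp_ge_constD:
  assumes "x \<in> carrier G" "\<xi> \<in> bd" "\<not> gp_ge (\<lambda>_. x) (rep \<xi>) r"
  shows "\<exists>N. \<forall>n\<ge>N. gp x (rep \<xi> n) < r + \<delta>"
proof -
  have "gp_ge (rep \<xi>) (rep \<xi>) (r + \<delta>)" using rep_gromov_seq[OF assms(2)] by (simp add: gromov_seq_def)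
  then obtain N where N: "\<And>n m. N \<le> n \<Longrightarrow> N \<le> m \<Longrightarrow> r + \<delta> \<le> gp (rep \<xi> n) (rep \<xi> m)"
    unfolding gp_ge_def by blast
  have "gp x (rep \<xi> n) < r + \<delta>" if n: "N \<le> n" for n
  proof (rule ccontr)
    assume "\<not> ?thesis"
    then have 1: "r + \<delta> \<le> gp x (rep \<xi> n)" by simp
    have "gp_ge (\<lambda>_. x) (rep \<xi>) r"
    proof (rule gp_geI[of N])
      fix k m :: nat assume m: "N \<le> m"
      have "min (r + \<delta>) (r + \<delta>) - \<delta> \<le> gp x (rep \<xi> m)"
        by (rule gp_hyperbolicD[OF 1 N]) (use n m assms rep_closed in auto)
      then show "r \<le> gp x (rep \<xi> m)" by simp
    qed
    then show False using assms(3) by blast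
  qed
  then show ?thesis by blast
qed

text \<open>Little cancellation between \<open>y\<close> and a ray means that the translated ray
  starts along \<open>y\<close>: this is \<open>gp_mult_right\<close> at infinity.\<close>

lemma act_in_shadow:
  assumes "y \<in> carrier G" "\<eta> \<in> bd" "\<eta> \<notin> shadow (inv y) r"
  shows "act y \<eta> \<in> shadow y (len y - r - 2 * \<delta>)"
proof -
  have "\<not> gp_ge (\<lambda>_. inv y) (rep \<eta>) r" using assms by (simp add: shadow_def)
  then obtain N where N: "\<And>n. N \<le> n \<Longrightarrow> gp (inv y) (rep \<eta> n) < r + \<delta>"
    using not_gp_ge_constD[of "inv y" \<eta>] assms(1,2) by auto
  have "gp_ge (\<lambda>_. y) (\<lambda>n. y \<otimes> rep \<eta> n) (len y - r - \<delta>)"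
  proof (rule gp_geI[of N])
    fix n m :: nat assume "N \<le> m"
    then show "len y - r - \<delta> \<le> gp y (y \<otimes> rep \<eta> m)"
      using N[of m] gp_mult_right[of y "rep \<eta> m"] rep_closed[OF assms(2)] assms(1) by simp
  qed
  then have "gp_ge (\<lambda>_. y) (rep (act y \<eta>)) (min (len y - r - \<delta>) (len y - r - \<delta>) - \<delta>)"
    by (rule gp_ge_trans[OF _ act_rep]) (use assms act_closed rep_range translate_rep_range in auto)
  then show ?thesis using assms act_closed by (simp add: shadow_def algebra_simps)
qed

text \<open>Hausdorff covers have to be open. Thickening a shadow by its own scale achieves this and
  changes the diameter bound by a constant factor only.\<close>

definition shadow_hull :: "'g \<Rightarrow> real \<Rightarrow> 'b set" where
  "shadow_hull x s = (\<Union>\<zeta>\<in>shadow x s. da.mball \<zeta> (a powr (- s)))"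

lemma openin_shadow_hull: "openin da.mtopology (shadow_hull x s)"
  unfolding shadow_hull_def by (intro openin_Union) auto

lemma shadow_subset_hull: "shadow x s \<subseteq> shadow_hull x s"
proof
  fix \<xi> assume \<xi>: "\<xi> \<in> shadow x s"
  then have "\<xi> \<in> bd" by (simp add: shadow_def)
  then have "\<xi> \<in> da.mball \<xi> (a powr (- s))" using a_gt_1 by simp
  then show "\<xi> \<in> shadow_hull x s" using \<xi> unfolding shadow_hull_def by blast
qed

lemma shadow_hull_da:
  assumes "x \<in> carrier G" "\<xi> \<in> shadow_hull x s" "\<eta> \<in> shadow_hull x s"
  shows "da \<xi> \<eta> \<le> (C * a powr \<delta> + 2) * a powr (- s)"
proof -
  obtain \<xi>' \<eta>' where h: "\<xi>' \<in> shadow x s" "\<eta>' \<in> shadow x s" "\<xi> \<in> bd" "\<eta> \<in> bd" "\<xi>' \<in> bd" "\<eta>' \<in> bd"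
    "da \<xi>' \<xi> < a powr (- s)" "da \<eta>' \<eta> < a powr (- s)"
    using assms(2,3) unfolding shadow_hull_def by auto
  have "da \<xi> \<eta> \<le> da \<xi> \<xi>' + (da \<xi>' \<eta>' + da \<eta>' \<eta>)"
    using da.triangle[of \<xi> \<xi>' \<eta>] da.triangle[of \<xi>' \<eta>' \<eta>] h by simp
  moreover have "da \<xi>' \<eta>' \<le> C * (a powr \<delta> * a powr (- s))"
    using shadow_da[OF assms(1) h(1,2)] by (simp add: powr_add[symmetric])
  ultimately show ?thesis using h(7,8) da.commute[of \<xi> \<xi>'] by (simp add: algebra_simps)
qed

end

section \<open>Growth of spheres and cost of shadows\<close>

locale conformal_boundary = visual_boundary G S \<delta> bd rep act da a C + prob_space P
  for G :: "('g, 'm) monoid_scheme" (structure) and S \<delta> and bd :: "'b set" and rep act da a C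
    and P :: "'b measure" +
  fixes D :: real
  assumes sets_P: "sets P = sets (borel_of da.mtopology)"
    and emeasure_P: "Z \<in> sets P \<Longrightarrow> emeasure P Z = hausdorff_measure bd da Z D / hausdorff_measure bd da bd D"
    and total_nonzero: "hausdorff_measure bd da bd D \<noteq> 0"
    and total_finite: "hausdorff_measure bd da bd D \<noteq> \<infinity>"
begin

abbreviation hm :: "'b set \<Rightarrow> ennreal" where
  "hm Z \<equiv> hausdorff_measure bd da Z D"

lemma D_pos: "0 < D"
  by (rule hausdorff_exponent_pos[OF da.Metric_space_axioms infinite_boundary total_nonzero total_finite])

lemma space_P: "space P = bd"
  using sets_eq_imp_space_eq[OF sets_P] by (simp add: space_borel_of)

lemma openin_P: "openin da.mtopology U \<Longrightarrow> U \<in> sets P"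
  using openin_sets_borel_of sets_P by blast

lemma emeasure_P_eq_0: "Z \<in> sets P \<Longrightarrow> hm Z = 0 \<Longrightarrow> emeasure P Z = 0"
  using emeasure_P by simp

text \<open>Otherwise there are sets of mass above \<open>1 / 2\<close> and diameter tending to
  zero. Any two of them meet, so their limit superior is at most one point, yet has mass at least
  \<open>1 / 2\<close>, whereas points are null.\<close>

lemma measure_small_sets:
  "\<exists>\<rho>>0. \<forall>B\<in>sets P. (\<forall>x\<in>B. \<forall>y\<in>B. da x y \<le> \<rho>) \<longrightarrow> prob B \<le> 1 / 2"
proof (rule ccontr)
  assume "\<not> ?thesis"
  then have "\<forall>n::nat. \<exists>B. B \<in> sets P \<and> (\<forall>x\<in>B. \<forall>y\<in>B. da x y \<le> 1 / real (Suc n)) \<and> 1 / 2 < prob B"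
    by (metis not_le of_nat_0_less_iff zero_less_Suc zero_less_divide_1_iff)
  then obtain B where B: "\<And>n. B n \<in> sets P" "\<And>n x y. x \<in> B n \<Longrightarrow> y \<in> B n \<Longrightarrow> da x y \<le> 1 / real (Suc n)"
    "\<And>n. 1 / 2 < prob (B n)" by metis
  have meet: "B n \<inter> B m \<noteq> {}" for n m
  proof
    assume "B n \<inter> B m = {}"
    then have "prob (B n \<union> B m) = prob (B n) + prob (B m)" using B(1) by (intro finite_measure_Union) auto
    then show False using B(3)[of n] B(3)[of m] prob_le_1[of "B n \<union> B m"] by linarith
  qed
  have Bbd: "B n \<subseteq> bd" for n using B(1) sets.sets_into_space space_P by blast
  define T where "T n = (\<Union>m\<in>{n..}. B m)" for n
  have Tm: "T n \<in> sets P" for n unfolding T_def using B(1) by auto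
  have "(\<lambda>n. prob (T n)) \<longlonglongrightarrow> prob (\<Inter>n. T n)"
  proof (rule finite_Lim_measure_decseq)
    have "T n \<subseteq> T m" if "m \<le> n" for m n unfolding T_def using that by (intro UN_mono) auto
    then show "decseq T" by (simp add: decseq_def)
  qed (use Tm in auto)
  moreover have "1 / 2 \<le> prob (T n)" for n
  proof -
    have "prob (B n) \<le> prob (T n)" using Tm by (intro finite_measure_mono) (auto simp: T_def)
    then show ?thesis using B(3)[of n] by simp
  qed
  ultimately have half: "1 / 2 \<le> prob (\<Inter>n. T n)" by (intro LIMSEQ_le_const) auto
  have eq: "x = y" if "x \<in> (\<Inter>n. T n)" "y \<in> (\<Inter>n. T n)" for x y
  proof (rule ccontr)
    assume "x \<noteq> y"
    moreover have xy: "x \<in> bd" "y \<in> bd" using that Bbd unfolding T_def by blast+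
    ultimately have pos: "0 < da x y" using da.mdist_pos_less by blast
    then obtain n :: nat where n: "2 / da x y < real n" using reals_Archimedean2 by blast
    have "x \<in> T n" "y \<in> T n" using that by blast+
    then obtain m k where mk: "n \<le> m" "x \<in> B m" "n \<le> k" "y \<in> B k" unfolding T_def by auto
    obtain z where z: "z \<in> B m" "z \<in> B k" using meet by blast
    have "1 / real (Suc m) \<le> 1 / real (Suc n)" "1 / real (Suc k) \<le> 1 / real (Suc n)"
      using mk by (auto simp: frac_le)
    then have "da x z \<le> 1 / real (Suc n)" "da z y \<le> 1 / real (Suc n)"
      using B(2)[OF mk(2) z(1)] B(2)[OF z(2) mk(4)] by linarith+
    moreover have "da x y \<le> da x z + da z y" using da.triangle xy z Bbd by blast
    ultimately have "da x y \<le> 1 / real (Suc n) + 1 / real (Suc n)" by linarith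
    then have "da x y \<le> 2 / real (Suc n)" by (simp only: add_divide_distrib[symmetric] one_add_one)
    moreover have "2 / real (Suc n) < da x y" using n pos by (simp add: field_simps)
    ultimately show False by linarith
  qed
  have "hm (\<Inter>n. T n) = 0"
  proof (cases "(\<Inter>n. T n) = {}")
    case True
    have "hm {} \<le> hm {\<xi>}" for \<xi> by (rule hausdorff_measure_mono) simp
    moreover obtain \<xi> where "\<xi> \<in> bd" using third_point by blast
    ultimately show ?thesis
      using hausdorff_measure_singleton[OF da.Metric_space_axioms D_pos] True by (metis le_zero_eq)
  next
    case False
    then obtain x where "x \<in> (\<Inter>n. T n)" by blast
    then have "(\<Inter>n. T n) = {x}" "x \<in> bd" using eq Bbd unfolding T_def by blast+
    then show ?thesis using hausdorff_measure_singleton[OF da.Metric_space_axioms D_pos] by simp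
  qed
  moreover have "(\<Inter>n. T n) \<in> sets P" using Tm by auto
  ultimately have "prob (\<Inter>n. T n) = 0" using emeasure_P_eq_0 by (simp add: measure_def)
  then show False using half by simp
qed

text \<open>Coornaert's bound: the shadows of the sphere of radius \<open>n\<close> have bounded multiplicity and mass at
  least of order \<open>a powr (- D * n)\<close>, since \<open>y\<inverse>\<close> expands by at most \<open>a powr len y\<close> and maps the shadow
  of \<open>y\<close> onto at least half of the boundary.\<close>

lemma sphere_growth:
  "\<exists>K\<ge>0. \<forall>n. real (card {y \<in> carrier G. word_length G S y = n}) \<le> K * a powr (D * real n)"
proof -
  obtain \<rho> where \<rho>0: "\<rho> > 0" and \<rho>': "\<forall>B\<in>sets P. (\<forall>x\<in>B. \<forall>y\<in>B. da x y \<le> \<rho>) \<longrightarrow> prob B \<le> 1 / 2"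
    using measure_small_sets by auto
  have \<rho>: "\<rho> > 0" "\<And>B. B \<in> sets P \<Longrightarrow> (\<And>x y. x \<in> B \<Longrightarrow> y \<in> B \<Longrightarrow> da x y \<le> \<rho>) \<Longrightarrow> prob B \<le> 1 / 2"
    using \<rho>0 \<rho>'[rule_format] by simp_all
  \<comment> \<open>Makes the shadow of \<open>inv y\<close> at level \<open>r\<close> so small that
    it fits into a ball of radius \<open>\<rho> / 2\<close>.\<close>
  define r where "r = \<delta> - log a (\<rho> / (4 * C))"
  have ar: "C * a powr (\<delta> - r) = \<rho> / 4" using a_gt_1 C_pos \<rho>(1) by (simp add: r_def)
  define c1 where "c1 = r + 2 * \<delta>"
  \<comment> \<open>\<open>q * a powr (- len y)\<close> bounds the diameter of the shadow of
    \<open>y\<close> at level \<open>len y - c1\<close>.\<close>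
  define q where "q = C * a powr (\<delta> + c1)"
  have q: "0 < q" using C_pos a_gt_1 by (simp add: q_def)
  \<comment> \<open>If two of the balls for a sphere of radius \<open>n\<close> meet, their centres
    have product at least \<open>n - c2\<close>; \<open>c3\<close> adds the losses on the way to the
    group elements.\<close>
  define c2 where "c2 = log a (8 * q * C)"
  have ac2: "a powr c2 = 8 * q * C" using a_gt_1 q C_pos by (simp add: c2_def)
  define c3 where "c3 = max c1 c2 + 2 * \<delta>"
  define B where "B = card {g \<in> carrier G. len g \<le> 2 * c3}"
  define L where "L = C\<^sup>2 * a powr (2 * \<delta> + 1)"
  have L: "0 < L" using C_pos a_gt_1 by (simp add: L_def)
  have "\<exists>\<zeta>. \<zeta> \<in> bd \<and> \<zeta> \<in> shadow y (len y - c1) \<and>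
      1 / 2 \<le> (L * a powr len y) powr D * prob (da.mball \<zeta> (2 * q * a powr (- len y)))" if y: "y \<in> carrier G" for y
  proof -
    \<comment> \<open>An open ball containing the shadow is removed instead of the shadow itself, so
      that \<open>E\<close> is Borel; the ball has mass at most \<open>1 / 2\<close>.\<close>
    define E where "E = bd - (if shadow (inv y) r = {} then {} else da.mball (SOME \<xi>. \<xi> \<in> shadow (inv y) r) (\<rho> / 2))"
    have Es: "E \<in> sets P" unfolding E_def using openin_P sets.top[of P] space_P by auto
    have "1 / 2 \<le> prob E"
    proof (cases "shadow (inv y) r = {}")
      case True
      then have "E = space P" by (simp add: E_def space_P)
      then show ?thesis using prob_space by simp
    next
      case False
      define \<xi> where "\<xi> = (SOME \<xi>. \<xi> \<in> shadow (inv y) r)"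
      have "prob (da.mball \<xi> (\<rho> / 2)) \<le> 1 / 2"
      proof (rule \<rho>(2))
        show "da.mball \<xi> (\<rho> / 2) \<in> sets P" by (intro openin_P) simp
        fix u v assume "u \<in> da.mball \<xi> (\<rho> / 2)" "v \<in> da.mball \<xi> (\<rho> / 2)"
        then show "da u v \<le> \<rho>" using da.triangle[of u \<xi> v] da.commute[of u \<xi>] by auto
      qed
      moreover have "prob E = 1 - prob (da.mball \<xi> (\<rho> / 2))"
        using False prob_compl[OF openin_P, of "da.mball \<xi> (\<rho> / 2)"] by (simp add: E_def \<xi>_def space_P)
      ultimately show ?thesis by simp
    qed
    have E_sub: "E \<subseteq> bd" by (auto simp: E_def)
    have E_shadow: "\<eta> \<notin> shadow (inv y) r" if \<eta>: "\<eta> \<in> E" for \<eta>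
    proof
      assume s: "\<eta> \<in> shadow (inv y) r"
      define \<xi> where "\<xi> = (SOME \<xi>. \<xi> \<in> shadow (inv y) r)"
      have \<xi>: "\<xi> \<in> shadow (inv y) r" unfolding \<xi>_def using s by (rule someI)
      then have "da \<xi> \<eta> \<le> C * a powr (\<delta> - r)" using shadow_da[OF inv_closed[OF y]] s by blast
      then have "\<eta> \<in> da.mball \<xi> (\<rho> / 2)" using ar \<rho>(1) \<xi> s by (auto simp: shadow_def)
      moreover have "shadow (inv y) r \<noteq> {}" using s by blast
      ultimately show False using \<eta> by (simp add: E_def \<xi>_def)
    qed
    have img: "act y ` E \<subseteq> shadow y (len y - c1)"
      using act_in_shadow[OF y] E_shadow E_sub by (auto simp: c1_def diff_diff_eq)
    obtain \<eta>0 where \<eta>0: "\<eta>0 \<in> E" using \<open>1 / 2 \<le> prob E\<close> by (cases "E = {}") auto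
    define \<zeta> where "\<zeta> = act y \<eta>0"
    have \<zeta>: "\<zeta> \<in> bd" "\<zeta> \<in> shadow y (len y - c1)"
      using \<eta>0 E_sub img act_closed[OF y] by (auto simp: \<zeta>_def)
    let ?ball = "da.mball \<zeta> (2 * q * a powr (- len y))"
    have "act y ` E \<subseteq> ?ball"
    proof
      fix \<xi> assume "\<xi> \<in> act y ` E"
      then have \<xi>: "\<xi> \<in> shadow y (len y - c1)" using img by blast
      have "da \<zeta> \<xi> \<le> C * a powr (\<delta> - (len y - c1))" using shadow_da[OF y \<zeta>(2) \<xi>] .
      also have "\<dots> = q * a powr (- len y)" by (simp add: q_def powr_add[symmetric] algebra_simps)
      also have "\<dots> < 2 * q * a powr (- len y)" using q a_gt_1 by simp
      finally show "\<xi> \<in> ?ball" using \<zeta> \<xi> by (simp add: shadow_def)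
    qed
    then have "hm (act y ` E) \<le> hm ?ball" by (rule hausdorff_measure_mono)
    moreover have "hm E \<le> ennreal ((L * a powr len y) powr D) * hm (act y ` E)"
    proof (rule hausdorff_measure_expanding[OF da.Metric_space_axioms D_pos])
      have K: "L * a powr len y = C\<^sup>2 * a powr (len y + 2 * \<delta> + 1)" by (simp add: L_def powr_add)
      show "da u v \<le> L * a powr len y * da (act y u) (act y v)" if "u \<in> bd" "v \<in> bd" for u v
        unfolding K by (rule da_act_expand[OF y that])
      show "da (act y u) (act y v) \<le> L * a powr len y * da u v" if "u \<in> bd" "v \<in> bd" for u v
        unfolding K by (rule da_act_lipschitz[OF y that])
    qed (use act_closed y E_sub L a_gt_1 in auto)
    ultimately have "hm E \<le> ennreal ((L * a powr len y) powr D) * hm ?ball"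
      using mult_left_mono[of "hm (act y ` E)" "hm ?ball" "ennreal ((L * a powr len y) powr D)"] by (meson order_trans zero_le)
    then have "hm E / hm bd \<le> ennreal ((L * a powr len y) powr D) * hm ?ball / hm bd"
      by (rule divide_right_mono_ennreal)
    then have "emeasure P E \<le> ennreal ((L * a powr len y) powr D) * emeasure P ?ball"
      using emeasure_P[OF Es] emeasure_P[OF openin_P, of ?ball] by (simp add: ennreal_times_divide)
    then have "prob E \<le> (L * a powr len y) powr D * prob ?ball"
      by (simp add: emeasure_eq_measure ennreal_mult[symmetric])
    then show ?thesis using \<zeta> \<open>1 / 2 \<le> prob E\<close> by (intro exI[of _ \<zeta>]) linarith
  qed
  then obtain \<zeta> where \<zeta>: "\<And>y. y \<in> carrier G \<Longrightarrow> \<zeta> y \<in> bd" "\<And>y. y \<in> carrier G \<Longrightarrow> \<zeta> y \<in> shadow y (len y - c1)"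
    "\<And>y. y \<in> carrier G \<Longrightarrow> 1 / 2 \<le> (L * a powr len y) powr D * prob (da.mball (\<zeta> y) (2 * q * a powr (- len y)))"
    by metis
  have bound: "real (card {y \<in> carrier G. word_length G S y = n}) \<le> 2 * real B * L powr D * a powr (D * real n)" for n
  proof -
    define Sn where "Sn = {y \<in> carrier G. word_length G S y = n}"
    define V where "V y = da.mball (\<zeta> y) (2 * q * a powr (- real n))" for y
    have finS: "finite Sn" by (rule finite_subset[OF _ finite_ball[of "real n"]]) (auto simp: Sn_def)
    have Vs: "V y \<in> sets P" for y unfolding V_def by (intro openin_P) simp
    have mult: "card {y \<in> Sn. \<xi> \<in> V y} \<le> B" for \<xi>
    proof (cases "{y \<in> Sn. \<xi> \<in> V y} = {}")
      case False
      then obtain y where y: "y \<in> Sn" "\<xi> \<in> V y" by blast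
      have yc: "y \<in> carrier G" "word_length G S y = n" using y by (auto simp: Sn_def)
      have close: "wd y z \<le> 2 * c3" if z: "z \<in> Sn" "\<xi> \<in> V z" for z
      proof -
        have zc: "z \<in> carrier G" "word_length G S z = n" using z by (auto simp: Sn_def)
        have "da (\<zeta> y) (\<zeta> z) < 4 * q * a powr (- real n)"
          using y z da.triangle[of "\<zeta> y" \<xi> "\<zeta> z"] da.commute[of \<xi> "\<zeta> z"] by (auto simp: V_def)
        also have "\<dots> \<le> 8 * q * a powr (- real n)" using q by simp
        also have "\<dots> = a powr (- (real n - c2)) / C"
          using C_pos ac2 by (simp add: powr_diff powr_minus field_simps)
        finally have g: "gp_ge (rep (\<zeta> y)) (rep (\<zeta> z)) (real n - c2)" using gp_ge_of_da \<zeta>(1) yc zc by blast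
        have gy: "gp_ge (\<lambda>_. y) (rep (\<zeta> y)) (real n - c1)" and gz: "gp_ge (\<lambda>_. z) (rep (\<zeta> z)) (real n - c1)"
          using \<zeta>(2)[OF yc(1)] \<zeta>(2)[OF zc(1)] yc zc by (auto simp: shadow_def)
        have "gp_ge (\<lambda>_. y) (rep (\<zeta> z)) (min (real n - c1) (real n - c2) - \<delta>)"
          by (rule gp_ge_trans[OF gy g]) (use yc zc \<zeta>(1) rep_range in auto)
        then have "gp_ge (\<lambda>_. y) (\<lambda>_. z) (min (min (real n - c1) (real n - c2) - \<delta>) (real n - c1) - \<delta>)"
          by (rule gp_ge_trans[OF _ gp_ge_commute[OF gz]]) (use yc zc \<zeta>(1) rep_range in auto)
        then have "real n - c3 \<le> gp y z" using delta_nonneg by (simp add: gp_ge_const c3_def min_def max_def split: if_splits)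
        then show ?thesis using yc zc by (simp add: gp_def)
      qed
      have "{z \<in> Sn. \<xi> \<in> V z} \<subseteq> (\<lambda>e. y \<otimes> e) ` {g \<in> carrier G. len g \<le> 2 * c3}"
      proof
        fix z assume z: "z \<in> {z \<in> Sn. \<xi> \<in> V z}"
        then have zc: "z \<in> carrier G" by (auto simp: Sn_def)
        have "len (inv y \<otimes> z) \<le> 2 * c3" using close z by (simp add: word_dist_def)
        moreover have "z = y \<otimes> (inv y \<otimes> z)" using yc zc by (simp add: m_assoc[symmetric])
        ultimately show "z \<in> (\<lambda>e. y \<otimes> e) ` {g \<in> carrier G. len g \<le> 2 * c3}" using yc zc by blast
      qed
      then show ?thesis unfolding B_def by (rule surj_card_le[OF finite_ball])
    qed (simp only: card.empty zero_le)
    \<comment> \<open>Double counting: every boundary point lies in at most \<open>B\<close> of the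
      balls, so their masses sum to at most \<open>B\<close>.\<close>
    have "(\<Sum>y\<in>Sn. emeasure P (V y)) = (\<Sum>y\<in>Sn. \<integral>\<^sup>+ \<xi>. indicator (V y) \<xi> \<partial>P)" using Vs by simp
    also have "\<dots> = (\<integral>\<^sup>+ \<xi>. (\<Sum>y\<in>Sn. indicator (V y) \<xi>) \<partial>P)" using Vs by (subst nn_integral_sum) auto
    also have "\<dots> \<le> (\<integral>\<^sup>+ \<xi>. of_nat B \<partial>P)"
    proof (rule nn_integral_mono)
      fix \<xi>
      have "(\<Sum>y\<in>Sn. indicator (V y) \<xi>) = (of_nat (card {y \<in> Sn. \<xi> \<in> V y}) :: ennreal)"
        using finS by (simp add: indicator_def sum.If_cases Int_def)
      then show "(\<Sum>y\<in>Sn. indicator (V y) \<xi>) \<le> (of_nat B :: ennreal)" using mult by (simp add: of_nat_mono)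
    qed
    also have "\<dots> = of_nat B" using emeasure_space_1 by simp
    finally have "ennreal (\<Sum>y\<in>Sn. prob (V y)) \<le> ennreal (real B)"
      by (simp add: emeasure_eq_measure sum_ennreal ennreal_of_nat_eq_real_of_nat)
    then have s: "(\<Sum>y\<in>Sn. prob (V y)) \<le> real B" by simp
    let ?k = "(L * a powr real n) powr D"
    have k: "?k = L powr D * a powr (D * real n)" using L a_gt_1 by (simp add: powr_mult powr_powr mult.commute)
    have "real (card Sn) / 2 = (\<Sum>y\<in>Sn. 1 / 2)" by simp
    also have "\<dots> \<le> (\<Sum>y\<in>Sn. ?k * prob (V y))"
      using \<zeta>(3) by (intro sum_mono) (auto simp: Sn_def V_def)
    also have "\<dots> = ?k * (\<Sum>y\<in>Sn. prob (V y))" by (simp add: sum_distrib_left)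
    also have "\<dots> \<le> ?k * real B" using s by (intro mult_left_mono) auto
    finally show ?thesis unfolding Sn_def[symmetric] k by (simp add: algebra_simps)
  qed
  show ?thesis
    by (rule exI[of _ "2 * real B * L powr D"]) (use bound L in auto)
qed

text \<open>By \<open>sphere_growth\<close> the weight compensates the number of elements of each
  sphere, and there are \<open>L + 1\<close> spheres.\<close>

lemma ball_sum_le:
  "\<exists>K\<ge>0. \<forall>L::nat. (\<Sum>y\<in>{y \<in> carrier G. word_length G S y \<le> L}. a powr (- D * len y)) \<le> K * (real L + 1)"
proof -
  obtain K where K: "K \<ge> 0" "\<And>n. real (card {y \<in> carrier G. word_length G S y = n}) \<le> K * a powr (D * real n)"
    using sphere_growth by blast
  have "(\<Sum>y\<in>{y \<in> carrier G. word_length G S y \<le> L}. a powr (- D * len y)) \<le> K * (real L + 1)" for L :: nat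
  proof -
    let ?B = "{y \<in> carrier G. word_length G S y \<le> L}"
    have fin: "finite ?B" using finite_ball[of "real L"] by simp
    have "(\<Sum>y\<in>?B. a powr (- D * len y)) = (\<Sum>n\<in>{..L}. \<Sum>y\<in>{y \<in> ?B. word_length G S y = n}. a powr (- D * len y))"
      by (rule sum.group[symmetric]) (use fin in auto)
    also have "\<dots> \<le> (\<Sum>n\<in>{..L}. K)"
    proof (rule sum_mono)
      fix n assume "n \<in> {..L}"
      then have eq: "{y \<in> ?B. word_length G S y = n} = {y \<in> carrier G. word_length G S y = n}" by auto
      have "(\<Sum>y\<in>{y \<in> ?B. word_length G S y = n}. a powr (- D * len y))
          = (\<Sum>y\<in>{y \<in> ?B. word_length G S y = n}. a powr (- D * real n))" by (rule sum.cong) auto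
      also have "\<dots> = real (card {y \<in> carrier G. word_length G S y = n}) * a powr (- D * real n)"
        unfolding eq by simp
      also have "\<dots> \<le> K * a powr (D * real n) * a powr (- D * real n)"
        using K(2) by (intro mult_right_mono) auto
      also have "\<dots> = K" using a_gt_1 by (simp add: powr_add[symmetric] mult.assoc)
      finally show "(\<Sum>y\<in>{y \<in> ?B. word_length G S y = n}. a powr (- D * len y)) \<le> K" .
    qed
    also have "\<dots> = K * (real L + 1)" by simp
    finally show ?thesis .
  qed
  then show ?thesis using K(1) by blast
qed

lemma jump_shadows_cost:
  "\<exists>K\<ge>0. \<forall>(L::nat) (W::'g set) c k. finite W \<longrightarrow> (\<forall>w\<in>W. real k \<le> len w) \<longrightarrow>
     (\<Sum>(y, w)\<in>{y \<in> carrier G. word_length G S y \<le> L} \<times> W. ((C * a powr \<delta> + 2) * a powr (- (len y + len w - c))) powr D)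
       \<le> K * (real L + 1) * real (card W) * a powr (D * (c - real k))"
proof -
  obtain K where K: "K \<ge> 0" "\<And>L::nat. (\<Sum>y\<in>{y \<in> carrier G. word_length G S y \<le> L}. a powr (- D * len y)) \<le> K * (real L + 1)"
    using ball_sum_le by blast
  define q where "q = C * a powr \<delta> + 2"
  have q: "0 < q" using C_pos a_gt_1 by (simp add: q_def add_pos_pos)
  have "(\<Sum>(y, w)\<in>{y \<in> carrier G. word_length G S y \<le> L} \<times> W. (q * a powr (- (len y + len w - c))) powr D)
       \<le> (q powr D * K) * (real L + 1) * real (card W) * a powr (D * (c - real k))"
    if W: "finite W" "\<And>w. w \<in> W \<Longrightarrow> real k \<le> len w" for L :: nat and W :: "'g set" and c and k :: nat
  proof -
    let ?B = "{y \<in> carrier G. word_length G S y \<le> L}"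
    have "(\<Sum>(y, w)\<in>?B \<times> W. (q * a powr (- (len y + len w - c))) powr D)
        = (\<Sum>y\<in>?B. \<Sum>w\<in>W. (q * a powr (- (len y + len w - c))) powr D)" by (rule sum.cartesian_product[symmetric])
    also have "\<dots> \<le> (\<Sum>y\<in>?B. \<Sum>w\<in>W. q powr D * a powr (D * (c - real k)) * a powr (- D * len y))"
    proof (intro sum_mono)
      fix y w assume "y \<in> ?B" "w \<in> W"
      have "(a powr (- (len y + len w - c))) powr D = a powr (- D * len y + D * (c - len w))"
        by (simp add: powr_powr algebra_simps)
      also have "\<dots> \<le> a powr (- D * len y + D * (c - real k))"
        using W(2)[OF \<open>w \<in> W\<close>] D_pos a_gt_1 by (intro powr_mono) (auto simp: mult_left_mono)
      also have "\<dots> = a powr (- D * len y) * a powr (D * (c - real k))" by (rule powr_add)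
      finally have "q powr D * (a powr (- (len y + len w - c))) powr D \<le> q powr D * (a powr (- D * len y) * a powr (D * (c - real k)))"
        by (rule mult_left_mono) simp
      moreover have "(q * a powr (- (len y + len w - c))) powr D = q powr D * (a powr (- (len y + len w - c))) powr D"
        by (rule powr_mult)
      ultimately show "(q * a powr (- (len y + len w - c))) powr D \<le> q powr D * a powr (D * (c - real k)) * a powr (- D * len y)"
        by (simp only: mult_ac)
    qed
    also have "\<dots> = q powr D * real (card W) * a powr (D * (c - real k)) * (\<Sum>y\<in>?B. a powr (- D * len y))"
      by (simp add: sum_distrib_left mult_ac)
    also have "\<dots> \<le> q powr D * real (card W) * a powr (D * (c - real k)) * (K * (real L + 1))"
      using K(2)[of L] by (intro mult_left_mono) auto
    finally show ?thesis by (simp add: mult_ac)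
  qed
  then show ?thesis unfolding q_def using K(1) by (intro exI[of _ "(C * a powr \<delta> + 2) powr D * K"]) auto
qed

lemma null_set_of_shadows:
  assumes cover: "\<And>\<epsilon>. 0 < \<epsilon> \<Longrightarrow> \<exists>(I :: 'i set) x s. finite I \<and> (\<forall>i\<in>I. x i \<in> carrier G) \<and> Z \<subseteq> (\<Union>i\<in>I. shadow_hull (x i) (s i)) \<and>
       (\<Sum>i\<in>I. ((C * a powr \<delta> + 2) * a powr (- s i)) powr D) \<le> \<epsilon>"
  shows "hm Z = 0"
proof (rule hausdorff_measure_null[OF da.Metric_space_axioms D_pos, where 'i = 'i])
  fix \<epsilon> :: real assume \<epsilon>: "0 < \<epsilon>"
  obtain I :: "'i set" and x s where I: "finite I" "\<forall>i\<in>I. x i \<in> carrier G" "Z \<subseteq> (\<Union>i\<in>I. shadow_hull (x i) (s i))"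
    "(\<Sum>i\<in>I. ((C * a powr \<delta> + 2) * a powr (- s i)) powr D) \<le> \<epsilon>"
    using cover[OF \<epsilon>] by (elim exE conjE)
  show "\<exists>(I :: 'i set) V r. finite I \<and> Z \<subseteq> (\<Union>i\<in>I. V i) \<and> (\<Sum>i\<in>I. r i powr D) \<le> \<epsilon> \<and>
       (\<forall>i\<in>I. openin da.mtopology (V i) \<and> 0 \<le> r i \<and> (\<forall>x\<in>V i. \<forall>y\<in>V i. da x y \<le> r i))"
    using I openin_shadow_hull shadow_hull_da C_pos
    by (intro exI[of _ I] exI[of _ "\<lambda>i. shadow_hull (x i) (s i)"] exI[of _ "\<lambda>i. (C * a powr \<delta> + 2) * a powr (- s i)"])
      (auto simp: add_nonneg_nonneg)
qed

end

section \<open>Random walks\<close>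

locale random_increments = word_metric G S for G :: "('g, 'm) monoid_scheme" (structure) and S +
  fixes \<mu> :: "'g pmf"
  assumes supp: "set_pmf \<mu> \<subseteq> carrier G"
begin

abbreviation step :: "'g measure" where
  "step \<equiv> restrict_space (measure_pmf \<mu>) (carrier G)"

lemma space_step [simp]: "space step = carrier G"
  by (simp add: space_restrict_space)

lemma sets_step: "sets step = Pow (carrier G)"
  by (auto simp: sets_restrict_space)

lemma emeasure_step: "A \<subseteq> carrier G \<Longrightarrow> emeasure step A = emeasure (measure_pmf \<mu>) A"
  by (simp add: emeasure_restrict_space)

lemma prob_space_step: "prob_space step"
proof
  have "emeasure (measure_pmf \<mu>) (carrier G) = 1"
    using supp measure_pmf.emeasure_eq_1_AE[of "carrier G" \<mu>] by (auto simp: AE_measure_pmf_iff)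
  then show "emeasure step (space step) = 1" by (simp add: emeasure_step)
qed

sublocale increments: prob_space "increments G \<mu>"
  unfolding increments_def by (intro prob_space_PiM prob_space_step)

abbreviation \<Omega> :: "(nat \<Rightarrow> 'g) measure" where
  "\<Omega> \<equiv> increments G \<mu>"

lemma space_\<Omega>: "space \<Omega> = {h. \<forall>i. h i \<in> carrier G}"
  unfolding increments_def space_PiM by (auto simp: PiE_def Pi_def extensional_def)

lemma component_measurable: "(\<lambda>h. h i) \<in> measurable \<Omega> (count_space (carrier G))"
proof -
  have "(\<lambda>h. h i) \<in> measurable \<Omega> step"
    unfolding increments_def by (rule measurable_component_singleton) simp
  moreover have "measurable \<Omega> step = measurable \<Omega> (count_space (carrier G))"
    by (rule measurable_cong_sets) (simp_all add: sets_step)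
  ultimately show ?thesis by simp
qed

text \<open>\<open>X\<close> has countably many values, so measurability for each fixed value
  suffices.\<close>

lemma discrete_pred:
  assumes "X \<in> measurable \<Omega> (count_space (carrier G))" "\<And>g. g \<in> carrier G \<Longrightarrow> Measurable.pred \<Omega> (Q g)"
  shows "Measurable.pred \<Omega> (\<lambda>h. Q (X h) h)"
  by (rule measurable_compose_countable'[OF assms(2,1) countable_carrier])

lemma discrete_pred1:
  assumes "X \<in> measurable \<Omega> (count_space (carrier G))"
  shows "Measurable.pred \<Omega> (\<lambda>h. Q (X h))"
  by (rule discrete_pred[OF assms]) simp

lemma walk_measurable: "(\<lambda>h. random_walk G (\<lambda>i. h (s + i)) n) \<in> measurable \<Omega> (count_space (carrier G))"
proof (induction n)
  case (Suc n)
  have "(\<lambda>h. (\<lambda>x. x \<otimes> h (s + n)) (random_walk G (\<lambda>i. h (s + i)) n)) \<in> measurable \<Omega> (count_space (carrier G))"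
  proof (rule measurable_compose_countable'[OF _ Suc countable_carrier])
    fix x assume x: "x \<in> carrier G"
    show "(\<lambda>h. x \<otimes> h (s + n)) \<in> measurable \<Omega> (count_space (carrier G))"
      by (rule measurable_compose[OF component_measurable]) (use x in auto)
  qed
  then show ?case by simp
qed simp

lemma walk_measurable0: "(\<lambda>h. random_walk G h n) \<in> measurable \<Omega> (count_space (carrier G))"
  using walk_measurable[of 0 n] by simp

lemma walk_closed: "h \<in> space \<Omega> \<Longrightarrow> random_walk G (\<lambda>i. h (s + i)) n \<in> carrier G"
  by (induction n) (auto simp: space_\<Omega>)

lemma walk_closed0: "h \<in> space \<Omega> \<Longrightarrow> random_walk G h n \<in> carrier G"
  using walk_closed[of h 0 n] by simp

lemma walk_add:
  assumes "h \<in> space \<Omega>"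
  shows "random_walk G h (s + n) = random_walk G h s \<otimes> random_walk G (\<lambda>i. h (s + i)) n"
proof (induction n)
  case 0
  then show ?case using walk_closed0[OF assms] by simp
next
  case (Suc n)
  then show ?case
    using walk_closed0[OF assms] walk_closed[OF assms] assms by (simp add: m_assoc space_\<Omega>)
qed

lemma walk_upd_past: "random_walk G (h(T := x)) n = random_walk G h n" if "n \<le> T"
  using that by (induction n) auto

lemma walk_len_le: "h \<in> space \<Omega> \<Longrightarrow> len (random_walk G h n) \<le> (\<Sum>i<n. len (h i))"
proof (induction n)
  case (Suc n)
  have "len (random_walk G h (Suc n)) \<le> len (random_walk G h n) + len (h n)"
    using len_mult walk_closed0[OF Suc.prems] Suc.prems by (simp add: space_\<Omega>)
  then show ?case using Suc by simp
qed simp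

text \<open>Replacing the step at time \<open>T\<close> by an independent copy preserves the law.
  Since \<open>Q\<close> does not see that step, integrating over the copy first reduces the bound
  to a fixed path \<open>h\<close>.\<close>

lemma resample:
  assumes W: "W \<subseteq> carrier G"
    and Q: "\<And>w. w \<in> carrier G \<Longrightarrow> Measurable.pred \<Omega> (Q w)"
    and indep: "\<And>w h x. h \<in> space \<Omega> \<Longrightarrow> x \<in> carrier G \<Longrightarrow> Q w (h(T := x)) = Q w h"
    and bound: "\<And>h. h \<in> space \<Omega> \<Longrightarrow> measure_pmf.prob \<mu> {w \<in> W. Q w h} \<le> \<epsilon>" and "0 \<le> \<epsilon>"
  shows "{h \<in> space \<Omega>. h T \<in> W \<and> Q (h T) h} \<in> sets \<Omega>"
    and "increments.prob {h \<in> space \<Omega>. h T \<in> W \<and> Q (h T) h} \<le> \<epsilon>"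
proof -
  let ?A = "{h \<in> space \<Omega>. h T \<in> W \<and> Q (h T) h}"
  interpret N: prob_space step by (rule prob_space_step)
  interpret pair: pair_prob_space step \<Omega> ..
  have "Measurable.pred \<Omega> (\<lambda>h. (\<lambda>g h. g \<in> W \<and> Q g h) (h T) h)"
    by (rule discrete_pred[OF component_measurable]) (use Q in measurable)
  then show A: "?A \<in> sets \<Omega>" by measurable
  have distr: "distr (step \<Otimes>\<^sub>M \<Omega>) \<Omega> (\<lambda>(x, X). X(T := x)) = \<Omega>"
    using distr_pair_PiM_eq_PiM[of UNIV "\<lambda>_. step" T] prob_space_step unfolding increments_def by simp
  have meas: "(\<lambda>(x, X). X(T := x)) \<in> measurable (step \<Otimes>\<^sub>M \<Omega>) \<Omega>"
    unfolding increments_def case_prod_beta' by (rule measurable_fun_upd[where J = UNIV]) auto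
  let ?B = "(\<lambda>(x, X). X(T := x)) -` ?A \<inter> space (step \<Otimes>\<^sub>M \<Omega>)"
  have B: "?B \<in> sets (step \<Otimes>\<^sub>M \<Omega>)" by (rule measurable_sets[OF meas A])
  have "emeasure \<Omega> ?A = emeasure (step \<Otimes>\<^sub>M \<Omega>) ?B"
    using emeasure_distr[OF meas A] distr by simp
  also have "\<dots> = (\<integral>\<^sup>+ h. emeasure step ((\<lambda>x. (x, h)) -` ?B) \<partial>\<Omega>)"
    by (rule pair.emeasure_pair_measure_alt2[OF B])
  also have "\<dots> \<le> (\<integral>\<^sup>+ h. ennreal \<epsilon> \<partial>\<Omega>)"
  proof (rule nn_integral_mono)
    fix h assume h: "h \<in> space \<Omega>"
    have "(\<lambda>x. (x, h)) -` ?B = {w \<in> W. Q w h}"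
      using h W indep[OF h] by (auto simp: space_pair_measure space_\<Omega>)
    moreover have "{w \<in> W. Q w h} \<subseteq> carrier G" using W by auto
    ultimately have "emeasure step ((\<lambda>x. (x, h)) -` ?B) = emeasure (measure_pmf \<mu>) {w \<in> W. Q w h}"
      using emeasure_step by simp
    also have "\<dots> \<le> ennreal \<epsilon>"
      using bound[OF h] by (simp add: measure_pmf.emeasure_eq_measure ennreal_leI)
    finally show "emeasure step ((\<lambda>x. (x, h)) -` ?B) \<le> ennreal \<epsilon>" .
  qed
  also have "\<dots> = ennreal \<epsilon>" using increments.emeasure_space_1 by simp
  finally show "increments.prob ?A \<le> \<epsilon>"
    using \<open>0 \<le> \<epsilon>\<close> by (simp add: increments.emeasure_eq_measure)
qed

lemma prob_no_jump:
  assumes "W \<subseteq> carrier G"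
  shows "{h \<in> space \<Omega>. \<forall>T<N. h T \<notin> W} \<in> sets \<Omega>"
    and "increments.prob {h \<in> space \<Omega>. \<forall>T<N. h T \<notin> W} = (1 - measure_pmf.prob \<mu> W) ^ N"
proof -
  have eq: "{h \<in> space \<Omega>. \<forall>T<N. h T \<notin> W} = prod_emb UNIV (\<lambda>_. step) {..<N} (Pi\<^sub>E {..<N} (\<lambda>_. carrier G - W))"
    unfolding increments_def by (auto simp: prod_emb_def space_PiM PiE_iff extensional_def)
  show "{h \<in> space \<Omega>. \<forall>T<N. h T \<notin> W} \<in> sets \<Omega>"
    unfolding eq unfolding increments_def by (intro sets_PiM_I) (auto simp: sets_step)
  have "emeasure \<Omega> {h \<in> space \<Omega>. \<forall>T<N. h T \<notin> W} = (\<Prod>T<N. emeasure step (carrier G - W))"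
    unfolding eq unfolding increments_def
    by (rule emeasure_PiM_emb) (auto simp: prob_space_step sets_step)
  also have "emeasure step (carrier G - W) = ennreal (1 - measure_pmf.prob \<mu> W)"
  proof -
    have "measure_pmf.prob \<mu> (carrier G - W) = measure_pmf.prob \<mu> (UNIV - W)"
      by (rule measure_pmf.finite_measure_eq_AE) (use supp in \<open>auto simp: AE_measure_pmf_iff\<close>)
    also have "\<dots> = 1 - measure_pmf.prob \<mu> W" using measure_pmf.prob_compl[of W \<mu>] by simp
    finally show ?thesis by (simp add: emeasure_step measure_pmf.emeasure_eq_measure)
  qed
  finally show "increments.prob {h \<in> space \<Omega>. \<forall>T<N. h T \<notin> W} = (1 - measure_pmf.prob \<mu> W) ^ N"
    by (simp add: increments.emeasure_eq_measure ennreal_power)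
qed

text \<open>Markov's inequality for the sum of the step lengths; one such event controls all
  positions of the walk up to time \<open>N\<close>.\<close>

lemma prob_long_walk:
  assumes mean: "(\<integral>\<^sup>+ g. ennreal (len g) \<partial>measure_pmf \<mu>) \<le> ennreal E" and "0 \<le> E" "0 < L"
  shows "{h \<in> space \<Omega>. L \<le> (\<Sum>i<N. len (h i))} \<in> sets \<Omega>"
    and "increments.prob {h \<in> space \<Omega>. L \<le> (\<Sum>i<N. len (h i))} \<le> real N * E / L"
proof -
  have m1: "(\<lambda>h. ennreal (len (h i))) \<in> borel_measurable \<Omega>" for i
    by (rule measurable_compose[OF component_measurable]) simp
  have m2: "(\<lambda>h. len (h i)) \<in> borel_measurable \<Omega>" for i
    by (rule measurable_compose[OF component_measurable]) simp
  note [measurable] = m1 m2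
  show s: "{h \<in> space \<Omega>. L \<le> (\<Sum>i<N. len (h i))} \<in> sets \<Omega>" by measurable
  have int: "(\<integral>\<^sup>+ h. ennreal (len (h i)) \<partial>\<Omega>) \<le> ennreal E" for i
  proof -
    have "(\<integral>\<^sup>+ h. ennreal (len (h i)) \<partial>\<Omega>) = (\<integral>\<^sup>+ g. ennreal (len g) \<partial>distr \<Omega> step (\<lambda>h. h i))"
      by (rule nn_integral_distr[symmetric])
        (auto simp: increments_def intro!: measurable_component_singleton measurable_restrict_space1)
    also have "distr \<Omega> step (\<lambda>h. h i) = step"
      unfolding increments_def by (rule distr_PiM_component) (auto simp: prob_space_step)
    also have "(\<integral>\<^sup>+ g. ennreal (len g) \<partial>step) = (\<integral>\<^sup>+ g. ennreal (len g) * indicator (carrier G) g \<partial>measure_pmf \<mu>)"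
      by (rule nn_integral_restrict_space) simp
    also have "\<dots> \<le> (\<integral>\<^sup>+ g. ennreal (len g) \<partial>measure_pmf \<mu>)"
      by (intro nn_integral_mono) (simp add: indicator_def)
    finally show ?thesis using mean by (rule order_trans)
  qed
  have "{h \<in> space \<Omega>. L \<le> (\<Sum>i<N. len (h i))} = {h \<in> space \<Omega>. 1 \<le> ennreal (1 / L) * (\<Sum>i<N. ennreal (len (h i)))}"
  proof -
    have "(L \<le> (\<Sum>i<N. len (h i))) = (1 \<le> ennreal (1 / L) * (\<Sum>i<N. ennreal (len (h i))))" for h
    proof -
      have "ennreal (1 / L) * (\<Sum>i<N. ennreal (len (h i))) = ennreal ((1 / L) * (\<Sum>i<N. len (h i)))"
        using \<open>0 < L\<close> by (subst sum_ennreal) (auto simp: ennreal_mult[symmetric] sum_nonneg)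
      then show ?thesis using \<open>0 < L\<close> by (simp add: ennreal_1[symmetric] ennreal_le_iff sum_nonneg divide_simps del: ennreal_1)
    qed
    then show ?thesis by blast
  qed
  then have "emeasure \<Omega> {h \<in> space \<Omega>. L \<le> (\<Sum>i<N. len (h i))} \<le> ennreal (1 / L) * (\<integral>\<^sup>+ h. (\<Sum>i<N. ennreal (len (h i))) * indicator (space \<Omega>) h \<partial>\<Omega>)"
    using nn_integral_Markov_inequality[of "\<lambda>h. \<Sum>i<N. ennreal (len (h i))" "space \<Omega>" \<Omega> "ennreal (1 / L)"] by simp
  also have "(\<integral>\<^sup>+ h. (\<Sum>i<N. ennreal (len (h i))) * indicator (space \<Omega>) h \<partial>\<Omega>) = (\<integral>\<^sup>+ h. (\<Sum>i<N. ennreal (len (h i))) \<partial>\<Omega>)"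
    by (rule nn_integral_cong) simp
  also have "\<dots> = (\<Sum>i<N. \<integral>\<^sup>+ h. ennreal (len (h i)) \<partial>\<Omega>)" by (rule nn_integral_sum) measurable
  also have "\<dots> \<le> (\<Sum>i<N. ennreal E)" by (intro sum_mono int)
  also have "\<dots> = ennreal (real N * E)" using \<open>0 \<le> E\<close> by (simp add: ennreal_of_nat_eq_real_of_nat ennreal_mult)
  finally have "emeasure \<Omega> {h \<in> space \<Omega>. L \<le> (\<Sum>i<N. len (h i))} \<le> ennreal (1 / L) * ennreal (real N * E)"
    by (simp add: mult_left_mono)
  also have "\<dots> = ennreal (real N * E / L)" using \<open>0 < L\<close> \<open>0 \<le> E\<close> by (simp add: ennreal_mult[symmetric])
  finally show "increments.prob {h \<in> space \<Omega>. L \<le> (\<Sum>i<N. len (h i))} \<le> real N * E / L"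
    using \<open>0 < L\<close> \<open>0 \<le> E\<close> by (simp add: increments.emeasure_eq_measure)
qed

text \<open>The small Gromov products say that the jump cancels neither with the past nor with the future of
  the walk. The future enters through finite times only, which keeps the event measurable.\<close>

definition clean_jump :: "'g set \<Rightarrow> real \<Rightarrow> nat \<Rightarrow> real \<Rightarrow> (nat \<Rightarrow> 'g) \<Rightarrow> bool" where
  "clean_jump W c N L h \<longleftrightarrow> (\<exists>T<N. h T \<in> W \<and> gp (inv (random_walk G h T)) (h T) < c \<and> len (random_walk G h T) \<le> L \<and>
     (\<forall>n\<^sub>0. \<exists>n\<ge>n\<^sub>0. gp (inv (h T)) (random_walk G (\<lambda>i. h (Suc T + i)) n) < c))"

text \<open>A clean jump is missing only if no step lies in \<open>W\<close>, the steps are too long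
  in total, or a jump cancels with its past or its future. The last two are estimated by
  \<open>resample\<close> at each of the \<open>N\<close> times.\<close>

lemma prob_no_clean_jump:
  assumes W: "finite W" "W \<subseteq> carrier G"
    and past: "\<And>y. y \<in> carrier G \<Longrightarrow> measure_pmf.prob \<mu> {w \<in> W. c \<le> gp y w} \<le> \<epsilon>"
    and future: "\<And>y. y \<in> carrier G \<Longrightarrow> measure_pmf.prob \<mu> {w \<in> W. c \<le> gp (inv w) y} \<le> \<epsilon>"
    and mean: "(\<integral>\<^sup>+ g. ennreal (len g) \<partial>measure_pmf \<mu>) \<le> ennreal E" and "0 \<le> E" "0 < L"
  shows "{h \<in> space \<Omega>. \<not> clean_jump W c N L h} \<in> sets \<Omega>"
    and "increments.prob {h \<in> space \<Omega>. \<not> clean_jump W c N L h}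
       \<le> (1 - measure_pmf.prob \<mu> W) ^ N + 2 * real N * \<epsilon> + real N * E / L"
proof -
  have \<epsilon>: "0 \<le> \<epsilon>" using past[OF one_closed] measure_nonneg order_trans by blast
  define Qp where "Qp T w h \<longleftrightarrow> c \<le> gp (inv (random_walk G h T)) w" for T w h
  \<comment> \<open>The bad event for the future is cancellation at all late times, not at a single
    one.\<close>
  define Qf where "Qf T w h \<longleftrightarrow> (\<exists>n\<^sub>0. \<forall>n\<ge>n\<^sub>0. c \<le> gp (inv w) (random_walk G (\<lambda>i. h (Suc T + i)) n))" for T w h
  have pp: "Measurable.pred \<Omega> (Qp T w)" for T w
    unfolding Qp_def by (rule discrete_pred1[OF walk_measurable0])
  have pf: "Measurable.pred \<Omega> (Qf T w)" for T w
  proof -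
    have [measurable]: "Measurable.pred \<Omega> (\<lambda>h. c \<le> gp (inv w) (random_walk G (\<lambda>i. h (Suc T + i)) n))" for n
      by (rule discrete_pred1[OF walk_measurable])
    show ?thesis unfolding Qf_def by measurable
  qed
  let ?Bp = "\<lambda>T. {h \<in> space \<Omega>. h T \<in> W \<and> Qp T (h T) h}" and ?Bf = "\<lambda>T. {h \<in> space \<Omega>. h T \<in> W \<and> Qf T (h T) h}"
  have Bp: "?Bp T \<in> sets \<Omega>" "increments.prob (?Bp T) \<le> \<epsilon>" for T
  proof -
    have "Qp T w (h(T := x)) = Qp T w h" for w h x by (simp add: Qp_def walk_upd_past)
    moreover have "measure_pmf.prob \<mu> {w \<in> W. Qp T w h} \<le> \<epsilon>" if "h \<in> space \<Omega>" for h
      unfolding Qp_def using past walk_closed0[OF that] by simp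
    ultimately show "?Bp T \<in> sets \<Omega>" "increments.prob (?Bp T) \<le> \<epsilon>"
      using resample[OF W(2), of "Qp T" T \<epsilon>] pp \<epsilon> by blast+
  qed
  have Bf: "?Bf T \<in> sets \<Omega>" "increments.prob (?Bf T) \<le> \<epsilon>" for T
  proof -
    have "Qf T w (h(T := x)) = Qf T w h" for w h x by (simp add: Qf_def)
    moreover have "measure_pmf.prob \<mu> {w \<in> W. Qf T w h} \<le> \<epsilon>" if h: "h \<in> space \<Omega>" for h
    proof -
      have "\<forall>w. \<exists>n\<^sub>0. Qf T w h \<longrightarrow> (\<forall>n\<ge>n\<^sub>0. c \<le> gp (inv w) (random_walk G (\<lambda>i. h (Suc T + i)) n))"
        unfolding Qf_def by blast
      then obtain n0 where n0: "\<And>w n. Qf T w h \<Longrightarrow> n0 w \<le> n \<Longrightarrow> c \<le> gp (inv w) (random_walk G (\<lambda>i. h (Suc T + i)) n)"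
        by metis
      \<comment> \<open>As \<open>W\<close> is finite, one time is late enough for all jumps
        concerned, and \<open>future\<close> applies to the single group element reached
        then.\<close>
      define m where "m = Max (insert 0 (n0 ` W))"
      have m: "n0 w \<le> m" if "w \<in> W" for w unfolding m_def using W(1) that by (intro Max_ge) auto
      have "measure_pmf.prob \<mu> {w \<in> W. Qf T w h} \<le> measure_pmf.prob \<mu> {w \<in> W. c \<le> gp (inv w) (random_walk G (\<lambda>i. h (Suc T + i)) m)}"
        using n0 m by (intro measure_pmf.finite_measure_mono) auto
      also have "\<dots> \<le> \<epsilon>" by (rule future[OF walk_closed[OF h]])
      finally show ?thesis .
    qed
    ultimately show "?Bf T \<in> sets \<Omega>" "increments.prob (?Bf T) \<le> \<epsilon>"
      using resample[OF W(2), of "Qf T" T \<epsilon>] pf \<epsilon> by blast+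
  qed
  let ?N = "{h \<in> space \<Omega>. \<forall>T<N. h T \<notin> W}" and ?L = "{h \<in> space \<Omega>. L \<le> (\<Sum>i<N. len (h i))}"
  have NL: "?N \<in> sets \<Omega>" "?L \<in> sets \<Omega>" by (rule prob_no_jump(1)[OF W(2)], rule prob_long_walk(1)[OF mean \<open>0 \<le> E\<close> \<open>0 < L\<close>])
  have Qf_not: "\<not> Qf T w h \<longleftrightarrow> (\<forall>n\<^sub>0. \<exists>n\<ge>n\<^sub>0. gp (inv w) (random_walk G (\<lambda>i. h (Suc T + i)) n) < c)" for T w h
    unfolding Qf_def by (simp add: not_le)
  have Qp_not: "\<not> Qp T w h \<longleftrightarrow> gp (inv (random_walk G h T)) w < c" for T w h
    unfolding Qp_def by (rule not_le)
  have cj: "clean_jump W c N L h \<longleftrightarrow> (\<exists>T<N. h T \<in> W \<and> \<not> Qp T (h T) h \<and> len (random_walk G h T) \<le> L \<and> \<not> Qf T (h T) h)" for h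
    unfolding clean_jump_def Qp_not Qf_not by (rule refl)
  have sub: "Measurable.pred \<Omega> (\<lambda>h. g \<in> W \<and> \<not> Qp T g h \<and> len (random_walk G h T) \<le> L \<and> \<not> Qf T g h)" for T g
  proof -
    note [measurable] = pp pf
    have [measurable]: "Measurable.pred \<Omega> (\<lambda>h. len (random_walk G h T) \<le> L)"
      by (rule discrete_pred1[OF walk_measurable0])
    show ?thesis by measurable
  qed
  have "Measurable.pred \<Omega> (\<lambda>h. h T \<in> W \<and> \<not> Qp T (h T) h \<and> len (random_walk G h T) \<le> L \<and> \<not> Qf T (h T) h)" for T
    by (rule discrete_pred[where Q = "\<lambda>g h. g \<in> W \<and> \<not> Qp T g h \<and> len (random_walk G h T) \<le> L \<and> \<not> Qf T g h",
        OF component_measurable sub])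
  then have [measurable]: "Measurable.pred \<Omega> (clean_jump W c N L)"
    unfolding cj by measurable
  show "{h \<in> space \<Omega>. \<not> clean_jump W c N L h} \<in> sets \<Omega>" by measurable
  have "{h \<in> space \<Omega>. \<not> clean_jump W c N L h} \<subseteq> ?N \<union> (\<Union>T<N. ?Bp T) \<union> (\<Union>T<N. ?Bf T) \<union> ?L"
  proof
    fix h assume h: "h \<in> {h \<in> space \<Omega>. \<not> clean_jump W c N L h}"
    then have hs: "h \<in> space \<Omega>" by blast
    show "h \<in> ?N \<union> (\<Union>T<N. ?Bp T) \<union> (\<Union>T<N. ?Bf T) \<union> ?L"
    proof (cases "h \<in> ?N \<or> h \<in> ?L")
      case False
      then obtain T where T: "T < N" "h T \<in> W" using hs by blast
      have "(\<Sum>i<T. len (h i)) \<le> (\<Sum>i<N. len (h i))" using T(1) by (intro sum_mono2) auto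
      then have "len (random_walk G h T) \<le> L" using False hs walk_len_le[OF hs, of T] by auto
      then have "Qp T (h T) h \<or> Qf T (h T) h" using h T unfolding cj by blast
      then show ?thesis using T hs by blast
    qed blast
  qed
  then have sub4: "{h \<in> space \<Omega>. \<not> clean_jump W c N L h} \<subseteq> ((?N \<union> (\<Union>T<N. ?Bp T)) \<union> (\<Union>T<N. ?Bf T)) \<union> ?L" .
  have union4: "increments.prob Z \<le> increments.prob X1 + increments.prob X2 + increments.prob X3 + increments.prob X4"
    if "Z \<subseteq> ((X1 \<union> X2) \<union> X3) \<union> X4" "X1 \<in> sets \<Omega>" "X2 \<in> sets \<Omega>" "X3 \<in> sets \<Omega>" "X4 \<in> sets \<Omega>" for Z X1 X2 X3 X4
    using increments.finite_measure_mono[OF that(1)] measure_Un_le[of "(X1 \<union> X2) \<union> X3" \<Omega> X4]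
      measure_Un_le[of "X1 \<union> X2" \<Omega> X3] measure_Un_le[of X1 \<Omega> X2] that(2-5)
    by simp
  have U: "(\<Union>T<N. ?Bp T) \<in> sets \<Omega>" "(\<Union>T<N. ?Bf T) \<in> sets \<Omega>"
    by (rule sets.finite_UN[OF finite_lessThan Bp(1)], rule sets.finite_UN[OF finite_lessThan Bf(1)])
  have finUN: "increments.prob (\<Union>T<N. X T) \<le> real N * \<epsilon>" if "\<And>T. X T \<in> sets \<Omega>" "\<And>T. increments.prob (X T) \<le> \<epsilon>" for X
  proof -
    have "increments.prob (\<Union>T<N. X T) \<le> (\<Sum>T<N. increments.prob (X T))"
      using that(1) by (intro measure_UNION_le) auto
    also have "\<dots> \<le> (\<Sum>T<N. \<epsilon>)" by (intro sum_mono that(2))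
    finally show ?thesis by simp
  qed
  have p: "increments.prob (\<Union>T<N. ?Bp T) \<le> real N * \<epsilon>" by (rule finUN[OF Bp])
  have f: "increments.prob (\<Union>T<N. ?Bf T) \<le> real N * \<epsilon>" by (rule finUN[OF Bf])
  show "increments.prob {h \<in> space \<Omega>. \<not> clean_jump W c N L h}
       \<le> (1 - measure_pmf.prob \<mu> W) ^ N + 2 * real N * \<epsilon> + real N * E / L"
    using union4[OF sub4 NL(1) U NL(2)] p f prob_no_jump(2)[OF W(2), of N] prob_long_walk(2)[OF mean \<open>0 \<le> E\<close> \<open>0 < L\<close>, of N] by linarith
qed

lemma AE_eventually_clean_jump:
  assumes "\<And>j. {h \<in> space \<Omega>. \<not> clean_jump (W j) (c j) (N j) (L j) h} \<in> sets \<Omega>"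
    and "\<And>j::nat. increments.prob {h \<in> space \<Omega>. \<not> clean_jump (W j) (c j) (N j) (L j) h} \<le> 4 * (1 / 2) ^ j"
  shows "AE h in \<Omega>. eventually (\<lambda>j. clean_jump (W j) (c j) (N j) (L j) h) sequentially"
proof -
  have "summable (\<lambda>j. increments.prob {h \<in> space \<Omega>. \<not> clean_jump (W j) (c j) (N j) (L j) h})"
    by (rule summable_comparison_test'[where g = "\<lambda>j. 4 * (1 / 2) ^ j" and N = 0])
      (use assms(2) in \<open>auto intro!: summable_mult summable_geometric\<close>)
  then have "AE h in \<Omega>. eventually (\<lambda>j. h \<in> space \<Omega> - {h \<in> space \<Omega>. \<not> clean_jump (W j) (c j) (N j) (L j) h}) sequentially"
    using assms(1) by (intro borel_cantelli_AE1) (auto simp: increments.emeasure_eq_measure)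
  then show ?thesis by eventually_elim (auto elim: eventually_mono)
qed

end

section \<open>The Cayley graph and its boundary\<close>

context word_metric
begin

abbreviation X :: "('g \<Rightarrow> real) set" where
  "X \<equiv> cayley_graph G S"

abbreviation dX :: "('g \<Rightarrow> real) \<Rightarrow> ('g \<Rightarrow> real) \<Rightarrow> real" where
  "dX \<equiv> cayley_dist G S"

abbreviation supp :: "('g \<Rightarrow> real) \<Rightarrow> 'g set" where
  "supp x \<equiv> {k. x k \<noteq> 0}"

text \<open>Admitting the identity as a label turns vertices into degenerate edges and saves a case
  distinction.\<close>

lemma edge_point_cases:
  assumes "x \<in> X"
  obtains g s t where "g \<in> carrier G" "s \<in> insert \<one> S" "t \<in> {0..1}" "x = edge_point g (g \<otimes> s) t"
proof -
  consider g where "g \<in> carrier G" "x = vertex g"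
    | g s t where "g \<in> carrier G" "s \<in> S" "t \<in> {0..1}" "x = edge_point g (g \<otimes> s) t"
    using assms unfolding cayley_graph_def cayley_edges_def by blast
  then show thesis
  proof cases
    case (1 g)
    then have "x = edge_point g (g \<otimes> \<one>) 0" by (simp add: edge_point_def)
    then show thesis using that[of g \<one> 0] 1 by simp
  next
    case 2
    then show thesis using that by blast
  qed
qed

lemma edge_point_support:
  assumes "g \<in> carrier G" "s \<in> insert \<one> S" "t \<in> {0..1}"
  shows "supp (edge_point g (g \<otimes> s) t) \<subseteq> {g, g \<otimes> s}" "supp (edge_point g (g \<otimes> s) t) \<noteq> {}"
    "0 \<le> edge_point g (g \<otimes> s) t k" "edge_point g (g \<otimes> s) t k \<le> 1"
proof -
  show "supp (edge_point g (g \<otimes> s) t) \<subseteq> {g, g \<otimes> s}" by (auto simp: edge_point_def vertex_def split: if_splits)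
  have "edge_point g (g \<otimes> s) t g \<noteq> 0 \<or> edge_point g (g \<otimes> s) t (g \<otimes> s) \<noteq> 0"
    by (auto simp: edge_point_def vertex_def)
  then show "supp (edge_point g (g \<otimes> s) t) \<noteq> {}" by blast
  show "0 \<le> edge_point g (g \<otimes> s) t k" "edge_point g (g \<otimes> s) t k \<le> 1"
    using assms(3) by (auto simp: edge_point_def vertex_def)
qed

lemma edge_ends_close:
  assumes "g \<in> carrier G" "s \<in> insert \<one> S" "k \<in> {g, g \<otimes> s}" "l \<in> {g, g \<otimes> s}"
  shows "k \<in> carrier G" "wd k l \<le> 1"
proof -
  have s: "s \<in> carrier G" using assms(2) gens_closed by auto
  then show "k \<in> carrier G" using assms by auto
  have "word_length G S s \<le> 1"
    using assms(2) word_length_le[of "[s]" s] s by auto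
  then have "wd g (g \<otimes> s) \<le> 1" using assms(1) s by simp
  moreover have "word_dist G S g (g \<otimes> s) = word_length G S s"
    using wd_mult_right[OF assms(1) s] by (simp del: wd_mult_right)
  ultimately show "wd k l \<le> 1"
    using assms s wd_commute[of "g \<otimes> s" g] word_dist_eq_0[of g g] word_dist_eq_0[of s s] by auto
qed

lemma point_support:
  assumes "x \<in> X"
  shows "finite (supp x)" "supp x \<noteq> {}" "supp x \<subseteq> carrier G" "0 \<le> x k" "x k \<le> 1"
    "k \<in> supp x \<Longrightarrow> l \<in> supp x \<Longrightarrow> wd k l \<le> 1"
proof -
  obtain g s t where x: "g \<in> carrier G" "s \<in> insert \<one> S" "t \<in> {0..1}" "x = edge_point g (g \<otimes> s) t"
    using edge_point_cases[OF assms] .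
  note e = edge_point_support[OF x(1-3)] edge_ends_close[OF x(1,2)]
  show "finite (supp x)" unfolding x(4) using e(1) finite_subset by blast
  show "supp x \<noteq> {}" "0 \<le> x k" "x k \<le> 1" unfolding x(4) using e by blast+
  show "supp x \<subseteq> carrier G" unfolding x(4) using e(1,5) by blast
  show "k \<in> supp x \<Longrightarrow> l \<in> supp x \<Longrightarrow> wd k l \<le> 1" unfolding x(4) using e(1) e(6) by blast
qed

text \<open>An end of an edge through \<open>x\<close>, not necessarily the closest one, as
  everything below holds up to additive constants.\<close>

definition near_vertex :: "('g \<Rightarrow> real) \<Rightarrow> 'g" where
  "near_vertex x = (SOME g. x g \<noteq> 0)"

lemma near_vertex_supp: "x \<in> X \<Longrightarrow> near_vertex x \<in> supp x"
  using point_support(2)[of x] unfolding near_vertex_def by (metis (mono_tags) Collect_empty_eq mem_Collect_eq someI_ex)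

lemma near_vertex_closed: "x \<in> X \<Longrightarrow> near_vertex x \<in> carrier G"
  using near_vertex_supp point_support(3) by blast

lemma near_vertex_dist:
  assumes x: "x \<in> X" and y: "y \<in> X"
  shows "\<bar>dX x y - wd (near_vertex x) (near_vertex y)\<bar> \<le> 2"
proof (cases "\<exists>E\<in>cayley_edges G S. x \<in> E \<and> y \<in> E")
  case True
  then obtain g s p q where g: "g \<in> carrier G" "s \<in> S" "p \<in> {0..1}" "q \<in> {0..1}"
    "x = edge_point g (g \<otimes> s) p" "y = edge_point g (g \<otimes> s) q"
    unfolding cayley_edges_def by blast
  have s: "s \<in> insert \<one> S" using g(2) by simp
  have sub: "{k. x k \<noteq> 0 \<or> y k \<noteq> 0} \<subseteq> {g, g \<otimes> s}"
    using edge_point_support(1)[OF g(1) s g(3)] edge_point_support(1)[OF g(1) s g(4)] unfolding g(5,6) by blast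
  have "(\<Sum>k | x k \<noteq> 0 \<or> y k \<noteq> 0. \<bar>x k - y k\<bar>) \<le> (\<Sum>k | x k \<noteq> 0 \<or> y k \<noteq> 0. 1)"
  proof (rule sum_mono)
    fix k show "\<bar>x k - y k\<bar> \<le> 1"
      using point_support(4,5)[OF x, of k] point_support(4,5)[OF y, of k] by linarith
  qed
  also have "\<dots> = real (card {k. x k \<noteq> 0 \<or> y k \<noteq> 0})" by simp
  also have "\<dots> \<le> real (card {g, g \<otimes> s})" using sub by (intro of_nat_mono card_mono) auto
  also have "\<dots> \<le> 2" by (simp add: card_insert_if)
  finally have "dX x y \<le> 1" "0 \<le> dX x y"
    unfolding cayley_dist_def if_P[OF True] by (auto intro: sum_nonneg)
  moreover have "near_vertex x \<in> {g, g \<otimes> s}" "near_vertex y \<in> {g, g \<otimes> s}"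
    using near_vertex_supp[OF x] near_vertex_supp[OF y] sub by blast+
  then have "wd (near_vertex x) (near_vertex y) \<le> 1" using edge_ends_close(2)[OF g(1) s] by blast
  ultimately show ?thesis by simp
next
  case False
  let ?A = "{(1 - x g) + wd g h + (1 - y h) | g h. x g \<noteq> 0 \<and> y h \<noteq> 0}"
  have "?A = (\<lambda>(g, h). (1 - x g) + wd g h + (1 - y h)) ` (supp x \<times> supp y)" by auto
  then have fin: "finite ?A" using point_support(1) x y by simp
  have nx: "near_vertex x \<in> supp x" and ny: "near_vertex y \<in> supp y" using near_vertex_supp x y by auto
  have el: "(1 - x (near_vertex x)) + wd (near_vertex x) (near_vertex y) + (1 - y (near_vertex y)) \<in> ?A"
    using nx ny by blast
  have "Min ?A \<le> (1 - x (near_vertex x)) + wd (near_vertex x) (near_vertex y) + (1 - y (near_vertex y))"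
    by (rule Min_le[OF fin el])
  then have up: "Min ?A \<le> wd (near_vertex x) (near_vertex y) + 2"
    using point_support(4)[OF x, of "near_vertex x"] point_support(4)[OF y, of "near_vertex y"] by linarith
  have "wd (near_vertex x) (near_vertex y) - 2 \<le> Min ?A"
  proof (rule Min.boundedI[OF fin])
    show "?A \<noteq> {}" using el by blast
    fix e assume "e \<in> ?A"
    then obtain g h where gh: "g \<in> supp x" "h \<in> supp y" "e = (1 - x g) + wd g h + (1 - y h)" by blast
    have c: "g \<in> carrier G" "h \<in> carrier G" "near_vertex x \<in> carrier G" "near_vertex y \<in> carrier G"
      using gh nx ny point_support(3)[OF x] point_support(3)[OF y] by auto
    have "wd (near_vertex x) (near_vertex y) \<le> wd (near_vertex x) g + wd g (near_vertex y)"
      "wd g (near_vertex y) \<le> wd g h + wd h (near_vertex y)" using wd_triangle c by blast+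
    moreover have "wd (near_vertex x) g \<le> 1" "wd h (near_vertex y) \<le> 1"
      using point_support(6)[OF x nx gh(1)] point_support(6)[OF y gh(2) ny] by auto
    ultimately show "wd (near_vertex x) (near_vertex y) - 2 \<le> e"
      using gh(3) point_support(5)[OF x, of g] point_support(5)[OF y, of h] by linarith
  qed
  then show ?thesis using up unfolding cayley_dist_def if_not_P[OF False] by linarith
qed

text \<open>The additive constants are harmless: equivalence of rays asks only for bounded
  distance.\<close>

lemma dX_triangle:
  assumes "x \<in> X" "y \<in> X" "z \<in> X" shows "dX x z \<le> dX x y + dX y z + 6"
  using near_vertex_dist[OF assms(1,2)] near_vertex_dist[OF assms(2,3)] near_vertex_dist[OF assms(1,3)]
    wd_triangle[of "near_vertex x" "near_vertex y" "near_vertex z"] near_vertex_closed assms by force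

lemma dX_commute:
  assumes "x \<in> X" "y \<in> X" shows "dX y x \<le> dX x y + 4"
  using near_vertex_dist[OF assms] near_vertex_dist[OF assms(2,1)]
    wd_commute[of "near_vertex x" "near_vertex y"] near_vertex_closed assms by force

lemma gromov_product_near_vertex:
  assumes "b \<in> X" "x \<in> X" "y \<in> X"
  shows "\<bar>gromov_product dX b x y - gp (near_vertex x) (near_vertex y)\<bar> \<le> len (near_vertex b) + 3"
proof -
  have c: "near_vertex b \<in> carrier G" "near_vertex x \<in> carrier G" "near_vertex y \<in> carrier G"
    using near_vertex_closed assms by auto
  have "gpb \<one> (near_vertex x) (near_vertex y) - len (near_vertex b) \<le> gpb (near_vertex b) (near_vertex x) (near_vertex y)"
    "gpb (near_vertex b) (near_vertex x) (near_vertex y) - len (near_vertex b) \<le> gpb \<one> (near_vertex x) (near_vertex y)"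
    using gpb_change_base[of "near_vertex b" \<one> "near_vertex x" "near_vertex y"]
      gpb_change_base[of \<one> "near_vertex b" "near_vertex x" "near_vertex y"] c by simp_all
  moreover have "\<bar>gromov_product dX b x y - gpb (near_vertex b) (near_vertex x) (near_vertex y)\<bar> \<le> 3"
    using near_vertex_dist[OF assms(1,2)] near_vertex_dist[OF assms(1,3)] near_vertex_dist[OF assms(2,3)]
    unfolding gromov_product_def by argo
  ultimately show ?thesis by argo
qed

lemma point_outside: "x \<in> X \<Longrightarrow> k \<notin> carrier G \<Longrightarrow> x k = 0"
  using point_support(3) by blast

lemma cayley_act_edge_point:
  assumes "g \<in> carrier G" "h \<in> carrier G" "k \<in> carrier G"
  shows "cayley_act G g (edge_point h k t) = edge_point (g \<otimes> h) (g \<otimes> k) t"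
proof
  fix l
  have "cayley_act G g (vertex h) l = vertex (g \<otimes> h) l" "cayley_act G g (vertex k) l = vertex (g \<otimes> k) l"
    using cayley_act_vertex assms by simp_all
  then show "cayley_act G g (edge_point h k t) l = edge_point (g \<otimes> h) (g \<otimes> k) t l"
    by (auto simp: cayley_act_def edge_point_def split: if_splits)
qed

lemma cayley_act_edge:
  assumes "g \<in> carrier G" "E \<in> cayley_edges G S"
  shows "cayley_act G g ` E \<in> cayley_edges G S"
proof -
  obtain h s where E: "E = edge_point h (h \<otimes> s) ` {0..1}" "h \<in> carrier G" "s \<in> S"
    using assms(2) unfolding cayley_edges_def by blast
  have "cayley_act G g ` E = edge_point (g \<otimes> h) ((g \<otimes> h) \<otimes> s) ` {0..1}"
    unfolding E(1) image_image using assms(1) E gens_closed by (simp add: cayley_act_edge_point m_assoc)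
  then show ?thesis unfolding cayley_edges_def using assms(1) E by blast
qed

lemma cayley_act_closed:
  assumes "g \<in> carrier G" "x \<in> X" shows "cayley_act G g x \<in> X"
proof -
  consider h where "h \<in> carrier G" "x = vertex h" | E where "E \<in> cayley_edges G S" "x \<in> E"
    using assms(2) unfolding cayley_graph_def by blast
  then show ?thesis
  proof cases
    case 1
    then show ?thesis using assms(1) cayley_act_vertex unfolding cayley_graph_def by auto
  next
    case 2
    then show ?thesis using cayley_act_edge[OF assms(1) 2(1)] unfolding cayley_graph_def by blast
  qed
qed

lemma cayley_act_apply:
  assumes "g \<in> carrier G" "x \<in> X" "k \<in> carrier G"
  shows "cayley_act G g x (g \<otimes> k) = x k"
  using assms by (simp add: cayley_act_def m_assoc[symmetric])

lemma cayley_act_supp: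
  assumes "g \<in> carrier G" "x \<in> X" shows "supp (cayley_act G g x) = (\<lambda>k. g \<otimes> k) ` supp x"
proof (intro equalityI subsetI)
  fix l assume l: "l \<in> supp (cayley_act G g x)"
  then have "l \<in> carrier G" "inv g \<otimes> l \<in> supp x" by (auto simp: cayley_act_def split: if_splits)
  moreover have "l = g \<otimes> (inv g \<otimes> l)" using \<open>l \<in> carrier G\<close> assms(1) by (simp add: m_assoc[symmetric])
  ultimately show "l \<in> (\<lambda>k. g \<otimes> k) ` supp x" by blast
next
  fix l assume "l \<in> (\<lambda>k. g \<otimes> k) ` supp x"
  then obtain k where k: "k \<in> supp x" "l = g \<otimes> k" by blast
  then have "k \<in> carrier G" using point_support(3)[OF assms(2)] by blast
  then show "l \<in> supp (cayley_act G g x)" using cayley_act_apply[OF assms] k by simp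
qed

lemma cayley_act_inv:
  assumes "g \<in> carrier G" "x \<in> X" shows "cayley_act G (inv g) (cayley_act G g x) = x"
proof
  fix k
  show "cayley_act G (inv g) (cayley_act G g x) k = x k"
    using assms point_outside[OF assms(2), of k] by (auto simp: cayley_act_def m_assoc[symmetric])
qed

lemma cayley_act_isometry:
  assumes g: "g \<in> carrier G" and x: "x \<in> X" and y: "y \<in> X"
  shows "dX (cayley_act G g x) (cayley_act G g y) = dX x y"
proof -
  let ?x = "cayley_act G g x" and ?y = "cayley_act G g y"
  have sx: "supp ?x = (\<lambda>k. g \<otimes> k) ` supp x" and sy: "supp ?y = (\<lambda>k. g \<otimes> k) ` supp y"
    using cayley_act_supp g x y by auto
  have E: "(\<exists>E\<in>cayley_edges G S. ?x \<in> E \<and> ?y \<in> E) \<longleftrightarrow> (\<exists>E\<in>cayley_edges G S. x \<in> E \<and> y \<in> E)"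
  proof
    assume "\<exists>E\<in>cayley_edges G S. ?x \<in> E \<and> ?y \<in> E"
    then obtain E where "E \<in> cayley_edges G S" "?x \<in> E" "?y \<in> E" by blast
    then have "cayley_act G (inv g) ` E \<in> cayley_edges G S" "cayley_act G (inv g) ?x \<in> cayley_act G (inv g) ` E"
      "cayley_act G (inv g) ?y \<in> cayley_act G (inv g) ` E" using cayley_act_edge g by auto
    then show "\<exists>E\<in>cayley_edges G S. x \<in> E \<and> y \<in> E"
      unfolding cayley_act_inv[OF g x] cayley_act_inv[OF g y] by (intro bexI conjI)
  next
    assume "\<exists>E\<in>cayley_edges G S. x \<in> E \<and> y \<in> E"
    then obtain E where "E \<in> cayley_edges G S" "x \<in> E" "y \<in> E" by blast
    then show "\<exists>E\<in>cayley_edges G S. ?x \<in> E \<and> ?y \<in> E"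
      using cayley_act_edge[OF g] by (intro bexI[of _ "cayley_act G g ` E"] conjI imageI)
  qed
  have Sum: "(\<Sum>k | ?x k \<noteq> 0 \<or> ?y k \<noteq> 0. \<bar>?x k - ?y k\<bar>) = (\<Sum>k | x k \<noteq> 0 \<or> y k \<noteq> 0. \<bar>x k - y k\<bar>)"
  proof -
    have u: "{k. x k \<noteq> 0 \<or> y k \<noteq> 0} \<subseteq> carrier G"
      using point_support(3)[OF x] point_support(3)[OF y] unfolding Collect_disj_eq by simp
    have "{k. ?x k \<noteq> 0 \<or> ?y k \<noteq> 0} = (\<lambda>k. g \<otimes> k) ` {k. x k \<noteq> 0 \<or> y k \<noteq> 0}"
      unfolding Collect_disj_eq sx sy by (rule image_Un[symmetric])
    moreover have "inj_on (\<lambda>k. g \<otimes> k) {k. x k \<noteq> 0 \<or> y k \<noteq> 0}" by (rule inj_on_subset[OF inj_on_cmult[OF g] u])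
    ultimately have "(\<Sum>k | ?x k \<noteq> 0 \<or> ?y k \<noteq> 0. \<bar>?x k - ?y k\<bar>)
        = (\<Sum>k | x k \<noteq> 0 \<or> y k \<noteq> 0. \<bar>?x (g \<otimes> k) - ?y (g \<otimes> k)\<bar>)" by (simp add: sum.reindex)
    also have "\<dots> = (\<Sum>k | x k \<noteq> 0 \<or> y k \<noteq> 0. \<bar>x k - y k\<bar>)"
      using u cayley_act_apply[OF g x] cayley_act_apply[OF g y] by (intro sum.cong refl) (auto simp: subset_eq)
    finally show ?thesis .
  qed
  have "{(1 - ?x k) + wd k l + (1 - ?y l) | k l. ?x k \<noteq> 0 \<and> ?y l \<noteq> 0}
      = (\<lambda>(k, l). (1 - ?x k) + wd k l + (1 - ?y l)) ` (supp ?x \<times> supp ?y)" by auto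
  also have "\<dots> = (\<lambda>(k, l). (1 - ?x (g \<otimes> k)) + wd (g \<otimes> k) (g \<otimes> l) + (1 - ?y (g \<otimes> l))) ` (supp x \<times> supp y)"
    unfolding sx sy by force
  also have "\<dots> = (\<lambda>(k, l). (1 - x k) + wd k l + (1 - y l)) ` (supp x \<times> supp y)"
  proof (rule image_cong[OF refl])
    fix kl assume "kl \<in> supp x \<times> supp y"
    then obtain k l where kl: "kl = (k, l)" "k \<in> carrier G" "l \<in> carrier G"
      using point_support(3)[OF x] point_support(3)[OF y] by blast
    then show "(case kl of (k, l) \<Rightarrow> (1 - ?x (g \<otimes> k)) + wd (g \<otimes> k) (g \<otimes> l) + (1 - ?y (g \<otimes> l))) =
        (case kl of (k, l) \<Rightarrow> (1 - x k) + wd k l + (1 - y l))"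
      using cayley_act_apply[OF g x] cayley_act_apply[OF g y] g by simp
  qed
  also have "\<dots> = {(1 - x k) + wd k l + (1 - y l) | k l. x k \<noteq> 0 \<and> y l \<noteq> 0}" by auto
  finally show ?thesis unfolding cayley_dist_def E Sum by (simp only:)
qed

lemma near_vertex_act:
  assumes "g \<in> carrier G" "x \<in> X"
  shows "wd (g \<otimes> near_vertex x) (near_vertex (cayley_act G g x)) \<le> 1"
proof -
  have "g \<otimes> near_vertex x \<in> supp (cayley_act G g x)"
    unfolding cayley_act_supp[OF assms] using near_vertex_supp[OF assms(2)] by blast
  then show ?thesis using point_support(6)[OF cayley_act_closed[OF assms]] near_vertex_supp[OF cayley_act_closed[OF assms]] by blast
qed

section \<open>Geodesic rays and their sequences of vertices\<close>

abbreviation rays :: "(real \<Rightarrow> 'g \<Rightarrow> real) set" where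
  "rays \<equiv> geodesic_rays X dX"

abbreviation Requiv :: "((real \<Rightarrow> 'g \<Rightarrow> real) \<times> (real \<Rightarrow> 'g \<Rightarrow> real)) set" where
  "Requiv \<equiv> ray_equiv X dX"

abbreviation ray_vertices :: "(real \<Rightarrow> 'g \<Rightarrow> real) \<Rightarrow> nat \<Rightarrow> 'g" where
  "ray_vertices c \<equiv> \<lambda>n. near_vertex (c (real n))"

lemma raysD: "c \<in> rays \<Longrightarrow> 0 \<le> t \<Longrightarrow> c t \<in> X" "c \<in> rays \<Longrightarrow> 0 \<le> s \<Longrightarrow> 0 \<le> t \<Longrightarrow> dX (c s) (c t) = \<bar>s - t\<bar>"
  unfolding geodesic_rays_def by auto

lemma quasi_ray_ray_vertices: "c \<in> rays \<Longrightarrow> quasi_ray (ray_vertices c)"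
  unfolding quasi_ray_def
proof (intro conjI allI)
  assume c: "c \<in> rays"
  show "range (ray_vertices c) \<subseteq> carrier G" using raysD(1)[OF c] near_vertex_closed by auto
  fix n m :: nat
  show "\<bar>wd (near_vertex (c (real n))) (near_vertex (c (real m))) - \<bar>real n - real m\<bar>\<bar> \<le> 2"
    using near_vertex_dist[of "c (real n)" "c (real m)"] raysD[OF c] by (simp add: abs_minus_commute)
qed

lemma equiv_Requiv: "equiv rays Requiv"
proof (rule equivI)
  show "Requiv \<subseteq> rays \<times> rays" unfolding ray_equiv_def by auto
  show "refl_on rays Requiv"
    unfolding refl_on_def ray_equiv_def using raysD(2) by (auto intro!: exI[of _ 0])
  show "sym Requiv"
  proof (rule symI)
    fix c c' assume "(c, c') \<in> Requiv"
    then obtain B where c: "c \<in> rays" "c' \<in> rays" and B: "\<And>t. 0 \<le> t \<Longrightarrow> dX (c t) (c' t) \<le> B"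
      unfolding ray_equiv_def by blast
    have "dX (c' t) (c t) \<le> B + 4" if "0 \<le> t" for t
      using dX_commute[of "c t" "c' t"] B[OF that] raysD(1) c that by force
    then show "(c', c) \<in> Requiv" unfolding ray_equiv_def using c by blast
  qed
  show "trans Requiv"
  proof (rule transI)
    fix c1 c2 c3 assume "(c1, c2) \<in> Requiv" "(c2, c3) \<in> Requiv"
    then obtain B B' where c: "c1 \<in> rays" "c2 \<in> rays" "c3 \<in> rays"
      and B: "\<And>t. 0 \<le> t \<Longrightarrow> dX (c1 t) (c2 t) \<le> B" "\<And>t. 0 \<le> t \<Longrightarrow> dX (c2 t) (c3 t) \<le> B'"
      unfolding ray_equiv_def by blast
    have "dX (c1 t) (c3 t) \<le> B + B' + 6" if "0 \<le> t" for t
      using dX_triangle[of "c1 t" "c2 t" "c3 t"] B[OF that] raysD(1) c that by force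
    then show "(c1, c3) \<in> Requiv" unfolding ray_equiv_def using c by blast
  qed
qed

lemma Requiv_gp_ge:
  assumes "(c, c') \<in> Requiv" shows "gp_ge (ray_vertices c) (ray_vertices c') r"
proof -
  obtain B where c: "c \<in> rays" "c' \<in> rays" and B: "\<And>t. 0 \<le> t \<Longrightarrow> dX (c t) (c' t) \<le> B"
    using assms unfolding ray_equiv_def by blast
  have "wd (near_vertex (c (real n))) (near_vertex (c' (real n))) \<le> B + 2" for n :: nat
    using near_vertex_dist[of "c (real n)" "c' (real n)"] B[of "real n"] raysD(1) c by force
  then show ?thesis by (intro bounded_dist_gp_ge[where B = "B + 2"] quasi_ray_ray_vertices c) auto
qed

lemma cayley_act_ray:
  assumes "g \<in> carrier G" "c \<in> rays" shows "(\<lambda>t. cayley_act G g (c t)) \<in> rays"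
proof -
  have "cayley_act G g (c t) \<in> X" if "0 \<le> t" for t
    by (rule cayley_act_closed[OF assms(1) raysD(1)[OF assms(2) that]])
  moreover have "dX (cayley_act G g (c s)) (cayley_act G g (c t)) = \<bar>s - t\<bar>" if "0 \<le> s" "0 \<le> t" for s t
    using cayley_act_isometry[OF assms(1) raysD(1)[OF assms(2) that(1)] raysD(1)[OF assms(2) that(2)]]
      raysD(2)[OF assms(2) that] by simp
  ultimately show ?thesis unfolding geodesic_rays_def by simp
qed

lemma cayley_act_ray_gp_ge:
  assumes "g \<in> carrier G" "c \<in> rays"
  shows "gp_ge (\<lambda>n. g \<otimes> ray_vertices c n) (ray_vertices (\<lambda>t. cayley_act G g (c t))) r"
proof (rule bounded_dist_gp_ge[where B = 1])
  show "quasi_ray (\<lambda>n. g \<otimes> ray_vertices c n)" by (rule quasi_ray_translate[OF quasi_ray_ray_vertices[OF assms(2)] assms(1)])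
  show "quasi_ray (ray_vertices (\<lambda>t. cayley_act G g (c t)))" by (rule quasi_ray_ray_vertices[OF cayley_act_ray[OF assms]])
  show "wd (g \<otimes> ray_vertices c n) (near_vertex (cayley_act G g (c (real n)))) \<le> 1" for n
    by (rule near_vertex_act[OF assms(1)]) (simp add: raysD(1)[OF assms(2)])
qed

end

context hyperbolic_word_metric
begin

lemma gp_ge_Requiv:
  assumes c: "c \<in> rays" "c' \<in> rays" and ge: "\<And>r. gp_ge (ray_vertices c) (ray_vertices c') r"
  shows "(c, c') \<in> Requiv"
proof -
  obtain B where B: "\<And>n. wd (ray_vertices c n) (ray_vertices c' n) \<le> B"
    using gp_ge_bounded_dist[OF quasi_ray_ray_vertices[OF c(1)] quasi_ray_ray_vertices[OF c(2)] ge] by blast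
  have "dX (c t) (c' t) \<le> B + 16" if t: "0 \<le> t" for t
  proof -
    define n where "n = nat \<lfloor>t\<rfloor>"
    have n: "\<bar>t - real n\<bar> \<le> 1" unfolding n_def using t by linarith
    have X: "c t \<in> X" "c (real n) \<in> X" "c' t \<in> X" "c' (real n) \<in> X" using raysD(1) c t by auto
    have "dX (c t) (c (real n)) \<le> 1" "dX (c' (real n)) (c' t) \<le> 1"
      using raysD(2)[OF c(1) t, of "real n"] raysD(2)[OF c(2) _ t, of "real n"] n by auto
    moreover have "dX (c (real n)) (c' (real n)) \<le> B + 2" using near_vertex_dist[OF X(2,4)] B[of n] by linarith
    ultimately show ?thesis using dX_triangle[OF X(1,2,3)] dX_triangle[OF X(2,4,3)] by linarith
  qed
  then show ?thesis unfolding ray_equiv_def using c by blast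
qed

end

section \<open>The boundary of the Cayley graph as an abstract visual boundary\<close>

locale cayley_visual_boundary = hyperbolic_word_metric G S \<delta>
  for G :: "('g, 'm) monoid_scheme" (structure) and S \<delta> +
  fixes b :: "'g \<Rightarrow> real" and a C\<^sub>0 :: real and da :: "('g \<Rightarrow> real) bord \<Rightarrow> ('g \<Rightarrow> real) bord \<Rightarrow> real"
  assumes base_point: "b \<in> X" and a_gt_1: "1 < a" and C0_pos: "0 < C\<^sub>0"
    and metric: "Metric_space (bordification X dX) da"
    and topology: "Metric_space.mtopology (bordification X dX) da = bord_topology X dX b"
    and upper: "\<And>x y. x \<in> bordification X dX \<Longrightarrow> y \<in> bordification X dX \<Longrightarrow>
      da x y \<le> C\<^sub>0 * exp_neg a (ext_gromov_product X dX b x y)"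
    and lower: "\<And>x y. x \<in> cayley_boundary G S \<Longrightarrow> y \<in> cayley_boundary G S \<Longrightarrow>
      inverse C\<^sub>0 * exp_neg a (ext_gromov_product X dX b x y) \<le> da x y"
    and non_elementary: "infinite (cayley_boundary G S) \<or> card (cayley_boundary G S) > 2"
begin

abbreviation bd :: "('g \<Rightarrow> real) bord set" where
  "bd \<equiv> cayley_boundary G S"

definition ray :: "('g \<Rightarrow> real) bord \<Rightarrow> real \<Rightarrow> 'g \<Rightarrow> real" where
  "ray \<xi> = (SOME c. c \<in> rays \<and> \<xi> = Inr (Requiv `` {c}))"

definition rep :: "('g \<Rightarrow> real) bord \<Rightarrow> nat \<Rightarrow> 'g" where
  "rep \<xi> = ray_vertices (ray \<xi>)"

definition bact :: "'g \<Rightarrow> ('g \<Rightarrow> real) bord \<Rightarrow> ('g \<Rightarrow> real) bord" where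
  "bact g \<xi> = Inr (Requiv `` {\<lambda>t. cayley_act G g (ray \<xi> t)})"

lemma ray_props:
  assumes "\<xi> \<in> bd" shows "ray \<xi> \<in> rays" "\<xi> = Inr (Requiv `` {ray \<xi>})"
proof -
  obtain Cl where "\<xi> = Inr Cl" "Cl \<in> rays // Requiv" using assms unfolding hyp_boundary_def by blast
  then have "\<exists>c. c \<in> rays \<and> \<xi> = Inr (Requiv `` {c})" by (auto elim: quotientE)
  then have "ray \<xi> \<in> rays \<and> \<xi> = Inr (Requiv `` {ray \<xi>})" unfolding ray_def by (rule someI_ex)
  then show "ray \<xi> \<in> rays" "\<xi> = Inr (Requiv `` {ray \<xi>})" by auto
qed

lemma class_in_bd: "c \<in> rays \<Longrightarrow> Inr (Requiv `` {c}) \<in> bd"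
  unfolding hyp_boundary_def by (intro imageI quotientI)

lemma ray_class:
  assumes "c \<in> rays" shows "(c, ray (Inr (Requiv `` {c}))) \<in> Requiv"
proof -
  note r = ray_props[OF class_in_bd[OF assms]]
  from r(2) have "Requiv `` {c} = Requiv `` {ray (Inr (Requiv `` {c}))}" by (rule sum.inject(2)[THEN iffD1])
  then show ?thesis by (rule eq_equiv_class[OF _ equiv_Requiv r(1)])
qed

lemma range_ray_vertices: "c \<in> rays \<Longrightarrow> range (ray_vertices c) \<subseteq> carrier G"
  by (drule quasi_ray_ray_vertices) (simp only: quasi_ray_def)

sublocale hyperbolic_boundary G S \<delta> bd rep bact
proof
  show "quasi_ray (rep \<xi>)" if "\<xi> \<in> bd" for \<xi>
    unfolding rep_def by (rule quasi_ray_ray_vertices[OF ray_props(1)[OF that]])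
  show "\<xi> = \<eta>" if "\<xi> \<in> bd" "\<eta> \<in> bd" "\<And>r. gp_ge (rep \<xi>) (rep \<eta>) r" for \<xi> \<eta>
  proof -
    have "(ray \<xi>, ray \<eta>) \<in> Requiv"
      using gp_ge_Requiv[OF ray_props(1)[OF that(1)] ray_props(1)[OF that(2)]] that(3) unfolding rep_def by blast
    then have eq: "Requiv `` {ray \<xi>} = Requiv `` {ray \<eta>}" by (rule equiv_class_eq[OF equiv_Requiv])
    have "\<xi> = Inr (Requiv `` {ray \<xi>})" by (rule ray_props(2)[OF that(1)])
    also have "\<dots> = Inr (Requiv `` {ray \<eta>})" unfolding eq ..
    also have "\<dots> = \<eta>" by (rule ray_props(2)[OF that(2), symmetric])
    finally show ?thesis .
  qed
  show "bact g \<xi> \<in> bd" if "g \<in> carrier G" "\<xi> \<in> bd" for g \<xi>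
    unfolding bact_def by (rule class_in_bd[OF cayley_act_ray[OF that(1) ray_props(1)[OF that(2)]]])
  show "gp_ge (\<lambda>n. g \<otimes> rep \<xi> n) (rep (bact g \<xi>)) r" if g: "g \<in> carrier G" and \<xi>: "\<xi> \<in> bd" for g \<xi> r
  proof -
    let ?c = "\<lambda>t. cayley_act G g (ray \<xi> t)"
    have c: "?c \<in> rays" by (rule cayley_act_ray[OF g ray_props(1)[OF \<xi>]])
    have c': "ray (bact g \<xi>) \<in> rays" unfolding bact_def by (rule ray_props(1)[OF class_in_bd[OF c]])
    have r: "quasi_ray (\<lambda>n. g \<otimes> ray_vertices (ray \<xi>) n)"
      by (rule quasi_ray_translate[OF quasi_ray_ray_vertices[OF ray_props(1)[OF \<xi>]] g])
    have "gp_ge (\<lambda>n. g \<otimes> ray_vertices (ray \<xi>) n) (ray_vertices (ray (bact g \<xi>))) (r + \<delta> - \<delta>)"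
    proof (rule gp_ge_all_trans)
      show "gp_ge (\<lambda>n. g \<otimes> ray_vertices (ray \<xi>) n) (ray_vertices ?c) s" for s
        by (rule cayley_act_ray_gp_ge[OF g ray_props(1)[OF \<xi>]])
      show "gp_ge (ray_vertices ?c) (ray_vertices (ray (bact g \<xi>))) (r + \<delta>)"
        unfolding bact_def by (rule Requiv_gp_ge[OF ray_class[OF c]])
      show "range (\<lambda>n. g \<otimes> ray_vertices (ray \<xi>) n) \<subseteq> carrier G" using r unfolding quasi_ray_def by (rule conjunct1)
    qed (rule range_ray_vertices c c')+
    then show ?thesis unfolding rep_def by simp
  qed
  show "infinite bd \<or> card bd > 2" by (rule non_elementary)
qed

text \<open>The first summand pays for moving the base point to the identity, the \<open>3\<close>
  for replacing three points by vertices.\<close>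

definition \<kappa> :: real where
  "\<kappa> = len (near_vertex b) + 3"

lemma gromov_product_X:
  "x \<in> X \<Longrightarrow> y \<in> X \<Longrightarrow> gp (near_vertex x) (near_vertex y) - \<kappa> \<le> gromov_product dX b x y"
  "x \<in> X \<Longrightarrow> y \<in> X \<Longrightarrow> gromov_product dX b x y - \<kappa> \<le> gp (near_vertex x) (near_vertex y)"
  using gromov_product_near_vertex[OF base_point, of x y] unfolding \<kappa>_def by linarith+

lemma range_near_vertex: "(\<And>n. xs n \<in> X) \<Longrightarrow> range (\<lambda>n. near_vertex (xs n)) \<subseteq> carrier G"
  using near_vertex_closed by blast

lemma seq_converges_gp_ge:
  assumes xs: "\<And>n. xs n \<in> X" and \<xi>: "\<xi> \<in> bd" and conv: "seq_converges dX b xs \<xi>"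
  shows "gp_ge (\<lambda>n. near_vertex (xs n)) (rep \<xi>) r"
proof -
  have e: "seq_converges dX b xs (Inr (Requiv `` {ray \<xi>}))"
    using conv by (subst (asm) ray_props(2)[OF \<xi>])
  then obtain c where c: "(ray \<xi>, c) \<in> Requiv"
    and lim: "filterlim (\<lambda>(n, m). gromov_product dX b (xs n) (c (real m))) at_top (sequentially \<times>\<^sub>F sequentially)"
    unfolding seq_converges_def by auto
  have cr: "c \<in> rays" using c unfolding ray_equiv_def by blast
  have c': "(c, ray \<xi>) \<in> Requiv" using c equiv_Requiv by (meson equivE symE)
  have "gp_ge (\<lambda>n. near_vertex (xs n)) (rep \<xi>) (r + \<delta> - \<delta>)"
    unfolding rep_def
  proof (rule gp_ge_all_trans)
    fix R
    have "eventually (\<lambda>(n, m). R + \<kappa> \<le> gromov_product dX b (xs n) (c (real m))) (sequentially \<times>\<^sub>F sequentially)"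
      using lim unfolding filterlim_at_top by (auto simp: case_prod_beta')
    then obtain N where N: "\<And>n m. N \<le> n \<Longrightarrow> N \<le> m \<Longrightarrow> R + \<kappa> \<le> gromov_product dX b (xs n) (c (real m))"
      unfolding eventually_prod_sequentially by auto
    show "gp_ge (\<lambda>n. near_vertex (xs n)) (ray_vertices c) R"
    proof (rule gp_geI)
      fix n m assume "N \<le> n" "N \<le> m"
      from N[OF this] show "R \<le> gp (near_vertex (xs n)) (near_vertex (c (real m)))"
        using gromov_product_X(2)[OF xs raysD(1)[OF cr], of "real m" n] by simp
    qed
  next
    show "gp_ge (ray_vertices c) (ray_vertices (ray \<xi>)) (r + \<delta>)" by (rule Requiv_gp_ge[OF c'])
  qed (rule range_near_vertex xs range_ray_vertices cr ray_props(1)[OF \<xi>])+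
  then show ?thesis by simp
qed

lemma ray_seq_converges:
  assumes \<xi>: "\<xi> \<in> bd" shows "seq_converges dX b (\<lambda>n. ray \<xi> (real n)) \<xi>"
proof -
  have r: "ray \<xi> \<in> rays" by (rule ray_props(1)[OF \<xi>])
  have "filterlim (\<lambda>(n, m). gromov_product dX b (ray \<xi> (real n)) (ray \<xi> (real m))) at_top (sequentially \<times>\<^sub>F sequentially)"
    unfolding filterlim_at_top
  proof
    fix Z
    have "gp_ge (rep \<xi>) (rep \<xi>) (Z + \<kappa>)" using rep_gromov_seq[OF \<xi>] by (simp add: gromov_seq_def)
    then obtain N where N: "\<And>n m. N \<le> n \<Longrightarrow> N \<le> m \<Longrightarrow> Z + \<kappa> \<le> gp (rep \<xi> n) (rep \<xi> m)" unfolding gp_ge_def by blast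
    have "Z \<le> gromov_product dX b (ray \<xi> (real n)) (ray \<xi> (real m))" if "N \<le> n" "N \<le> m" for n m
      using N[OF that] gromov_product_X(1)[OF raysD(1)[OF r] raysD(1)[OF r], of "real n" "real m"] by (simp add: rep_def)
    then show "eventually (\<lambda>x. Z \<le> (case x of (n, m) \<Rightarrow> gromov_product dX b (ray \<xi> (real n)) (ray \<xi> (real m)))) (sequentially \<times>\<^sub>F sequentially)"
      unfolding eventually_prod_sequentially by auto
  qed
  moreover have "ray \<xi> \<in> Requiv `` {ray \<xi>}" using r equiv_class_self[OF equiv_Requiv] by blast
  ultimately have "seq_converges dX b (\<lambda>n. ray \<xi> (real n)) (Inr (Requiv `` {ray \<xi>}))"
    unfolding seq_converges_def by auto
  then show ?thesis by (subst (2) ray_props(2)[OF \<xi>])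
qed

lemma ext_gromov_product_ge:
  assumes "\<And>xs ys. (\<And>n. xs n \<in> X) \<Longrightarrow> (\<And>n. ys n \<in> X) \<Longrightarrow> seq_converges dX b xs \<xi> \<Longrightarrow> seq_converges dX b ys \<eta> \<Longrightarrow>
    gp_ge (\<lambda>n. near_vertex (xs n)) (\<lambda>n. near_vertex (ys n)) r"
  shows "ereal (r - \<kappa>) \<le> ext_gromov_product X dX b \<xi> \<eta>"
  unfolding ext_gromov_product_def
proof (rule Inf_greatest)
  fix l assume "l \<in> {liminf (\<lambda>n. ereal (gromov_product dX b (xs n) (ys n))) | xs ys.
            (\<forall>n. xs n \<in> X \<and> ys n \<in> X) \<and> seq_converges dX b xs \<xi> \<and> seq_converges dX b ys \<eta>}"
  then obtain xs ys where l: "l = liminf (\<lambda>n. ereal (gromov_product dX b (xs n) (ys n)))"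
    and xy: "\<And>n. xs n \<in> X" "\<And>n. ys n \<in> X" "seq_converges dX b xs \<xi>" "seq_converges dX b ys \<eta>" by blast
  obtain N where N: "\<And>n m. N \<le> n \<Longrightarrow> N \<le> m \<Longrightarrow> r \<le> gp (near_vertex (xs n)) (near_vertex (ys m))"
    using assms[OF xy] unfolding gp_ge_def by blast
  show "ereal (r - \<kappa>) \<le> l"
    unfolding l
  proof (rule Liminf_bounded)
    have "ereal (r - \<kappa>) \<le> ereal (gromov_product dX b (xs n) (ys n))" if "N \<le> n" for n
      using N[OF that that] gromov_product_X(1)[OF xy(1,2), of n n] by simp
    then show "eventually (\<lambda>n. ereal (r - \<kappa>) \<le> ereal (gromov_product dX b (xs n) (ys n))) sequentially"
      unfolding eventually_sequentially by blast
  qed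
qed

lemma exp_neg_le:
  assumes "ereal r \<le> t" shows "exp_neg a t \<le> a powr (- r)"
proof (cases t)
  case (real s)
  then show ?thesis using assms a_gt_1 by (simp add: exp_neg_def powr_mono)
qed (use assms in \<open>auto simp: exp_neg_def\<close>)

lemma ext_gromov_product_bd_ge:
  assumes "\<xi> \<in> bd" "\<eta> \<in> bd" "gp_ge (rep \<xi>) (rep \<eta>) r"
  shows "ereal (r - 2 * \<delta> - \<kappa>) \<le> ext_gromov_product X dX b \<xi> \<eta>"
proof (rule ext_gromov_product_ge)
  fix xs ys assume xs: "\<And>n. xs n \<in> X" and ys: "\<And>n. ys n \<in> X"
    and conv: "seq_converges dX b xs \<xi>" "seq_converges dX b ys \<eta>"
  note rng = range_near_vertex[OF xs] range_near_vertex[OF ys] rep_range[OF assms(1)] rep_range[OF assms(2)]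
  have "gp_ge (\<lambda>n. near_vertex (xs n)) (rep \<eta>) (r - \<delta>)"
    by (rule gp_ge_all_trans[OF seq_converges_gp_ge[OF xs assms(1) conv(1)] assms(3)]) (rule rng)+
  then have "gp_ge (\<lambda>n. near_vertex (xs n)) (\<lambda>n. near_vertex (ys n)) (min (r - \<delta>) (r - \<delta>) - \<delta>)"
    by (rule gp_ge_trans[OF _ gp_ge_commute[OF seq_converges_gp_ge[OF ys assms(2) conv(2)]]]) (rule rng)+
  then show "gp_ge (\<lambda>n. near_vertex (xs n)) (\<lambda>n. near_vertex (ys n)) (r - 2 * \<delta>)" by simp
qed

text \<open>The chosen rays compete in the infimum, so a large extended product makes their products
  large at equal late times. If \<open>gp_ge\<close> failed, \<open>not_gp_geD\<close> would make
  these products small.\<close>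

lemma gp_ge_of_ext:
  assumes "\<xi> \<in> bd" "\<eta> \<in> bd" "ereal (r + 2 * \<delta> + \<kappa>) < ext_gromov_product X dX b \<xi> \<eta>"
  shows "gp_ge (rep \<xi>) (rep \<eta>) r"
proof (rule ccontr)
  assume "\<not> ?thesis"
  then obtain N where N: "\<And>n m. N \<le> n \<Longrightarrow> N \<le> m \<Longrightarrow> gp (rep \<xi> n) (rep \<eta> m) < r + 2 * \<delta>"
    using not_gp_geD rep_gromov_seq assms(1,2) by metis
  have r: "ray \<xi> (real n) \<in> X" "ray \<eta> (real n) \<in> X" for n :: nat
    using raysD(1) ray_props(1) assms(1,2) by simp_all
  have "ext_gromov_product X dX b \<xi> \<eta> \<le> liminf (\<lambda>n. ereal (gromov_product dX b (ray \<xi> (real n)) (ray \<eta> (real n))))"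
    unfolding ext_gromov_product_def
    by (rule Inf_lower, rule CollectI, intro exI[of _ "\<lambda>n. ray \<xi> (real n)"] exI[of _ "\<lambda>n. ray \<eta> (real n)"] conjI allI)
      (rule refl r ray_seq_converges assms(1,2))+
  with assms(3) have "ereal (r + 2 * \<delta> + \<kappa>) < liminf (\<lambda>n. ereal (gromov_product dX b (ray \<xi> (real n)) (ray \<eta> (real n))))"
    by (rule order.strict_trans2)
  then have "eventually (\<lambda>n. ereal (r + 2 * \<delta> + \<kappa>) < ereal (gromov_product dX b (ray \<xi> (real n)) (ray \<eta> (real n)))) sequentially"
    by (rule less_LiminfD)
  then obtain M where M: "\<And>n. M \<le> n \<Longrightarrow> r + 2 * \<delta> + \<kappa> < gromov_product dX b (ray \<xi> (real n)) (ray \<eta> (real n))"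
    unfolding eventually_sequentially by auto
  show False
    using N[of "max N M" "max N M"] M[of "max N M"] gromov_product_X(2)[OF r(1) r(2), of "max N M" "max N M"]
    by (simp add: rep_def)
qed

definition C :: real where
  "C = C\<^sub>0 * a powr (2 * \<delta> + \<kappa>)"

lemma C_pos: "0 < C"
  using C0_pos a_gt_1 by (simp add: C_def)

lemma bd_subset: "bd \<subseteq> bordification X dX"
  by (simp add: bordification_def)

lemma Inl_bordification: "x \<in> X \<Longrightarrow> Inl x \<in> bordification X dX"
  by (simp add: bordification_def)

sublocale visual_boundary G S \<delta> bd rep bact da a C
proof (intro visual_boundary.intro visual_boundary_axioms.intro)
  show "hyperbolic_boundary G S \<delta> bd rep bact" by (rule hyperbolic_boundary_axioms)
  show "Metric_space bd da" by (rule Metric_space.subspace[OF metric bd_subset])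
  show "1 < a" "0 < C" by (rule a_gt_1, rule C_pos)
  show "da \<xi> \<eta> \<le> C * a powr (- r)" if "\<xi> \<in> bd" "\<eta> \<in> bd" "gp_ge (rep \<xi>) (rep \<eta>) r" for \<xi> \<eta> r
  proof -
    have "da \<xi> \<eta> \<le> C\<^sub>0 * exp_neg a (ext_gromov_product X dX b \<xi> \<eta>)" using upper bd_subset that by blast
    also have "\<dots> \<le> C\<^sub>0 * a powr (- (r - 2 * \<delta> - \<kappa>))"
      using exp_neg_le[OF ext_gromov_product_bd_ge[OF that]] C0_pos by (intro mult_left_mono) auto
    also have "\<dots> = C * a powr (- r)" by (simp add: C_def powr_add[symmetric] mult.assoc algebra_simps)
    finally show ?thesis .
  qed
  show "gp_ge (rep \<xi>) (rep \<eta>) r" if \<xi>: "\<xi> \<in> bd" and \<eta>: "\<eta> \<in> bd" and d: "da \<xi> \<eta> < a powr (- r) / C" for \<xi> \<eta> r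
  proof (rule gp_ge_of_ext[OF \<xi> \<eta>], rule ccontr)
    let ?e = "ext_gromov_product X dX b \<xi> \<eta>"
    assume "\<not> ereal (r + 2 * \<delta> + \<kappa>) < ?e"
    then have le: "?e \<le> ereal (r + 2 * \<delta> + \<kappa>)" by simp
    \<comment> \<open>The trivial threshold \<open>0\<close> excludes the value
      \<open>-\<infinity>\<close> of the extended product, at which \<open>exp_neg\<close> would be
      \<open>1\<close>.\<close>
    have "gp_ge (rep \<xi>) (rep \<eta>) 0"
      by (rule gp_geI[of 0]) (use gpb_nonneg rep_closed \<xi> \<eta> in blast)
    then have "ereal (0 - 2 * \<delta> - \<kappa>) \<le> ?e" by (rule ext_gromov_product_bd_ge[OF \<xi> \<eta>])
    then obtain e where e: "?e = ereal e" using le by (cases ?e) auto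
    have "a powr (- (r + 2 * \<delta> + \<kappa>)) \<le> exp_neg a ?e"
      using le a_gt_1 unfolding e by (simp add: exp_neg_def powr_mono)
    also have "\<dots> \<le> C\<^sub>0 * da \<xi> \<eta>" using lower[OF \<xi> \<eta>] C0_pos by (simp add: field_simps)
    also have "\<dots> < C\<^sub>0 * (a powr (- r) / C)" using d C0_pos by (intro mult_strict_left_mono)
    also have "\<dots> = a powr (- r) / a powr (2 * \<delta> + \<kappa>)" using C0_pos by (simp add: C_def)
    also have "\<dots> = a powr (- (r + 2 * \<delta> + \<kappa>))" by (simp add: powr_diff[symmetric] algebra_simps)
    finally show False by simp
  qed
qed

text \<open>Of two distinct boundary points at least one avoids the shadow of \<open>inv y\<close>
  at a fixed level, and \<open>y\<close> maps it into the shadow of \<open>y\<close>.\<close>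

lemma visibility:
  "\<exists>c. \<forall>y\<in>carrier G. \<exists>\<eta>\<in>bd. \<eta> \<in> shadow y (len y - c)"
proof -
  obtain \<xi> where \<xi>: "\<xi> \<in> bd" using third_point by blast
  obtain \<eta> where \<eta>: "\<eta> \<in> bd" "\<eta> \<noteq> \<xi>" using third_point by blast
  then obtain r where r: "\<not> gp_ge (rep \<xi>) (rep \<eta>) r" using rep_eqI \<xi> by blast
  have "\<exists>\<zeta>\<in>bd. \<zeta> \<in> shadow y (len y - (r + \<delta> + 2 * \<delta>))" if y: "y \<in> carrier G" for y
  proof -
    have "\<exists>\<zeta>\<in>{\<xi>, \<eta>}. \<zeta> \<notin> shadow (inv y) (r + \<delta>)"
    proof (rule ccontr)
      assume "\<not> ?thesis"
      then have 1: "gp_ge (\<lambda>_. inv y) (rep \<xi>) (r + \<delta>)" "gp_ge (\<lambda>_. inv y) (rep \<eta>) (r + \<delta>)"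
        by (auto simp: shadow_def)
      have iy: "range (\<lambda>_::nat. inv y) \<subseteq> carrier G" using y by auto
      have "gp_ge (rep \<xi>) (rep \<eta>) (min (r + \<delta>) (r + \<delta>) - \<delta>)"
        by (rule gp_ge_trans[OF gp_ge_commute[OF 1(1)] 1(2)]) (rule iy rep_range[OF \<xi>] rep_range[OF \<eta>(1)])+
      then show False using r by simp
    qed
    then obtain \<zeta> where \<zeta>: "\<zeta> \<in> bd" "\<zeta> \<notin> shadow (inv y) (r + \<delta>)" using \<xi> \<eta> by blast
    have "bact y \<zeta> \<in> shadow y (len y - (r + \<delta>) - 2 * \<delta>)" by (rule act_in_shadow[OF y \<zeta>])
    moreover have "bact y \<zeta> \<in> bd" by (rule act_closed[OF y \<zeta>(1)])
    ultimately show ?thesis by (intro bexI[of _ "bact y \<zeta>"]) (simp_all add: algebra_simps)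
  qed
  then show ?thesis by blast
qed

lemma orbit_near:
  assumes y: "y \<in> carrier G" and xs: "\<And>n. xs n \<in> X" and conv: "seq_converges dX b xs (Inl (cayley_act G y b))"
  shows "\<exists>N. \<forall>n\<ge>N. wd y (near_vertex (xs n)) \<le> len (near_vertex b) + 4"
proof -
  have yb: "cayley_act G y b \<in> X" by (rule cayley_act_closed[OF y base_point])
  have "(\<lambda>n. dX (xs n) (cayley_act G y b)) \<longlonglongrightarrow> 0" using conv by (simp add: seq_converges_def)
  then have "eventually (\<lambda>n. dX (xs n) (cayley_act G y b) < 1) sequentially" by (rule order_tendstoD) simp
  then obtain N where N: "\<And>n. N \<le> n \<Longrightarrow> dX (xs n) (cayley_act G y b) < 1" unfolding eventually_sequentially by auto
  have "wd y (near_vertex (xs n)) \<le> len (near_vertex b) + 4" if "N \<le> n" for n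
  proof -
    let ?v = "near_vertex (cayley_act G y b)" and ?w = "near_vertex (xs n)" and ?b = "near_vertex b"
    have c: "?v \<in> carrier G" "?w \<in> carrier G" "?b \<in> carrier G" using near_vertex_closed yb xs base_point by auto
    have yb': "y \<otimes> ?b \<in> carrier G" using y c by simp
    have "wd ?w ?v \<le> 3" using near_vertex_dist[OF xs[of n] yb] N[OF that] by linarith
    moreover have "wd (y \<otimes> ?b) ?v \<le> 1" by (rule near_vertex_act[OF y base_point])
    moreover have "wd y (y \<otimes> ?b) = len ?b" by (rule wd_mult_right[OF y c(3)])
    moreover have "wd y ?w \<le> wd y (y \<otimes> ?b) + wd (y \<otimes> ?b) ?w" by (rule wd_triangle[OF y yb' c(2)])
    moreover have "wd (y \<otimes> ?b) ?w \<le> wd (y \<otimes> ?b) ?v + wd ?v ?w" by (rule wd_triangle[OF yb' c(1,2)])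
    moreover have "wd ?v ?w = wd ?w ?v" by (rule wd_commute[OF c(1,2)])
    ultimately show ?thesis by linarith
  qed
  then show ?thesis by blast
qed

lemma da_orbit_le:
  assumes y: "y \<in> carrier G" and \<eta>: "\<eta> \<in> shadow y r"
  shows "da (Inl (cayley_act G y b)) \<eta> \<le> C\<^sub>0 * a powr (- (r - (len (near_vertex b) + 4) - \<delta> - \<kappa>))"
proof -
  have bd: "\<eta> \<in> bd" and g: "gp_ge (\<lambda>_. y) (rep \<eta>) r" using \<eta> by (auto simp: shadow_def)
  define q where "q = len (near_vertex b) + 4"
  have "ereal (r - q - \<delta> - \<kappa>) \<le> ext_gromov_product X dX b (Inl (cayley_act G y b)) \<eta>"
  proof (rule ext_gromov_product_ge)
    fix xs ys assume xs: "\<And>n. xs n \<in> X" and ys: "\<And>n. ys n \<in> X"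
      and conv: "seq_converges dX b xs (Inl (cayley_act G y b))" "seq_converges dX b ys \<eta>"
    obtain N where N: "\<And>n. N \<le> n \<Longrightarrow> wd y (near_vertex (xs n)) \<le> q"
      using orbit_near[OF y xs conv(1)] unfolding q_def by blast
    have yr: "range (\<lambda>_::nat. y) \<subseteq> carrier G" using y by auto
    have "gp_ge (\<lambda>_. y) (\<lambda>n. near_vertex (ys n)) (min r r - \<delta>)"
      by (rule gp_ge_trans[OF g gp_ge_commute[OF seq_converges_gp_ge[OF ys bd conv(2)]]])
        (rule yr rep_range[OF bd] range_near_vertex ys)+
    then obtain M where M: "\<And>m::nat. M \<le> m \<Longrightarrow> r - \<delta> \<le> gp y (near_vertex (ys m))" unfolding gp_ge_def by auto
    show "gp_ge (\<lambda>n. near_vertex (xs n)) (\<lambda>n. near_vertex (ys n)) (r - q - \<delta>)"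
    proof (rule gp_geI[of "max N M"])
      fix n m assume nm: "max N M \<le> n" "max N M \<le> m"
      have c: "near_vertex (xs n) \<in> carrier G" "near_vertex (ys m) \<in> carrier G" using near_vertex_closed xs ys by auto
      have "gp (near_vertex (ys m)) y - wd (near_vertex (xs n)) y \<le> gp (near_vertex (ys m)) (near_vertex (xs n))"
        by (rule gp_change_right[OF c(2,1) y])
      then show "r - q - \<delta> \<le> gp (near_vertex (xs n)) (near_vertex (ys m))"
        using N[of n] M[of m] nm gp_commute[OF c(2) y] gp_commute[OF c] wd_commute[OF c(1) y] by simp
    qed
  qed
  then have "exp_neg a (ext_gromov_product X dX b (Inl (cayley_act G y b)) \<eta>) \<le> a powr (- (r - q - \<delta> - \<kappa>))"
    by (rule exp_neg_le)
  then have "C\<^sub>0 * exp_neg a (ext_gromov_product X dX b (Inl (cayley_act G y b)) \<eta>) \<le> C\<^sub>0 * a powr (- (r - q - \<delta> - \<kappa>))"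
    using C0_pos by (intro mult_left_mono) auto
  moreover have "da (Inl (cayley_act G y b)) \<eta> \<le> C\<^sub>0 * exp_neg a (ext_gromov_product X dX b (Inl (cayley_act G y b)) \<eta>)"
    by (rule upper) (use Inl_bordification[OF cayley_act_closed[OF y base_point]] bd bd_subset in auto)
  ultimately show ?thesis unfolding q_def by linarith
qed

text \<open>The metric controls the Gromov product from below only on the boundary, so an orbit point is
  first replaced by a boundary point in its shadow.\<close>

lemma orbit_converges_gp_ge:
  assumes x: "\<And>n. x n \<in> carrier G" and \<xi>: "\<xi> \<in> bd"
    and lim: "limitin (bord_topology X dX b) (\<lambda>n. Inl (cayley_act G (x n) b)) \<xi> sequentially"
  shows "gp_ge x (rep \<xi>) r"
proof -
  interpret B: Metric_space "bordification X dX" da by (rule metric)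
  let ?p = "\<lambda>y. Inl (cayley_act G y b) :: ('g \<Rightarrow> real) bord"
  have p: "?p y \<in> bordification X dX" if "y \<in> carrier G" for y
    by (rule Inl_bordification[OF cayley_act_closed[OF that base_point]])
  have \<xi>B: "\<xi> \<in> bordification X dX" using \<xi> bd_subset by blast
  have near: "eventually (\<lambda>n. da (?p (x n)) \<xi> < \<epsilon>) sequentially" if "0 < \<epsilon>" for \<epsilon>
    using lim that unfolding topology[symmetric] B.limitin_metric by (auto elim: eventually_mono)
  \<comment> \<open>A ball contains finitely many group elements, and their orbit points are all
    different from the boundary point \<open>\<xi>\<close>.\<close>
  have large: "eventually (\<lambda>n. R < len (x n)) sequentially" for R
  proof -
    let ?F = "{y \<in> carrier G. len y \<le> R}"
    define \<epsilon> where "\<epsilon> = Min (insert 1 ((\<lambda>y. da (?p y) \<xi>) ` ?F))"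
    have "0 < da (?p y) \<xi>" if "y \<in> carrier G" for y
    proof -
      have "?p y \<noteq> \<xi>" using \<xi> unfolding hyp_boundary_def by auto
      then show ?thesis using B.mdist_pos_less[OF _ p[OF that] \<xi>B] by blast
    qed
    then have "0 < \<epsilon>" unfolding \<epsilon>_def using finite_ball by (subst Min_gr_iff) auto
    from near[OF this] show ?thesis
    proof eventually_elim
      case (elim n)
      show ?case
      proof (rule ccontr)
        assume "\<not> R < len (x n)"
        then have "\<epsilon> \<le> da (?p (x n)) \<xi>" unfolding \<epsilon>_def using finite_ball x by (intro Min_le) auto
        then show False using elim by simp
      qed
    qed
  qed
  obtain c where c: "\<And>y. y \<in> carrier G \<Longrightarrow> \<exists>\<eta>\<in>bd. \<eta> \<in> shadow y (len y - c)" using visibility by blast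
  define r1 where "r1 = r + 3 * \<delta>"
  define \<epsilon> where "\<epsilon> = a powr (- r1) / C / 2"
  have \<epsilon>: "0 < \<epsilon>" using a_gt_1 C_pos by (simp add: \<epsilon>_def)
  define q where "q = len (near_vertex b) + 4 + \<delta> + \<kappa>"
  \<comment> \<open>The first entry puts the shadow level \<open>len (x n) - c\<close> above
    \<open>r1\<close>; the second lets \<open>da_orbit_le\<close> bound the distance from the orbit
    point to the boundary point in its shadow by \<open>\<epsilon>\<close>.\<close>
  define R where "R = max (r1 + c) (c + q - log a (\<epsilon> / C\<^sub>0))"
  obtain N1 where N1: "\<And>n. N1 \<le> n \<Longrightarrow> da (?p (x n)) \<xi> < \<epsilon>" using near[OF \<epsilon>] unfolding eventually_sequentially by blast
  obtain N2 where N2: "\<And>n. N2 \<le> n \<Longrightarrow> R < len (x n)" using large[of R] unfolding eventually_sequentially by blast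
  have "gp_ge (rep \<xi>) (rep \<xi>) r1" using rep_gromov_seq[OF \<xi>] by (simp add: gromov_seq_def)
  then obtain M where M: "\<And>n m. M \<le> n \<Longrightarrow> M \<le> m \<Longrightarrow> r1 \<le> gp (rep \<xi> n) (rep \<xi> m)" unfolding gp_ge_def by blast
  show ?thesis
  proof (rule gp_geI[of "max (max N1 N2) M"])
    fix n m assume nm: "max (max N1 N2) M \<le> n" "max (max N1 N2) M \<le> m"
    obtain \<eta> where \<eta>: "\<eta> \<in> bd" "\<eta> \<in> shadow (x n) (len (x n) - c)" using c[OF x] by blast
    have lenR: "R < len (x n)" using N2 nm by simp
    have "da (?p (x n)) \<eta> \<le> C\<^sub>0 * a powr (- (len (x n) - c - (len (near_vertex b) + 4) - \<delta> - \<kappa>))"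
      by (rule da_orbit_le[OF x \<eta>(2)])
    also have "\<dots> \<le> C\<^sub>0 * a powr (log a (\<epsilon> / C\<^sub>0))"
      using lenR a_gt_1 C0_pos unfolding R_def q_def by (intro mult_left_mono powr_mono) auto
    also have "\<dots> = \<epsilon>" using a_gt_1 C0_pos \<epsilon> by simp
    finally have 1: "da (?p (x n)) \<eta> \<le> \<epsilon>" .
    have 2: "da (?p (x n)) \<xi> < \<epsilon>" using N1 nm by simp
    have "da \<eta> \<xi> \<le> da \<eta> (?p (x n)) + da (?p (x n)) \<xi>"
      by (rule B.triangle) (use \<eta>(1) bd_subset p[OF x] \<xi>B in auto)
    then have "da \<eta> \<xi> < a powr (- r1) / C" using 1 2 B.commute[of \<eta> "?p (x n)"] by (simp add: \<epsilon>_def)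
    then have g: "gp_ge (rep \<eta>) (rep \<xi>) r1" by (rule gp_ge_of_da[OF \<eta>(1) \<xi>])
    have "gp_ge (\<lambda>_. x n) (rep \<eta>) r1"
      using \<eta>(2) lenR unfolding shadow_def R_def by (auto intro: gp_ge_mono)
    then have "gp_ge (\<lambda>_. x n) (rep \<xi>) (min r1 r1 - \<delta>)"
      by (rule gp_ge_trans[OF _ g]) (use x rep_range \<eta>(1) \<xi> in auto)
    then obtain K where K: "\<And>k::nat. K \<le> k \<Longrightarrow> r1 - \<delta> \<le> gp (x n) (rep \<xi> k)" unfolding gp_ge_def by auto
    have "min (r1 - \<delta>) r1 - \<delta> \<le> gp (x n) (rep \<xi> m)"
      by (rule gp_hyperbolicD[OF K[of "max K M"] M[of "max K M" m]]) (use nm x rep_closed[OF \<xi>] in auto)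
    then show "r \<le> gp (x n) (rep \<xi> m)" using delta_nonneg by (simp add: r1_def)
  qed
qed

end

section \<open>Mixtures of jumps of all scales\<close>

text \<open>Non-measurable sets have \<open>emeasure\<close> zero, so a non-measurable map and a probability measure
  never yield a push-forward that is a measure.\<close>

lemma distr_not_measurable:
  assumes M: "prob_space M" and into: "\<And>x. x \<in> space M \<Longrightarrow> f x \<in> space N" and f: "f \<notin> measurable M N"
  shows "emeasure (distr M N f) B = 0"
proof (rule ccontr)
  interpret prob_space M by (rule M)
  let ?\<mu> = "\<lambda>A. emeasure M (f -` A \<inter> space M)"
  assume "emeasure (distr M N f) B \<noteq> 0"
  then have ms: "measure_space (space N) (sets N) ?\<mu>"
    unfolding distr_def emeasure_measure_of_conv by (auto simp: sets.sigma_sets_eq split: if_splits)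
  obtain A where A: "A \<in> sets N" "f -` A \<inter> space M \<notin> sets M"
    using f into unfolding measurable_def by auto
  have c: "f -` (space N - A) \<inter> space M = space M - (f -` A \<inter> space M)" using into by auto
  have "space M - (f -` A \<inter> space M) \<notin> sets M"
  proof
    assume "space M - (f -` A \<inter> space M) \<in> sets M"
    then have "space M - (space M - (f -` A \<inter> space M)) \<in> sets M" by blast
    moreover have "space M - (space M - (f -` A \<inter> space M)) = f -` A \<inter> space M" by blast
    ultimately show False using A(2) by simp
  qed
  then have 0: "?\<mu> A = 0" "?\<mu> (space N - A) = 0"
    using A(2) unfolding c by (simp_all add: emeasure_notin_sets)
  have "additive (sets N) ?\<mu>"
    using ms sets.countably_additive_additive[of N ?\<mu>] unfolding measure_space_def by blast
  then have "?\<mu> (A \<union> (space N - A)) = ?\<mu> A + ?\<mu> (space N - A)"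
    using A(1) by (intro additiveD) auto
  moreover have "f -` (A \<union> (space N - A)) \<inter> space M = space M" using into by auto
  ultimately show False using 0 emeasure_space_1 by simp
qed

context word_metric
begin

lemma pmf_inv_eq:
  assumes "map_pmf (\<lambda>w. inv w) \<mu> = \<mu>" "set_pmf \<mu> \<subseteq> carrier G" "g \<in> carrier G"
  shows "pmf \<mu> (inv g) = pmf \<mu> g"
proof -
  have "pmf \<mu> (inv g) = measure_pmf.prob \<mu> ((\<lambda>w. inv w) -` {inv g})"
    using assms(1) by (metis pmf_map)
  also have "\<dots> = measure_pmf.prob \<mu> {g}"
  proof (rule measure_pmf.finite_measure_eq_AE)
    have "inv w = inv g \<longleftrightarrow> w = g" if "w \<in> set_pmf \<mu>" for w
      using that assms(2,3) by (metis inv_inv subsetD)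
    then show "AE w in measure_pmf \<mu>. w \<in> (\<lambda>w. inv w) -` {inv g} \<longleftrightarrow> w \<in> {g}" by (simp add: AE_measure_pmf_iff)
  qed auto
  finally show ?thesis by (simp add: measure_pmf_single)
qed

lemma first_moment_summable:
  assumes b: "b \<in> X" and mean: "(\<integral>\<^sup>+ g. ennreal (len g) \<partial>measure_pmf \<mu>) \<le> ennreal E" and E: "0 \<le> E"
  shows "(\<lambda>g. pmf \<mu> g * dX b (cayley_act G g b)) summable_on carrier G"
proof -
  define q where "q = 2 * len (near_vertex b) + 3"
  have vb: "near_vertex b \<in> carrier G" using near_vertex_closed b by blast
  have bound: "\<bar>dX b (cayley_act G g b)\<bar> \<le> len g + q" if g: "g \<in> carrier G" for g
  proof -
    let ?v = "near_vertex b" and ?w = "near_vertex (cayley_act G g b)"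
    have c: "?w \<in> carrier G" "g \<otimes> ?v \<in> carrier G"
      using near_vertex_closed[OF cayley_act_closed[OF g b]] g vb by auto
    have "wd ?v ?w \<le> wd ?v \<one> + wd \<one> ?w" by (rule wd_triangle) (use vb c in auto)
    moreover have "wd \<one> ?w \<le> wd \<one> (g \<otimes> ?v) + wd (g \<otimes> ?v) ?w" by (rule wd_triangle) (use vb c in auto)
    moreover have "wd (g \<otimes> ?v) ?w \<le> 1" by (rule near_vertex_act[OF g b])
    moreover have "len (g \<otimes> ?v) \<le> len g + len ?v" by (rule len_mult[OF g vb])
    ultimately have "wd ?v ?w \<le> len g + 2 * len ?v + 1" using vb c(2) by simp
    then show ?thesis using near_vertex_dist[OF b cayley_act_closed[OF g b]] unfolding q_def by linarith
  qed
  have q: "0 \<le> q" by (simp add: q_def)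
  have "(\<lambda>g. pmf \<mu> g * (len g + q)) summable_on carrier G"
  proof (rule nonneg_bdd_above_summable_on)
    show "bdd_above (sum (\<lambda>g. pmf \<mu> g * (len g + q)) ` {F. F \<subseteq> carrier G \<and> finite F})"
    proof (rule bdd_aboveI2)
      fix F assume F: "F \<in> {F. F \<subseteq> carrier G \<and> finite F}"
      have "ennreal (\<Sum>g\<in>F. pmf \<mu> g * (len g + q)) = (\<Sum>g\<in>F. ennreal (len g + q) * ennreal (pmf \<mu> g))"
      proof (subst sum_ennreal[symmetric])
        show "(\<Sum>g\<in>F. ennreal (pmf \<mu> g * (len g + q))) = (\<Sum>g\<in>F. ennreal (len g + q) * ennreal (pmf \<mu> g))"
        proof (rule sum.cong[OF refl])
          fix g
          have "ennreal ((len g + q) * pmf \<mu> g) = ennreal (len g + q) * ennreal (pmf \<mu> g)"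
            by (rule ennreal_mult) (use q in auto)
          then show "ennreal (pmf \<mu> g * (len g + q)) = ennreal (len g + q) * ennreal (pmf \<mu> g)"
            by (simp only: mult.commute)
        qed
      qed (use q in auto)
      also have "\<dots> = (\<Sum>g\<in>F. (ennreal (len g + q) * indicator F g) * ennreal (pmf \<mu> g))"
        by (intro sum.cong) auto
      also have "\<dots> = (\<integral>\<^sup>+ g. ennreal (len g + q) * indicator F g \<partial>measure_pmf \<mu>)"
        by (rule nn_integral_measure_pmf_support[symmetric]) (use F in auto)
      also have "\<dots> \<le> (\<integral>\<^sup>+ g. ennreal (len g) + ennreal q \<partial>measure_pmf \<mu>)"
        using q by (intro nn_integral_mono) (auto simp: indicator_def)
      also have "\<dots> = (\<integral>\<^sup>+ g. ennreal (len g) \<partial>measure_pmf \<mu>) + ennreal q"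
        by (subst nn_integral_add) auto
      also have "\<dots> \<le> ennreal (E + q)" using mean q E by (simp add: add_right_mono)
      finally show "(\<Sum>g\<in>F. pmf \<mu> g * (len g + q)) \<le> E + q" using q E by (simp add: ennreal_le_iff del: ennreal_plus)
    qed
  qed (use q in auto)
  then have "(\<lambda>g. norm (pmf \<mu> g * (len g + q))) summable_on carrier G" using q by simp
  then have "(\<lambda>g. norm (pmf \<mu> g * dX b (cayley_act G g b))) summable_on carrier G"
  proof (rule Infinite_Sum.abs_summable_on_comparison_test)
    fix g assume "g \<in> carrier G"
    then show "norm (pmf \<mu> g * dX b (cayley_act G g b)) \<le> norm (pmf \<mu> g * (len g + q))"
      using bound[of g] q by (simp add: abs_mult mult_left_mono)
  qed
  then show ?thesis by (rule abs_summable_summable)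
qed

lemma generate_support:
  assumes "S \<subseteq> A" "A \<subseteq> carrier G" shows "generate G A = carrier G"
proof
  show "generate G A \<subseteq> carrier G" by (rule generate_incl[OF assms(2)])
  show "carrier G \<subseteq> generate G A" using mono_generate[OF assms(1)] generate_gens by simp
qed

text \<open>Short steps whose support generates the group. The identity keeps the set nonempty even
  for empty \<open>S\<close>.\<close>

definition lazy_gens :: "'g pmf" where
  "lazy_gens = pmf_of_set (insert \<one> S)"

lemma set_lazy_gens: "set_pmf lazy_gens = insert \<one> S"
  unfolding lazy_gens_def using finite_gens by (intro set_pmf_of_set) auto

lemma lazy_gens_sym: "map_pmf (\<lambda>w. inv w) lazy_gens = lazy_gens"
  unfolding lazy_gens_def
proof (rule map_pmf_of_set_bij_betw)
  show "bij_betw (\<lambda>w. inv w) (insert \<one> S) (insert \<one> S)"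
    by (rule bij_betw_byWitness[of _ "\<lambda>w. inv w"]) (use gens_closed gens_inv in auto)
qed (use finite_gens in auto)

lemma lazy_gens_len: "w \<in> set_pmf lazy_gens \<Longrightarrow> word_length G S w \<le> 1"
  unfolding set_lazy_gens using word_length_le[of "[w]" w] gens_closed by fastforce

text \<open>At scale \<open>j\<close>, which is chosen with probability \<open>2\<^sup>-\<^sup>j\<^sup>-\<^sup>1\<close>, a jump of law \<open>\<rho> j\<close> and length of
  order \<open>l j\<close> is made with probability \<open>1 / l j\<close>, so that every scale contributes a bounded amount to the
  first moment.\<close>

definition jump_mixture :: "(nat \<Rightarrow> 'g pmf) \<Rightarrow> (nat \<Rightarrow> nat) \<Rightarrow> 'g pmf" where
  "jump_mixture \<rho> l = bind_pmf (geometric_pmf (1 / 2))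
     (\<lambda>j. bind_pmf (bernoulli_pmf (1 / real (l j))) (\<lambda>t. if t then \<rho> j else lazy_gens))"

context
  fixes \<rho> :: "nat \<Rightarrow> 'g pmf" and l k :: "nat \<Rightarrow> nat"
  assumes \<rho>_closed: "\<And>j. set_pmf (\<rho> j) \<subseteq> carrier G"
    and \<rho>_len: "\<And>j w. w \<in> set_pmf (\<rho> j) \<Longrightarrow> k j \<le> word_length G S w \<and> word_length G S w \<le> l j"
    and \<rho>_sym: "\<And>j. map_pmf (\<lambda>w. inv w) (\<rho> j) = \<rho> j"
    and k_ge: "\<And>j. 2 \<le> k j" and kl: "\<And>j. k j \<le> l j" and lk: "\<And>j. l j < k (Suc j)"
begin

lemma jump_rate: "0 < 1 / real (l j)" "1 / real (l j) < 1"
  using k_ge[of j] kl[of j] by simp_all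

lemma set_jump_mixture: "set_pmf (jump_mixture \<rho> l) = insert \<one> S \<union> (\<Union>j. set_pmf (\<rho> j))"
proof -
  have "set_pmf (bind_pmf (bernoulli_pmf (1 / real (l j))) (\<lambda>t. if t then \<rho> j else lazy_gens)) = set_pmf (\<rho> j) \<union> insert \<one> S" for j
    using jump_rate[of j] by (simp add: set_pmf_bernoulli UNIV_bool set_lazy_gens Un_commute)
  then show ?thesis unfolding jump_mixture_def by (simp add: set_pmf_geometric) blast
qed

lemma jump_mixture_closed: "set_pmf (jump_mixture \<rho> l) \<subseteq> carrier G"
  unfolding set_jump_mixture using \<rho>_closed gens_closed by auto

lemma jump_mixture_sym: "map_pmf (\<lambda>w. inv w) (jump_mixture \<rho> l) = jump_mixture \<rho> l"
  unfolding jump_mixture_def map_bind_pmf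
  by (intro bind_pmf_cong refl) (simp add: \<rho>_sym lazy_gens_sym)

lemma jump_mixture_mean: "(\<integral>\<^sup>+ g. ennreal (len g) \<partial>measure_pmf (jump_mixture \<rho> l)) \<le> ennreal 2"
proof -
  have 1: "(\<integral>\<^sup>+ g. ennreal (len g) \<partial>measure_pmf (\<rho> j)) \<le> ennreal (real (l j))" for j
  proof -
    have "(\<integral>\<^sup>+ g. ennreal (len g) \<partial>measure_pmf (\<rho> j)) \<le> (\<integral>\<^sup>+ g. ennreal (real (l j)) \<partial>measure_pmf (\<rho> j))"
      using \<rho>_len[of _ j] by (intro nn_integral_mono_AE) (auto simp: AE_measure_pmf_iff intro!: ennreal_leI)
    then show ?thesis by simp
  qed
  have 2: "(\<integral>\<^sup>+ g. ennreal (len g) \<partial>measure_pmf lazy_gens) \<le> ennreal 1"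
  proof -
    have "(\<integral>\<^sup>+ g. ennreal (len g) \<partial>measure_pmf lazy_gens) \<le> (\<integral>\<^sup>+ g. ennreal 1 \<partial>measure_pmf lazy_gens)"
      using lazy_gens_len by (intro nn_integral_mono_AE) (auto simp: AE_measure_pmf_iff intro!: ennreal_leI)
    then show ?thesis by simp
  qed
  have "(\<integral>\<^sup>+ g. ennreal (len g) \<partial>measure_pmf (bind_pmf (bernoulli_pmf (1 / real (l j))) (\<lambda>t. if t then \<rho> j else lazy_gens))) \<le> ennreal 2" for j
  proof -
    let ?q = "1 / real (l j)"
    have "(\<integral>\<^sup>+ g. ennreal (len g) \<partial>measure_pmf (bind_pmf (bernoulli_pmf ?q) (\<lambda>t. if t then \<rho> j else lazy_gens)))
        = (\<integral>\<^sup>+ g. ennreal (len g) \<partial>measure_pmf (\<rho> j)) * ennreal ?q + (\<integral>\<^sup>+ g. ennreal (len g) \<partial>measure_pmf lazy_gens) * ennreal (1 - ?q)"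
      using jump_rate[of j] by (subst nn_integral_bind_pmf) (simp add: nn_integral_bernoulli_pmf)
    also have "\<dots> \<le> ennreal (real (l j)) * ennreal ?q + ennreal 1 * ennreal (1 - ?q)"
      by (intro add_mono mult_right_mono 1 2) auto
    also have "\<dots> = ennreal (real (l j) * ?q + (1 - ?q))"
    proof -
      have "ennreal (real (l j)) * ennreal ?q = ennreal (real (l j) * ?q)" by (rule ennreal_mult[symmetric]) auto
      moreover have "ennreal (real (l j) * ?q) + ennreal (1 - ?q) = ennreal (real (l j) * ?q + (1 - ?q))"
        by (rule ennreal_plus[symmetric]) (use jump_rate[of j] in auto)
      ultimately show ?thesis by (simp only: ennreal_1 mult_1_left)
    qed
    also have "\<dots> \<le> ennreal 2" using jump_rate[of j] by (intro ennreal_leI) (auto simp: divide_simps)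
    finally show ?thesis .
  qed
  then have "(\<integral>\<^sup>+ g. ennreal (len g) \<partial>measure_pmf (jump_mixture \<rho> l)) \<le> (\<integral>\<^sup>+ j. ennreal 2 \<partial>measure_pmf (geometric_pmf (1 / 2)))"
    unfolding jump_mixture_def by (subst nn_integral_bind_pmf) (intro nn_integral_mono, simp)
  then show ?thesis by simp
qed

text \<open>The length intervals from \<open>k j\<close> to \<open>l j\<close> are disjoint, so a
  jump reveals its scale.\<close>

lemma scales_disjoint:
  assumes "w \<in> set_pmf (\<rho> i)" "w \<in> set_pmf (\<rho> j)" shows "i = j"
proof -
  have step: "l i < k j" if "i < j" for i j
    using that
  proof (induction j)
    case (Suc j)
    have "l j < k (Suc j)" by (rule lk)
    then show ?case using Suc kl[of j] by (cases "i = j") auto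
  qed simp
  have "\<not> i < j" "\<not> j < i" using step[of i j] step[of j i] \<rho>_len[OF assms(1)] \<rho>_len[OF assms(2)] by linarith+
  then show ?thesis by simp
qed

text \<open>Only scale \<open>j\<close> can produce such a jump: other scales have other lengths,
  and generators are shorter than \<open>2\<close>. The factor is the weight of the scale times its
  jump rate.\<close>

lemma prob_jump_mixture:
  "measure_pmf.prob (jump_mixture \<rho> l) {w \<in> set_pmf (\<rho> j). Q w} =
     1 / (2 ^ Suc j * real (l j)) * measure_pmf.prob (\<rho> j) {w. Q w}"
proof -
  let ?B = "{w \<in> set_pmf (\<rho> j). Q w}" and ?q = "\<lambda>j. 1 / real (l j)"
  have \<rho>0: "emeasure (measure_pmf (\<rho> i)) ?B = 0" if "i \<noteq> j" for i
    using scales_disjoint that by (intro AE_iff_measurable[THEN iffD1, of _ _ "\<lambda>w. w \<notin> ?B"]) (auto simp: AE_measure_pmf_iff)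
  have base0: "emeasure (measure_pmf lazy_gens) ?B = 0"
  proof (intro AE_iff_measurable[THEN iffD1, of _ _ "\<lambda>w. w \<notin> ?B"])
    show "AE w in measure_pmf lazy_gens. w \<notin> ?B"
      using lazy_gens_len \<rho>_len[of _ j] k_ge[of j] by (fastforce simp: AE_measure_pmf_iff)
  qed auto
  have inner: "emeasure (measure_pmf (bind_pmf (bernoulli_pmf (?q i)) (\<lambda>t. if t then \<rho> i else lazy_gens))) ?B
      = emeasure (measure_pmf (\<rho> j)) ?B * ennreal (?q j) * indicator {j} i" for i
    using jump_rate[of i] \<rho>0[of i] base0
    by (simp add: emeasure_bind_pmf nn_integral_bernoulli_pmf indicator_def)
  have "emeasure (measure_pmf (jump_mixture \<rho> l)) ?B = (\<integral>\<^sup>+ i. emeasure (measure_pmf (\<rho> j)) ?B * ennreal (?q j) * indicator {j} i \<partial>measure_pmf (geometric_pmf (1 / 2)))"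
    unfolding jump_mixture_def by (subst emeasure_bind_pmf) (simp only: inner)
  also have "\<dots> = emeasure (measure_pmf (\<rho> j)) ?B * ennreal (?q j) * emeasure (measure_pmf (geometric_pmf (1 / 2))) {j}"
    by (rule nn_integral_cmult_indicator) simp
  also have "\<dots> = ennreal (measure_pmf.prob (\<rho> j) ?B * ?q j * (1 / 2 ^ Suc j))"
    by (simp add: measure_pmf.emeasure_eq_measure ennreal_mult[symmetric] measure_pmf_single power_one_over)
  finally have "measure_pmf.prob (jump_mixture \<rho> l) ?B = measure_pmf.prob (\<rho> j) ?B * ?q j * (1 / 2 ^ Suc j)"
    by (simp add: measure_pmf.emeasure_eq_measure)
  moreover have "measure_pmf.prob (\<rho> j) ?B = measure_pmf.prob (\<rho> j) {w. Q w}"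
    by (rule measure_pmf.finite_measure_eq_AE) (auto simp: AE_measure_pmf_iff)
  ultimately show ?thesis by simp
qed

lemma prob_jump_mixture_scale: "measure_pmf.prob (jump_mixture \<rho> l) (set_pmf (\<rho> j)) = 1 / (2 ^ Suc j * real (l j))"
  using prob_jump_mixture[of j "\<lambda>_. True"] by simp

text \<open>The expected number of jumps in \<open>N\<close> steps is \<open>2 ^ j\<close>, so none
  occurs with probability at most \<open>exp (- (2 ^ j))\<close>. Cancellation costs
  \<open>2 * 2 ^ j / 4 ^ j\<close>, and \<open>L\<close> is \<open>2 ^ j\<close> times the bound
  \<open>2 * N\<close> on the expected total length.\<close>

lemma prob_no_clean_jump_mixture:
  fixes c :: real
  assumes fin: "finite (set_pmf (\<rho> j))"
    and spread: "\<And>y. y \<in> carrier G \<Longrightarrow> measure_pmf.prob (\<rho> j) {w. c \<le> gp y w} \<le> 1 / 4 ^ j"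
    and N: "N = 2 ^ j * (2 ^ Suc j * l j)" and L: "L = 2 ^ j * (2 * real N)"
  shows "{h \<in> space (increments G (jump_mixture \<rho> l)). \<not> random_increments.clean_jump G S (set_pmf (\<rho> j)) c N L h} \<in> sets (increments G (jump_mixture \<rho> l))"
    and "measure (increments G (jump_mixture \<rho> l)) {h \<in> space (increments G (jump_mixture \<rho> l)). \<not> random_increments.clean_jump G S (set_pmf (\<rho> j)) c N L h} \<le> 4 * (1 / 2) ^ j"
proof -
  interpret random_increments G S "jump_mixture \<rho> l"
    by unfold_locales (rule jump_mixture_closed)
  define p where "p = 1 / (2 ^ Suc j * real (l j))"
  have lj: "0 < real (l j)" using k_ge[of j] kl[of j] by simp
  have p: "0 < p" "p \<le> 1" unfolding p_def using lj k_ge[of j] kl[of j]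
    by (auto simp: divide_simps intro!: mult_ge1_I one_le_power) 
  have past: "measure_pmf.prob (jump_mixture \<rho> l) {w \<in> set_pmf (\<rho> j). c \<le> gp y w} \<le> p * (1 / 4 ^ j)" if "y \<in> carrier G" for y
    unfolding prob_jump_mixture p_def[symmetric] using spread[OF that] p by (intro mult_left_mono) auto
  \<comment> \<open>Symmetry of \<open>\<rho> j\<close> reduces cancellation with the future to
    cancellation with the past.\<close>
  have sym: "measure_pmf.prob (\<rho> j) {w. c \<le> gp (inv w) y} \<le> 1 / 4 ^ j" if y: "y \<in> carrier G" for y
  proof -
    have "measure_pmf.prob (\<rho> j) {w. c \<le> gp (inv w) y} = measure_pmf.prob (map_pmf (\<lambda>w. inv w) (\<rho> j)) {w. c \<le> gp w y}"
      by (simp add: vimage_def)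
    also have "\<dots> = measure_pmf.prob (\<rho> j) {w. c \<le> gp w y}" by (simp only: \<rho>_sym)
    also have "\<dots> = measure_pmf.prob (\<rho> j) {w. c \<le> gp y w}"
      by (rule measure_pmf.finite_measure_eq_AE) (use \<rho>_closed y gp_commute in \<open>auto simp: AE_measure_pmf_iff subset_eq\<close>)
    finally show ?thesis using spread[OF y] by simp
  qed
  have future: "measure_pmf.prob (jump_mixture \<rho> l) {w \<in> set_pmf (\<rho> j). c \<le> gp (inv w) y} \<le> p * (1 / 4 ^ j)" if "y \<in> carrier G" for y
    unfolding prob_jump_mixture p_def[symmetric] using sym[OF that] p by (intro mult_left_mono) auto
  have Npos: "0 < real N" unfolding N using lj by simp
  have Np: "real N * p = 2 ^ j" unfolding N p_def using lj by simp
  have Lpos: "0 < L" unfolding L using Npos by simp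
  note * = prob_no_clean_jump[OF fin \<rho>_closed past future jump_mixture_mean _ Lpos, of N]
  show "{h \<in> space \<Omega>. \<not> clean_jump (set_pmf (\<rho> j)) c N L h} \<in> sets \<Omega>" by (rule *(1)) simp_all
  have "increments.prob {h \<in> space \<Omega>. \<not> clean_jump (set_pmf (\<rho> j)) c N L h}
      \<le> (1 - p) ^ N + 2 * real N * (p * (1 / 4 ^ j)) + real N * 2 / L"
    using *(2) unfolding prob_jump_mixture_scale p_def[symmetric] by simp
  also have "(1 - p) ^ N \<le> (1 / 2) ^ j"
  proof -
    have "(1 - p) ^ N \<le> exp (- p) ^ N" using p exp_ge_add_one_self[of "- p"] by (intro power_mono) auto
    also have "\<dots> = exp (- (2 ^ j))" unfolding Np[symmetric] by (simp add: exp_of_nat_mult[symmetric])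
    also have "\<dots> = 1 / exp (2 ^ j)" by (simp add: exp_minus inverse_eq_divide)
    also have "\<dots> \<le> 1 / 2 ^ j"
    proof -
      have "(2::real) ^ j \<le> exp (2 ^ j)" using exp_ge_add_one_self[of "2 ^ j"] by linarith
      then show ?thesis by (intro divide_left_mono) auto
    qed
    finally show ?thesis by (simp add: power_one_over)
  qed
  also have "2 * real N * (p * (1 / 4 ^ j)) = 2 * (1 / 2) ^ j"
  proof -
    have "2 * real N * (p * (1 / 4 ^ j)) = 2 * (real N * p) / 4 ^ j" by simp
    also have "\<dots> = 2 * (2 ^ j / 4 ^ j)" unfolding Np by simp
    also have "(2::real) ^ j / 4 ^ j = (1 / 2) ^ j" by (simp add: power_divide[symmetric])
    finally show ?thesis .
  qed
  also have "real N * 2 / L = (1 / 2) ^ j" unfolding L using Npos by (simp add: power_one_over)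
  finally show "increments.prob {h \<in> space \<Omega>. \<not> clean_jump (set_pmf (\<rho> j)) c N L h} \<le> 4 * (1 / 2) ^ j"
    by simp
qed

end

end

section \<open>Singularity of the harmonic measure\<close>

lemma exponential_beats_linear:
  fixes a D K A c B s :: real
  assumes "1 < a" "0 < D"
  shows "(\<lambda>k::nat. K * (A * (real k + c) + 1) * B * a powr (D * (s - real k))) \<longlonglongrightarrow> 0"
proof -
  define E where "E = D * ln a"
  have E: "0 < E" using assms by (simp add: E_def)
  have 1: "((\<lambda>x::real. (x + c) * exp (- E * x)) \<longlongrightarrow> 0) at_top" using E by real_asymp
  have 2: "((\<lambda>x::real. exp (- E * x)) \<longlongrightarrow> 0) at_top" using E by real_asymp
  have lim: "((\<lambda>x::real. K * B * exp (E * s) * (A * ((x + c) * exp (- E * x)) + exp (- E * x))) \<longlongrightarrow> K * B * exp (E * s) * (A * 0 + 0)) at_top"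
    by (intro tendsto_intros 1 2)
  have eq: "K * B * exp (E * s) * (A * ((x + c) * exp (- E * x)) + exp (- E * x)) = K * (A * (x + c) + 1) * B * a powr (D * (s - x))" for x
  proof -
    have "a powr (D * (s - x)) = exp (E * s) * exp (- E * x)"
      using assms by (simp add: powr_def E_def exp_add[symmetric] algebra_simps)
    then show ?thesis by (simp add: algebra_simps)
  qed
  have "((\<lambda>x::real. K * (A * (x + c) + 1) * B * a powr (D * (s - x))) \<longlongrightarrow> 0) at_top"
    using lim unfolding eq by (simp only: mult_zero_right add_0)
  then show ?thesis by (rule filterlim_compose[OF _ filterlim_real_sequentially])
qed

section \<open>Shadows of clean jumps\<close>

context hyperbolic_word_metric
begin

text \<open>Seen from \<open>y \<otimes> w\<close>, the way back starts along \<open>inv w\<close>,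
  because \<open>w\<close> is long and hardly cancels with \<open>y\<close>. The future
  \<open>z\<close> soon leaves \<open>inv w\<close>, hence also the whole way back.\<close>

lemma no_cancellation:
  assumes y: "y \<in> carrier G" and w: "w \<in> carrier G" and z: "z \<in> carrier G"
    and past: "gp (inv y) w < c" and future: "gp (inv w) z < c" and long: "2 * c + \<delta> \<le> len w"
  shows "len y + len w - 3 * c - \<delta> \<le> gp (y \<otimes> w) (y \<otimes> w \<otimes> z)"
proof -
  have iy: "inv y \<in> carrier G" and iw: "inv w \<in> carrier G" and yw: "y \<otimes> w \<in> carrier G"
    and iwy: "inv w \<otimes> inv y \<in> carrier G" using y w by auto
  have "wd (inv y) w = len (y \<otimes> w)" using y w by (simp add: word_dist_def)
  then have l: "len y + len w - 2 * c < len (y \<otimes> w)"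
    using past y w by (simp add: gp_def)
  have "gp (inv w) (inv w \<otimes> inv y) = len w - gp w (inv y)"
    using gp_mult_right[OF iw iy] w by simp
  then have "len w - c < gp (inv w) (inv w \<otimes> inv y)" using past gp_commute[OF w iy] by simp
  moreover have "min (gp (inv w) (inv w \<otimes> inv y)) (gp (inv w \<otimes> inv y) z) - \<delta> \<le> gp (inv w) z"
    by (rule gp_hyperbolic[OF iw iwy z])
  ultimately have "gp (inv w \<otimes> inv y) z < c + \<delta>" using future long by linarith
  moreover have "gp (y \<otimes> w) (y \<otimes> w \<otimes> z) = len (y \<otimes> w) - gp (inv (y \<otimes> w)) z"
    by (rule gp_mult_right[OF yw z])
  moreover have "inv (y \<otimes> w) = inv w \<otimes> inv y" using y w by (rule inv_mult_group)
  ultimately show ?thesis using l by simp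
qed

end

context cayley_visual_boundary
begin

text \<open>One late time suffices: there the future does not cancel with the jump, so the walk has
  a large product with \<open>y \<otimes> w\<close>, and by convergence also with
  \<open>\<xi>\<close>.\<close>

lemma clean_jump_shadow:
  assumes \<mu>: "set_pmf \<mu> \<subseteq> carrier G" and h: "h \<in> space (increments G \<mu>)" and \<xi>: "\<xi> \<in> bd"
    and conv: "\<And>r. gp_ge (random_walk G h) (rep \<xi>) r"
    and jump: "random_increments.clean_jump G S W c N L h"
    and W: "W \<subseteq> carrier G" "\<And>w. w \<in> W \<Longrightarrow> 2 * c + \<delta> \<le> len w"
  shows "\<exists>y w. y \<in> carrier G \<and> len y \<le> L \<and> w \<in> W \<and> \<xi> \<in> shadow (y \<otimes> w) (len y + len w - (3 * c + 2 * \<delta>))"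
proof -
  interpret random_increments G S \<mu> by unfold_locales (rule \<mu>)
  obtain T where T: "h T \<in> W" "gp (inv (random_walk G h T)) (h T) < c" "len (random_walk G h T) \<le> L"
    "\<And>n\<^sub>0. \<exists>n\<ge>n\<^sub>0. gp (inv (h T)) (random_walk G (\<lambda>i. h (Suc T + i)) n) < c"
    using jump unfolding clean_jump_def by blast
  define y where "y = random_walk G h T"
  define w where "w = h T"
  have y: "y \<in> carrier G" unfolding y_def by (rule walk_closed0[OF h])
  have w: "w \<in> carrier G" "w \<in> W" using T(1) W(1) by (auto simp: w_def)
  have yw: "y \<otimes> w \<in> carrier G" using y w by simp
  define s where "s = len y + len w - 3 * c - \<delta>"
  obtain M where M: "\<And>n m. M \<le> n \<Longrightarrow> M \<le> m \<Longrightarrow> s \<le> gp (random_walk G h n) (rep \<xi> m)"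
    using conv[of s] unfolding gp_ge_def by blast
  obtain n where n: "M \<le> n" "gp (inv w) (random_walk G (\<lambda>i. h (Suc T + i)) n) < c"
    using T(4)[of M] unfolding w_def by blast
  let ?z = "random_walk G (\<lambda>i. h (Suc T + i)) n"
  have z: "?z \<in> carrier G" by (rule walk_closed[OF h])
  have "random_walk G h (Suc T + n) = y \<otimes> w \<otimes> ?z"
    using walk_add[OF h, of "Suc T" n] by (simp add: y_def w_def)
  then have 1: "s \<le> gp (y \<otimes> w) (random_walk G h (Suc T + n))"
    using no_cancellation[OF y w(1) z _ n(2) W(2)[OF w(2)]] T(2) by (simp add: s_def y_def w_def)
  have "gp_ge (\<lambda>_. y \<otimes> w) (rep \<xi>) (s - \<delta>)"
  proof (rule gp_geI[of M])
    fix k m :: nat assume m: "M \<le> m"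
    have "min s s - \<delta> \<le> gp (y \<otimes> w) (rep \<xi> m)"
      by (rule gp_hyperbolicD[OF 1 M[OF _ m] yw walk_closed0[OF h] rep_closed[OF \<xi>]]) (use n(1) in simp)
    then show "s - \<delta> \<le> gp (y \<otimes> w) (rep \<xi> m)" by simp
  qed
  moreover have "s - \<delta> = len y + len w - (3 * c + 2 * \<delta>)" by (simp add: s_def)
  ultimately have "\<xi> \<in> shadow (y \<otimes> w) (len y + len w - (3 * c + 2 * \<delta>))"
    using \<xi> by (simp only: shadow_def mem_Collect_eq simp_thms)
  then show ?thesis using y w T(3) y_def by blast
qed

text \<open>The constant \<open>c j\<close> and the bound \<open>2 * (4 ^ j)\<^sup>2\<close> on the
  number of jumps depend on \<open>j\<close> only. The length \<open>k j\<close> is chosen after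
  them, so the exponential factor in \<open>price\<close> can absorb everything else.\<close>

lemma singular_walk:
  assumes "conformal_boundary G S \<delta> bd rep bact da a C P D"
  shows "\<exists>\<mu>. set_pmf \<mu> \<subseteq> carrier G \<and> map_pmf (\<lambda>w. inv w) \<mu> = \<mu> \<and> S \<subseteq> set_pmf \<mu> \<and>
     (\<integral>\<^sup>+ g. ennreal (len g) \<partial>measure_pmf \<mu>) \<le> ennreal 2 \<and>
     (\<exists>Z\<in>sets P. emeasure P Z = 0 \<and> (AE h in increments G \<mu>. \<forall>\<xi>\<in>bd.
        limitin (bord_topology X dX b) (\<lambda>n. Inl (cayley_act G (random_walk G h n) b)) \<xi> sequentially \<longrightarrow> \<xi> \<in> Z))"
proof -
  interpret conformal_boundary G S \<delta> bd rep bact da a C P D by (rule assms)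
  obtain K where K': "0 \<le> K \<and> (\<forall>(L::nat) (W::'g set) c k. finite W \<longrightarrow> (\<forall>w\<in>W. real k \<le> len w) \<longrightarrow>
     (\<Sum>(y, w)\<in>{y \<in> carrier G. word_length G S y \<le> L} \<times> W. ((C * a powr \<delta> + 2) * a powr (- (len y + len w - c))) powr D)
       \<le> K * (real L + 1) * real (card W) * a powr (D * (c - real k)))"
    using jump_shadows_cost ..
  have K: "0 \<le> K" and cost: "\<And>(L::nat) (W::'g set) c k. finite W \<Longrightarrow> (\<And>w. w \<in> W \<Longrightarrow> real k \<le> len w) \<Longrightarrow>
     (\<Sum>(y, w)\<in>{y \<in> carrier G. word_length G S y \<le> L} \<times> W. ((C * a powr \<delta> + 2) * a powr (- (len y + len w - c))) powr D)
       \<le> K * (real L + 1) * real (card W) * a powr (D * (c - real k))"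
    using K'[THEN conjunct1] K'[THEN conjunct2, rule_format] by blast+
  define J where "J j c k \<rho> \<longleftrightarrow> finite (set_pmf \<rho>) \<and> card (set_pmf \<rho>) \<le> 2 * (4 ^ j)\<^sup>2 \<and> set_pmf \<rho> \<subseteq> carrier G \<and>
      (\<forall>w\<in>set_pmf \<rho>. k \<le> word_length G S w \<and> word_length G S w \<le> k + c) \<and> map_pmf (\<lambda>w. inv w) \<rho> = \<rho> \<and>
      (\<forall>y\<in>carrier G. measure_pmf.prob \<rho> {w. real c \<le> gp y w} \<le> 1 / real (4 ^ j))"
    for j c k :: nat and \<rho> :: "'g pmf"
  have "\<exists>c. \<forall>k0. \<exists>k\<ge>k0. \<exists>\<rho>. J j c k \<rho>" for j
    unfolding J_def by (rule spread_jumps[of "4 ^ j"]) (simp, blast)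
  then obtain c where c: "\<And>j k0. \<exists>k\<ge>k0. \<exists>\<rho>. J j (c j) k \<rho>" by metis
  \<comment> \<open>\<open>A j * l j\<close> is the radius that the Markov estimate needs for the
    walk up to time \<open>N j\<close>, see \<open>AL\<close>.\<close>
  define A :: "nat \<Rightarrow> nat" where "A j = 2 ^ j * (2 * (2 ^ j * 2 ^ Suc j))" for j
  define s where "s j = 3 * real (c j) + 2 * \<delta>" for j
  define price where "price j k = K * (real (A j) * (real k + real (c j)) + 1) * real (2 * (4 ^ j)\<^sup>2) * a powr (D * (s j - real k))" for j k
  \<comment> \<open>\<open>2 \<le> k\<close> keeps the jumps apart from the generators, and
    \<open>2 * c j + \<delta> \<le> k\<close> is the length required by
    \<open>no_cancellation\<close>.\<close>
  define good where "good j = (\<lambda>(k, \<rho>). J j (c j) k \<rho> \<and> 2 \<le> k \<and> 2 * real (c j) + \<delta> \<le> real k \<and> price j k \<le> (1 / 2) ^ j)" for j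
  have good_ex: "\<exists>x. good j x \<and> m < fst x" for j m
  proof -
    have "price j \<longlonglongrightarrow> 0" unfolding price_def by (rule exponential_beats_linear[OF a_gt_1 D_pos])
    then have "eventually (\<lambda>k. price j k < (1 / 2) ^ j) sequentially" by (rule order_tendstoD) simp
    then obtain k1 where k1: "\<And>k. k1 \<le> k \<Longrightarrow> price j k < (1 / 2) ^ j" unfolding eventually_sequentially by blast
    define k0 where "k0 = max (max k1 (Suc m)) (max 2 (nat \<lceil>2 * real (c j) + \<delta>\<rceil>))"
    obtain k \<rho> where k: "k0 \<le> k" "J j (c j) k \<rho>" using c[of k0 j] by blast
    have "k1 \<le> k" "m < k" "2 \<le> k" "2 * real (c j) + \<delta> \<le> real k" using k(1) unfolding k0_def by linarith+
    then show ?thesis using k(2) k1[of k] by (intro exI[of _ "(k, \<rho>)"]) (simp add: good_def less_imp_le)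
  qed
  \<comment> \<open>Each scale starts beyond the longest jumps of the preceding one, which makes the
    length intervals disjoint.\<close>
  have "\<exists>f. \<forall>n. good n (f n) \<and> fst (f n) + c n < fst (f (Suc n))"
    by (rule dependent_nat_choice) (use good_ex in blast)+
  then obtain f where f: "\<And>n. good n (f n)" "\<And>n. fst (f n) + c n < fst (f (Suc n))" by blast
  define k where "k n = fst (f n)" for n
  define \<rho> where "\<rho> n = snd (f n)" for n
  define l where "l n = k n + c n" for n
  have g: "J n (c n) (k n) (\<rho> n)" "2 \<le> k n" "2 * real (c n) + \<delta> \<le> real (k n)" "price n (k n) \<le> (1 / 2) ^ n" for n
    using f(1)[of n] unfolding good_def k_def \<rho>_def by (auto simp: case_prod_beta)
  have \<rho>: "finite (set_pmf (\<rho> n))" "card (set_pmf (\<rho> n)) \<le> 2 * (4 ^ n)\<^sup>2" "set_pmf (\<rho> n) \<subseteq> carrier G"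
    "\<And>w. w \<in> set_pmf (\<rho> n) \<Longrightarrow> k n \<le> word_length G S w \<and> word_length G S w \<le> l n"
    "map_pmf (\<lambda>w. inv w) (\<rho> n) = \<rho> n"
    "\<And>y. y \<in> carrier G \<Longrightarrow> measure_pmf.prob (\<rho> n) {w. real (c n) \<le> gp y w} \<le> 1 / 4 ^ n" for n
    using g(1)[of n] unfolding J_def l_def by simp_all
  have kl: "k n \<le> l n" "l n < k (Suc n)" for n using f(2)[of n] by (simp_all add: l_def k_def)
  note mix = \<rho>(3,4,5) g(2) kl
  define \<mu> where "\<mu> = jump_mixture \<rho> l"
  have \<mu>: "set_pmf \<mu> \<subseteq> carrier G" "map_pmf (\<lambda>w. inv w) \<mu> = \<mu>" "S \<subseteq> set_pmf \<mu>"
    "(\<integral>\<^sup>+ g. ennreal (len g) \<partial>measure_pmf \<mu>) \<le> ennreal 2"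
    unfolding \<mu>_def
    using jump_mixture_closed[of \<rho> k l, OF mix] jump_mixture_sym[of \<rho> k l, OF mix]
      set_jump_mixture[of \<rho> k l, OF mix] jump_mixture_mean[of \<rho> k l, OF mix] by auto
  interpret R: random_increments G S \<mu> by unfold_locales (rule \<mu>(1))
  define N where "N j = 2 ^ j * (2 ^ Suc j * l j)" for j
  have AL: "real (A j * l j) = 2 ^ j * (2 * real (N j))" for j by (simp add: A_def N_def)
  have "AE h in increments G \<mu>. eventually (\<lambda>j. R.clean_jump (set_pmf (\<rho> j)) (real (c j)) (N j) (real (A j * l j)) h) sequentially"
  proof (rule R.AE_eventually_clean_jump)
    fix j
    note * = prob_no_clean_jump_mixture[of \<rho> k l j "real (c j)" "N j" "real (A j * l j)", OF mix \<rho>(1) \<rho>(6) N_def AL, folded \<mu>_def]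
    show "{h \<in> space (increments G \<mu>). \<not> R.clean_jump (set_pmf (\<rho> j)) (real (c j)) (N j) (real (A j * l j)) h} \<in> sets (increments G \<mu>)"
      by (rule *(1))
    show "R.increments.prob {h \<in> space (increments G \<mu>). \<not> R.clean_jump (set_pmf (\<rho> j)) (real (c j)) (N j) (real (A j * l j)) h} \<le> 4 * (1 / 2) ^ j"
      by (rule *(2))
  qed
  define I where "I j = {y \<in> carrier G. word_length G S y \<le> A j * l j} \<times> set_pmf (\<rho> j)" for j
  define Q where "Q j = (\<Union>(y, w)\<in>I j. shadow_hull (y \<otimes> w) (len y + len w - s j))" for j
  \<comment> \<open>Limit points lie in \<open>Q j\<close> for all large \<open>j\<close>, that is,
    in some \<open>Z i\<close>. Each \<open>Z i\<close> is contained in \<open>Q j\<close> for every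
    \<open>j \<ge> i\<close>, and the cost of \<open>Q j\<close> tends to zero.\<close>
  define Z where "Z i = (\<Inter>j\<in>{i..}. Q j)" for i :: nat
  have Qs: "Q j \<in> sets P" for j
    unfolding Q_def using openin_shadow_hull by (intro openin_P openin_Union) auto
  have Zs: "Z i \<in> sets P" for i unfolding Z_def using Qs by (intro sets.countable_INT') auto
  have Z0: "hm (Z i) = 0" for i
  proof (rule null_set_of_shadows[where 'i = "'g \<times> 'g"])
    fix \<epsilon> :: real assume \<epsilon>: "0 < \<epsilon>"
    have "(\<lambda>j. (1 / 2 :: real) ^ j) \<longlonglongrightarrow> 0" by (rule LIMSEQ_realpow_zero) auto
    then have "eventually (\<lambda>j. (1 / 2 :: real) ^ j < \<epsilon>) sequentially" using \<epsilon> by (rule order_tendstoD)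
    then obtain j0 where j0: "\<And>j. j0 \<le> j \<Longrightarrow> (1 / 2 :: real) ^ j < \<epsilon>" unfolding eventually_sequentially by blast
    define j where "j = max i j0"
    have fin: "finite (I j)"
      unfolding I_def by (intro finite_cartesian_product finite_ball[of "real (A j * l j)", unfolded of_nat_le_iff] \<rho>(1))
    have "(\<Sum>p\<in>I j. ((C * a powr \<delta> + 2) * a powr (- (len (fst p) + len (snd p) - s j))) powr D)
        = (\<Sum>(y, w)\<in>I j. ((C * a powr \<delta> + 2) * a powr (- (len y + len w - s j))) powr D)"
      by (simp add: case_prod_beta)
    also have "\<dots> \<le> K * (real (A j * l j) + 1) * real (card (set_pmf (\<rho> j))) * a powr (D * (s j - real (k j)))"
      unfolding I_def by (rule cost[OF \<rho>(1)]) (use \<rho>(4) in simp)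
    also have "\<dots> \<le> K * (real (A j * l j) + 1) * real (2 * (4 ^ j)\<^sup>2) * a powr (D * (s j - real (k j)))"
      using K \<rho>(2)[of j] by (intro mult_right_mono mult_left_mono of_nat_mono) auto
    also have "\<dots> = price j (k j)" by (simp add: price_def l_def)
    also have "\<dots> \<le> (1 / 2) ^ j" by (rule g(4))
    also have "\<dots> \<le> \<epsilon>" using j0[of j] by (simp add: j_def)
    finally have sum: "(\<Sum>p\<in>I j. ((C * a powr \<delta> + 2) * a powr (- (len (fst p) + len (snd p) - s j))) powr D) \<le> \<epsilon>" .
    have "Z i \<subseteq> Q j" unfolding Z_def j_def by (rule INF_lower) simp
    then have sub: "Z i \<subseteq> (\<Union>p\<in>I j. shadow_hull (fst p \<otimes> snd p) (len (fst p) + len (snd p) - s j))"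
      unfolding Q_def by (simp add: case_prod_beta)
    have cl: "\<forall>p\<in>I j. fst p \<otimes> snd p \<in> carrier G" unfolding I_def using \<rho>(3)[of j] by auto
    show "\<exists>(I :: ('g \<times> 'g) set) x t. finite I \<and> (\<forall>i\<in>I. x i \<in> carrier G) \<and> Z i \<subseteq> (\<Union>i\<in>I. shadow_hull (x i) (t i)) \<and>
       (\<Sum>i\<in>I. ((C * a powr \<delta> + 2) * a powr (- t i)) powr D) \<le> \<epsilon>"
      using fin cl sub sum by (intro exI conjI)
  qed
  have "emeasure P (\<Union>i. Z i) = 0"
    using Zs Z0 emeasure_P_eq_0 by (intro emeasure_UN_eq_0) auto
  moreover have "(\<Union>i. Z i) \<in> sets P" using Zs by auto
  moreover have "AE h in increments G \<mu>. \<forall>\<xi>\<in>bd.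
        limitin (bord_topology X dX b) (\<lambda>n. Inl (cayley_act G (random_walk G h n) b)) \<xi> sequentially \<longrightarrow> \<xi> \<in> (\<Union>i. Z i)"
    using \<open>AE h in increments G \<mu>. eventually _ sequentially\<close> AE_space
  proof eventually_elim
    case (elim h)
    then obtain i where i: "\<And>j. i \<le> j \<Longrightarrow> R.clean_jump (set_pmf (\<rho> j)) (real (c j)) (N j) (real (A j * l j)) h"
      unfolding eventually_sequentially by blast
    have h: "h \<in> space (increments G \<mu>)" by fact
    show ?case
    proof (intro ballI impI)
      fix \<xi> assume \<xi>: "\<xi> \<in> bd"
        and lim: "limitin (bord_topology X dX b) (\<lambda>n. Inl (cayley_act G (random_walk G h n) b)) \<xi> sequentially"
      have conv: "gp_ge (random_walk G h) (rep \<xi>) r" for r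
        by (rule orbit_converges_gp_ge[OF R.walk_closed0[OF h] \<xi> lim])
      have "\<xi> \<in> Q j" if j: "i \<le> j" for j
      proof -
        have "2 * real (c j) + \<delta> \<le> len w" if "w \<in> set_pmf (\<rho> j)" for w
          using g(3)[of j] \<rho>(4)[OF that] by linarith
        then obtain y w where yw: "y \<in> carrier G" "len y \<le> real (A j * l j)" "w \<in> set_pmf (\<rho> j)"
          "\<xi> \<in> shadow (y \<otimes> w) (len y + len w - (3 * real (c j) + 2 * \<delta>))"
          using clean_jump_shadow[OF \<mu>(1) h \<xi> conv i[OF j] \<rho>(3)] by blast
        have "\<xi> \<in> shadow_hull (y \<otimes> w) (len y + len w - s j)"
          using yw(4) shadow_subset_hull unfolding s_def by blast
        moreover have "(y, w) \<in> I j" unfolding I_def using yw by (simp del: of_nat_mult)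
        ultimately show ?thesis unfolding Q_def by blast
      qed
      then have "\<xi> \<in> Z i" unfolding Z_def by blast
      then show "\<xi> \<in> (\<Union>i. Z i)" by blast
    qed
  qed
  ultimately show ?thesis using \<mu> by blast
qed

section \<open>Limits of paths and the harmonic measure\<close>

lemma walk_limit_bd: "walk_limit G S b h \<in> bd"
  and walk_limit_eq: "\<xi> \<in> bd \<Longrightarrow> limitin (bord_topology X dX b) (\<lambda>n. Inl (cayley_act G (random_walk G h n) b)) \<xi> sequentially \<Longrightarrow>
    walk_limit G S b h = \<xi>"
  and walk_limit_junk: "\<not> (\<exists>\<xi>\<in>bd. limitin (bord_topology X dX b) (\<lambda>n. Inl (cayley_act G (random_walk G h n) b)) \<xi> sequentially) \<Longrightarrow>
    walk_limit G S b h = (SOME \<xi>. \<xi> \<in> bd)"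
proof -
  interpret B: Metric_space "bordification X dX" da by (rule metric)
  define L where "L \<xi> \<longleftrightarrow> \<xi> \<in> bd \<and> limitin (bord_topology X dX b) (\<lambda>n. Inl (cayley_act G (random_walk G h n) b)) \<xi> sequentially" for \<xi>
  have wl: "walk_limit G S b h = (if \<exists>\<xi>. L \<xi> then THE \<xi>. L \<xi> else SOME \<xi>. \<xi> \<in> bd)"
    unfolding walk_limit_def L_def Let_def by (rule refl)
  have uniq: "\<xi> = \<eta>" if "L \<xi>" "L \<eta>" for \<xi> \<eta>
    using that B.limitin_metric_unique[of _ \<xi> sequentially \<eta>] unfolding L_def topology[symmetric] by auto
  have eq: "walk_limit G S b h = \<xi>" if "L \<xi>" for \<xi>
    unfolding wl using that uniq by (auto intro: the_equality)
  show "\<xi> \<in> bd \<Longrightarrow> limitin (bord_topology X dX b) (\<lambda>n. Inl (cayley_act G (random_walk G h n) b)) \<xi> sequentially \<Longrightarrow>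
    walk_limit G S b h = \<xi>" using eq[of \<xi>] by (simp add: L_def)
  show junk: "\<not> (\<exists>\<xi>\<in>bd. limitin (bord_topology X dX b) (\<lambda>n. Inl (cayley_act G (random_walk G h n) b)) \<xi> sequentially) \<Longrightarrow>
    walk_limit G S b h = (SOME \<xi>. \<xi> \<in> bd)" unfolding wl by (auto simp: L_def)
  obtain \<xi>0 where "\<xi>0 \<in> bd" using third_point by blast
  then have "(SOME \<xi>. \<xi> \<in> bd) \<in> bd" by (rule someI)
  then show "walk_limit G S b h \<in> bd"
    using eq wl unfolding L_def by (cases "\<exists>\<xi>. L \<xi>") (auto simp: L_def)
qed

lemma boundary_topology_eq: "boundary_topology X dX b = da.mtopology"
proof -
  interpret Submetric "bordification X dX" da bd
    using metric bd_subset by (simp add: Submetric_def Submetric_axioms_def)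
  show ?thesis unfolding boundary_topology_def topology[symmetric] using mtopology_submetric by simp
qed

lemma exists_singular_walk:
  "\<exists>\<mu>. set_pmf \<mu> \<subseteq> carrier G \<and> map_pmf (\<lambda>w. inv w) \<mu> = \<mu> \<and> S \<subseteq> set_pmf \<mu> \<and>
     (\<integral>\<^sup>+ g. ennreal (len g) \<partial>measure_pmf \<mu>) \<le> ennreal 2 \<and>
     mutually_singular (harmonic_measure G S b \<mu>) (hausdorff_prob bd da)"
proof -
  define P where "P = hausdorff_prob bd da"
  define D where "D = hausdorff_dim bd da"
  have opens: "sets (borel_of da.mtopology) \<subseteq> Pow bd"
    using sets.space_closed[of "borel_of da.mtopology"] by (simp add: space_borel_of)
  have sig: "sigma_sets bd (sets (borel_of da.mtopology)) = sets (borel_of da.mtopology)"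
    using sets.sigma_sets_eq[of "borel_of da.mtopology"] by (simp add: space_borel_of)
  have sP: "sets P = sets (borel_of da.mtopology)"
    unfolding P_def hausdorff_prob_def by (simp add: sets_measure_of[OF opens] sig)
  have spP: "space P = bd" using sets_eq_imp_space_eq[OF sP] by (simp add: space_borel_of)
  have sH: "sets (harmonic_measure G S b \<mu>) = sets P" "space (harmonic_measure G S b \<mu>) = bd" for \<mu>
    unfolding harmonic_measure_def by (simp_all add: boundary_topology_eq sP space_borel_of)
  have lazy: "set_pmf lazy_gens \<subseteq> carrier G" "map_pmf (\<lambda>w. inv w) lazy_gens = lazy_gens" "S \<subseteq> set_pmf lazy_gens"
    "(\<integral>\<^sup>+ g. ennreal (len g) \<partial>measure_pmf lazy_gens) \<le> ennreal 2"
  proof -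
    show "set_pmf lazy_gens \<subseteq> carrier G" "S \<subseteq> set_pmf lazy_gens" using gens_closed by (auto simp: set_lazy_gens)
    show "map_pmf (\<lambda>w. inv w) lazy_gens = lazy_gens" by (rule lazy_gens_sym)
    have "ennreal (len w) \<le> ennreal 2" if "w \<in> set_pmf lazy_gens" for w
      using lazy_gens_len[OF that] by (intro ennreal_leI) simp
    then have "(\<integral>\<^sup>+ g. ennreal (len g) \<partial>measure_pmf lazy_gens) \<le> (\<integral>\<^sup>+ g. ennreal 2 \<partial>measure_pmf lazy_gens)"
      by (intro nn_integral_mono_AE) (simp add: AE_measure_pmf_iff)
    then show "(\<integral>\<^sup>+ g. ennreal (len g) \<partial>measure_pmf lazy_gens) \<le> ennreal 2" by simp
  qed
  show ?thesis
  proof (cases "emeasure P bd = 0")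
    \<comment> \<open>This is the junk case of \<open>hausdorff_prob\<close>: total Hausdorff measure \<open>0\<close> or \<open>\<infinity>\<close>, or no measure at all.\<close>
    case True
    have "mutually_singular (harmonic_measure G S b lazy_gens) P"
      unfolding mutually_singular_def sH using True spP by (intro conjI refl bexI[of _ "{}"]) auto
    then show ?thesis using lazy unfolding P_def by blast
  next
    case False
    let ?f = "\<lambda>Z. hausdorff_measure bd da Z D / hausdorff_measure bd da bd D"
    have bdP: "bd \<in> sets P" using sets.top[of P] spP by simp
    \<comment> \<open>\<open>measure_of\<close> yields the zero measure unless the given function is
      a measure, so nonzero mass shows that the Hausdorff measure is countably additive on the Borel
      sets.\<close>
    have ms: "measure_space bd (sets (borel_of da.mtopology)) ?f"
      using False unfolding P_def hausdorff_prob_def D_def emeasure_measure_of_conv sig by (auto split: if_splits)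
    have eP: "emeasure P Z = ?f Z" if "Z \<in> sets P" for Z
      using that ms sP unfolding P_def hausdorff_prob_def D_def emeasure_measure_of_conv sig by simp
    have tot: "hausdorff_measure bd da bd D \<noteq> 0" "hausdorff_measure bd da bd D \<noteq> \<infinity>"
      using False eP[OF bdP] by auto
    have "emeasure P (space P) = 1"
      unfolding spP eP[OF bdP] using tot by (simp add: ennreal_divide_self top.not_eq_extremum)
    then interpret P: prob_space P by (rule prob_spaceI)
    have "conformal_boundary G S \<delta> bd rep bact da a C P D"
      by unfold_locales (use sP eP tot in auto)
    then interpret conformal_boundary G S \<delta> bd rep bact da a C P D .
    obtain \<mu> Z where \<mu>: "set_pmf \<mu> \<subseteq> carrier G" "map_pmf (\<lambda>w. inv w) \<mu> = \<mu>" "S \<subseteq> set_pmf \<mu>"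
      "(\<integral>\<^sup>+ g. ennreal (len g) \<partial>measure_pmf \<mu>) \<le> ennreal 2"
      and Z: "Z \<in> sets P" "emeasure P Z = 0"
      and ae: "AE h in increments G \<mu>. \<forall>\<xi>\<in>bd.
        limitin (bord_topology X dX b) (\<lambda>n. Inl (cayley_act G (random_walk G h n) b)) \<xi> sequentially \<longrightarrow> \<xi> \<in> Z"
      using singular_walk[OF \<open>conformal_boundary G S \<delta> bd rep bact da a C P D\<close>] by blast
    interpret R: random_increments G S \<mu> by unfold_locales (rule \<mu>(1))
    \<comment> \<open>The value of \<open>walk_limit\<close> on divergent paths; points are Hausdorff null, so no convergence theorem is needed.\<close>
    define \<xi>0 where "\<xi>0 = (SOME \<xi>. \<xi> \<in> bd)"
    obtain \<xi>1 where "\<xi>1 \<in> bd" using third_point by blast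
    then have \<xi>0: "\<xi>0 \<in> bd" unfolding \<xi>0_def by (rule someI)
    have cl: "bd - {\<xi>0} \<in> sets P"
    proof (rule openin_P)
      have "closedin da.mtopology {\<xi>0}"
        using da.Hausdorff_space_mtopology \<xi>0 by (intro closedin_Hausdorff_sing_eq[THEN iffD2]) auto
      then show "openin da.mtopology (bd - {\<xi>0})" unfolding closedin_def by simp
    qed
    have s0: "{\<xi>0} \<in> sets P"
    proof -
      have "space P - (bd - {\<xi>0}) \<in> sets P" using cl by (rule sets.compl_sets)
      moreover have "space P - (bd - {\<xi>0}) = {\<xi>0}" using spP \<xi>0 by auto
      ultimately show ?thesis by simp
    qed
    have p0: "emeasure P {\<xi>0} = 0"
      by (rule emeasure_P_eq_0[OF s0 hausdorff_measure_singleton[OF da.Metric_space_axioms D_pos \<xi>0]])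
    define B where "B = bd - (Z \<union> {\<xi>0})"
    have Bs: "B \<in> sets P" unfolding B_def by (intro sets.Diff sets.Un bdP Z(1) s0)
    have "emeasure P (space P - B) = 0"
    proof -
      have "space P - B \<subseteq> Z \<union> {\<xi>0}" unfolding B_def spP by auto
      then have "emeasure P (space P - B) \<le> emeasure P (Z \<union> {\<xi>0})" by (rule emeasure_mono) (intro sets.Un Z(1) s0)
      also have "\<dots> \<le> emeasure P Z + emeasure P {\<xi>0}" using Z(1) s0 by (rule emeasure_subadditive)
      finally show ?thesis using Z(2) p0 by simp
    qed
    moreover have "emeasure (harmonic_measure G S b \<mu>) B = 0"
    proof (cases "walk_limit G S b \<in> measurable (increments G \<mu>) (borel_of (boundary_topology X dX b))")
      case False
      show ?thesis
        unfolding harmonic_measure_def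
        by (rule distr_not_measurable[OF R.increments.prob_space_axioms _ False])
          (simp add: boundary_topology_eq space_borel_of walk_limit_bd)
    next
      case True
      have B': "B \<in> sets (borel_of (boundary_topology X dX b))" using Bs by (simp add: boundary_topology_eq sP)
      have "AE h in increments G \<mu>. walk_limit G S b h \<notin> B"
        using ae
      proof eventually_elim
        case (elim h)
        show ?case
        proof (cases "\<exists>\<xi>\<in>bd. limitin (bord_topology X dX b) (\<lambda>n. Inl (cayley_act G (random_walk G h n) b)) \<xi> sequentially")
          case True
          then show ?thesis using elim walk_limit_eq unfolding B_def by fastforce
        next
          case False
          then show ?thesis using walk_limit_junk[OF False] unfolding B_def \<xi>0_def by simp
        qed
      qed
      then have "emeasure (increments G \<mu>) (walk_limit G S b -` B \<inter> space (increments G \<mu>)) = 0"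
        using measurable_sets[OF True B'] by (subst (asm) AE_iff_measurable[OF _ refl]) (auto simp: vimage_def Int_def conj_commute)
      then show ?thesis unfolding harmonic_measure_def by (subst emeasure_distr[OF True B'])
    qed
    ultimately have "mutually_singular (harmonic_measure G S b \<mu>) P"
      unfolding mutually_singular_def using Bs sH by auto
    then show ?thesis using \<mu> unfolding P_def by blast
  qed
qed

end

theorem corollary5p1:
  fixes G :: "('g, 'm) monoid_scheme" and S :: "'g set" and b :: "'g \<Rightarrow> real" and a :: real
    and da :: "('g \<Rightarrow> real) bord \<Rightarrow> ('g \<Rightarrow> real) bord \<Rightarrow> real"
  assumes hyperbolic: "hyperbolic_group G"
    and generating: "finite S" "symmetric_generating_system G S"
    and non_elementary: "infinite (cayley_boundary G S) \<or> card (cayley_boundary G S) > 2"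
    and base_point: "b \<in> cayley_graph G S"
    and metric: "a > 1" "visual_metric (cayley_graph G S) (cayley_dist G S) b a da"
  shows "\<exists>\<mu> :: 'g pmf.
           set_pmf \<mu> \<subseteq> carrier G \<and>
           (\<forall>g \<in> carrier G. pmf \<mu> (inv\<^bsub>G\<^esub> g) = pmf \<mu> g) \<and>
           (\<lambda>g. pmf \<mu> g * cayley_dist G S b (cayley_act G g b)) summable_on carrier G \<and>
           generate G (set_pmf \<mu>) = carrier G \<and>
           mutually_singular (harmonic_measure G S b \<mu>) (hausdorff_prob (cayley_boundary G S) da)"
proof -
  obtain \<delta> where "hyperbolic_word_metric G S \<delta>"
    using hyperbolic_group_word_metric[OF hyperbolic generating] by blast
  then interpret hyperbolic_word_metric G S \<delta> .
  obtain C0 where C0: "C0 > 0"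
    "\<And>x y. x \<in> bordification X dX \<Longrightarrow> y \<in> bordification X dX \<Longrightarrow> da x y \<le> C0 * exp_neg a (ext_gromov_product X dX b x y)"
    "\<And>x y. x \<in> cayley_boundary G S \<Longrightarrow> y \<in> cayley_boundary G S \<Longrightarrow> inverse C0 * exp_neg a (ext_gromov_product X dX b x y) \<le> da x y"
    using metric(2) unfolding visual_metric_def by blast
  have da: "Metric_space (bordification X dX) da" "Metric_space.mtopology (bordification X dX) da = bord_topology X dX b"
    using metric(2) unfolding visual_metric_def by blast+
  interpret cayley_visual_boundary G S \<delta> b a C0 da
    by (intro cayley_visual_boundary.intro cayley_visual_boundary_axioms.intro)
      (rule hyperbolic_word_metric_axioms base_point metric(1) C0 da non_elementary | assumption)+
  obtain \<mu> where \<mu>: "set_pmf \<mu> \<subseteq> carrier G" "map_pmf (\<lambda>w. inv\<^bsub>G\<^esub> w) \<mu> = \<mu>" "S \<subseteq> set_pmf \<mu>"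
    "(\<integral>\<^sup>+ g. ennreal (len g) \<partial>measure_pmf \<mu>) \<le> ennreal 2"
    "mutually_singular (harmonic_measure G S b \<mu>) (hausdorff_prob bd da)"
    using exists_singular_walk by blast
  show ?thesis
    using \<mu>(1,5) pmf_inv_eq[OF \<mu>(2,1)] first_moment_summable[OF base_point \<mu>(4)] generate_support[OF \<mu>(3,1)]
    by (intro exI[of _ \<mu>]) simp
qed

end
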